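(* Let $H$ be a complex Hilbert space, $A:D(A)\subseteq H\to H$ a maximal monotone linear operator, $M_0,M_1\in L(H)$ with $M_0$ selfadjoint and non-negative and $\operatorname{Re}M_1\ge c>1$, and let $h<0$. Let $\nu_0>0$ be the number satisfying $\nu_0\|M_0\|+e^{-\nu_0h}=c$. Then for each $\rho>0$ the operator $\partial_{0,\rho}M_0+\tau_h+M_1+A$ on $H_{\rho,0}(\mathbb{R};H)$ has a boundedly invertible closure and the solution operator $\big(\overline{\partial_{0,\rho}M_0+\tau_h+M_1+A}\big)^{-1}$ is exponentially stable with stability rate $\nu_0$.
   Context: $\operatorname{Re}T=\frac12(T+T^* )$ and $T\ge c$ means $\operatorname{Re}\langle Tx|x\rangle\ge c|x|^2$ for all $x$. $H_{\rho,0}(\mathbb{R};H)$ is the Hilbert space of (classes of) measurable $f:\mathbb{R}\to H$ with $\int|f(t)|^2e^{-2\rho t}\,\mathrm{d}t<\infty$; $\partial_{0,\rho}$ is the closure in it of the derivative on $C_c^\infty(\mathbb{R};H)$; $\tau_h$ is the time translation $(\tau_hu)(t)=u(t+h)$; $M_0,M_1,A$ act pointwise in time. A solution operator $S_\rho\in L(H_{\rho,0}(\mathbb{R};H))$ is exponentially stable with stability rate $\nu_0>0$ if for each $0\le\nu<\nu_0$ and each $f\in H_{-\nu,0}(\mathbb{R};H)\cap H_{\rho,0}(\mathbb{R};H)$ one has $S_\rho f\in\bigcap_{-\nu<\mu\le\rho}H_{\mu,0}(\mathbb{R};H)$. *)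

theory Defs
  imports "HOL-Analysis.Analysis"
begin

text \<open>A complex Hilbert space is modelled as a real Banach space type 'a together with a
complex scalar multiplication sc (extending the real one) and a complex inner product ip
(linear in the first, conjugate linear in the second argument) inducing the norm.\<close>

definition chilbert :: "(complex \<Rightarrow> 'a::banach \<Rightarrow> 'a) \<Rightarrow> ('a \<Rightarrow> 'a \<Rightarrow> complex) \<Rightarrow> bool" where
  "chilbert sc ip \<longleftrightarrow>
     vector_space sc \<and>
     (\<forall>r x. sc (complex_of_real r) x = scaleR r x) \<and>
     (\<forall>x y z. ip (x + y) z = ip x z + ip y z) \<and>
     (\<forall>a x y. ip (sc a x) y = a * ip x y) \<and>
     (\<forall>x y. ip y x = cnj (ip x y)) \<and>
     (\<forall>x. ip x x = complex_of_real ((norm x)\<^sup>2))"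

definition bounded_clinear_op :: "(complex \<Rightarrow> 'a::banach \<Rightarrow> 'a) \<Rightarrow> ('a \<Rightarrow> 'a) \<Rightarrow> bool" where
  "bounded_clinear_op sc T \<longleftrightarrow> Vector_Spaces.linear sc sc T \<and> bounded_linear T"

text \<open>Linear operators A : D(A) \<subseteq> H \<rightarrow> H are represented by their graphs (a relation).\<close>
definition linear_operator :: "(complex \<Rightarrow> 'a::banach \<Rightarrow> 'a) \<Rightarrow> ('a \<times> 'a) set \<Rightarrow> bool" where
  "linear_operator sc A \<longleftrightarrow>
     (0, 0) \<in> A \<and>
     (\<forall>x u y v. (x, u) \<in> A \<longrightarrow> (y, v) \<in> A \<longrightarrow> (x + y, u + v) \<in> A) \<and>
     (\<forall>a x u. (x, u) \<in> A \<longrightarrow> (sc a x, sc a u) \<in> A) \<and>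
     (\<forall>x u v. (x, u) \<in> A \<longrightarrow> (x, v) \<in> A \<longrightarrow> u = v)"

definition monotone_rel :: "('a \<Rightarrow> 'a \<Rightarrow> complex) \<Rightarrow> ('a::banach \<times> 'a) set \<Rightarrow> bool" where
  "monotone_rel ip B \<longleftrightarrow>
     (\<forall>x u y v. (x, u) \<in> B \<longrightarrow> (y, v) \<in> B \<longrightarrow> Re (ip (u - v) (x - y)) \<ge> 0)"

definition maximal_monotone :: "('a \<Rightarrow> 'a \<Rightarrow> complex) \<Rightarrow> ('a::banach \<times> 'a) set \<Rightarrow> bool" where
  "maximal_monotone ip A \<longleftrightarrow>
     monotone_rel ip A \<and> (\<forall>B. A \<subseteq> B \<longrightarrow> monotone_rel ip B \<longrightarrow> B = A)"

text \<open>Strong (Bochner) measurability: a.e. limit of Borel simple functions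
(no separability of H is assumed).\<close>
definition strongly_measurable :: "(real \<Rightarrow> 'a::banach) \<Rightarrow> bool" where
  "strongly_measurable f \<longleftrightarrow>
     (\<exists>s :: nat \<Rightarrow> real \<Rightarrow> 'a.
        (\<forall>n. s n \<in> borel_measurable lborel \<and> finite (range (s n))) \<and>
        (AE t in lborel. (\<lambda>n. s n t) \<longlonglongrightarrow> f t))"

definition wnorm_sq :: "real \<Rightarrow> (real \<Rightarrow> 'a::banach) \<Rightarrow> ennreal" where
  "wnorm_sq \<rho> f = (\<integral>\<^sup>+ t. ennreal ((norm (f t))\<^sup>2 * exp (- 2 * \<rho> * t)) \<partial>lborel)"

text \<open>Representatives of elements of H_{rho,0}(R;H).\<close>
definition Hrho :: "real \<Rightarrow> (real \<Rightarrow> 'a::banach) set" where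
  "Hrho \<rho> = {f. strongly_measurable f \<and> wnorm_sq \<rho> f < \<infinity>}"

definition nrm :: "real \<Rightarrow> (real \<Rightarrow> 'a::banach) \<Rightarrow> real" where
  "nrm \<rho> f = sqrt (enn2real (wnorm_sq \<rho> f))"

definition gclosure :: "real \<Rightarrow> ((real \<Rightarrow> 'a::banach) \<times> (real \<Rightarrow> 'a)) set
                         \<Rightarrow> ((real \<Rightarrow> 'a) \<times> (real \<Rightarrow> 'a)) set" where
  "gclosure \<rho> G = {(u, f). u \<in> Hrho \<rho> \<and> f \<in> Hrho \<rho> \<and>
      (\<exists>un fn. (\<forall>n. (un n, fn n) \<in> G \<and> un n \<in> Hrho \<rho> \<and> fn n \<in> Hrho \<rho>) \<and>
         (\<lambda>n. nrm \<rho> (\<lambda>t. un n t - u t)) \<longlonglongrightarrow> 0 \<and>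
         (\<lambda>n. nrm \<rho> (\<lambda>t. fn n t - f t)) \<longlonglongrightarrow> 0)}"

definition Cc_deriv_graph :: "((real \<Rightarrow> 'a::banach) \<times> (real \<Rightarrow> 'a)) set" where
  "Cc_deriv_graph = {(\<phi>, \<psi>). \<exists>d :: nat \<Rightarrow> real \<Rightarrow> 'a.
      d 0 = \<phi> \<and> d 1 = \<psi> \<and>
      (\<forall>k t. (d k has_vector_derivative d (Suc k) t) (at t)) \<and>
      (\<exists>R. \<forall>t. R < \<bar>t\<bar> \<longrightarrow> \<phi> t = 0)}"

definition d0_graph :: "real \<Rightarrow> ((real \<Rightarrow> 'a::banach) \<times> (real \<Rightarrow> 'a)) set" where
  "d0_graph \<rho> = gclosure \<rho> Cc_deriv_graph"

text \<open>Graph of the operator partial_{0,rho} M0 + tau_h + M1 + A on H_{rho,0}(R;H)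
(natural domain: D(partial_{0,rho} M0) intersected with D(A), A acting pointwise).\<close>
definition B_graph :: "real \<Rightarrow> real \<Rightarrow> ('a \<Rightarrow> 'a) \<Rightarrow> ('a \<Rightarrow> 'a) \<Rightarrow> ('a::banach \<times> 'a) set
                        \<Rightarrow> ((real \<Rightarrow> 'a) \<times> (real \<Rightarrow> 'a)) set" where
  "B_graph \<rho> h M0 M1 A = {(u, f). u \<in> Hrho \<rho> \<and> f \<in> Hrho \<rho> \<and>
      (\<exists>v w. ((\<lambda>t. M0 (u t)), v) \<in> d0_graph \<rho> \<and> w \<in> Hrho \<rho> \<and>
         (AE t in lborel. (u t, w t) \<in> A) \<and>
         (AE t in lborel. f t = v t + u (t + h) + M1 (u t) + w t))}"

text \<open>G is the graph of a boundedly invertible operator on H_{rho,0}(R;H) whose inverse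
(an element of L(H_{rho,0}(R;H)), acting on representatives) is S.\<close>
definition bdd_inverse :: "real \<Rightarrow> (complex \<Rightarrow> 'a::banach \<Rightarrow> 'a)
     \<Rightarrow> ((real \<Rightarrow> 'a) \<times> (real \<Rightarrow> 'a)) set \<Rightarrow> ((real \<Rightarrow> 'a) \<Rightarrow> (real \<Rightarrow> 'a)) \<Rightarrow> bool" where
  "bdd_inverse \<rho> sc G S \<longleftrightarrow>
     (\<forall>f \<in> Hrho \<rho>. S f \<in> Hrho \<rho>) \<and>
     (\<forall>f \<in> Hrho \<rho>. \<forall>g \<in> Hrho \<rho>. \<forall>a.
        nrm \<rho> (\<lambda>t. S (\<lambda>s. sc a (f s) + g s) t - (sc a (S f t) + S g t)) = 0) \<and>
     (\<exists>C. \<forall>f \<in> Hrho \<rho>. nrm \<rho> (S f) \<le> C * nrm \<rho> f) \<and>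
     (\<forall>u f. (u, f) \<in> G \<longleftrightarrow> u \<in> Hrho \<rho> \<and> f \<in> Hrho \<rho> \<and> nrm \<rho> (\<lambda>t. u t - S f t) = 0) \<and>
     (\<forall>u f g. (u, f) \<in> G \<longrightarrow> (u, g) \<in> G \<longrightarrow> nrm \<rho> (\<lambda>t. f t - g t) = 0)"

definition exp_stable :: "real \<Rightarrow> real \<Rightarrow> ((real \<Rightarrow> 'a::banach) \<Rightarrow> (real \<Rightarrow> 'a)) \<Rightarrow> bool" where
  "exp_stable \<rho> \<nu>0 S \<longleftrightarrow> \<nu>0 > 0 \<and>
     (\<forall>\<nu>. 0 \<le> \<nu> \<and> \<nu> < \<nu>0 \<longrightarrow>
        (\<forall>f. f \<in> Hrho (-\<nu>) \<and> f \<in> Hrho \<rho> \<longrightarrow>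
           (\<forall>\<mu>. -\<nu> < \<mu> \<and> \<mu> \<le> \<rho> \<longrightarrow> S f \<in> Hrho \<mu>)))"

end

theory Submission
  imports Defs
begin

text \<open>
  On \<open>Hrho \<mu>\<close> the real part of \<open>\<partial>\<^sub>0 M0 + \<tau>\<^sub>h + M1 + A\<close> is bounded below by
  \<open>\<mu> M0 + c - exp (\<mu> h)\<close>, which is coercive for every \<open>\<mu> > - \<nu>0\<close>; this is the source of both
  invertibility and the stability rate.

  Replacing \<open>\<partial>\<^sub>0\<close> by the backward difference quotient with step \<open>\<epsilon>\<close> turns the equation into a
  causal recursion driven by the resolvent of \<open>M0/\<epsilon> + M1 + A\<close>.  For smooth compactly supported
  right-hand sides its solution is smooth, satisfies the weighted energy estimate for all weights at
  once (truncating at time \<open>T\<close> makes every integral finite), and solves the original equation up to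
  an error \<open>O(\<epsilon>)\<close> controlled by the second derivative of the right-hand side.  Density and
  completeness then give the solution operator for all right-hand sides, and Fatou's lemma transports
  the estimate in \<open>Hrho (- \<nu>)\<close> to the limit.
\<close>

section \<open>Strong measurability\<close>

lemma AE_lborel_shift:
  fixes P :: "real \<Rightarrow> bool"
  assumes "AE t in lborel. P t"
  shows "AE t in lborel. P (t + h)"
proof -
  obtain N where N: "{t \<in> space lborel. \<not> P t} \<subseteq> N" "emeasure lborel N = 0" "N \<in> sets lborel"
    using AE_E[OF assms] by blast
  have "AE t in lborel. t \<notin> N"
    using N by (intro AE_not_in) (auto simp: null_sets_def)
  then have "AE t in lborel. h + 1 * t \<notin> N"
    by (intro AE_borel_affine) (use N in auto)
  then show ?thesis
    by eventually_elim (use N in \<open>auto simp: add.commute\<close>)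
qed

lemma strongly_measurable_add:
  assumes "strongly_measurable f" "strongly_measurable g"
  shows "strongly_measurable (\<lambda>t. f t + g t)"
proof -
  obtain s where s: "\<And>n. s n \<in> borel_measurable lborel" "\<And>n. finite (range (s n))"
      "AE t in lborel. (\<lambda>n. s n t) \<longlonglongrightarrow> f t"
    using assms(1) unfolding strongly_measurable_def by blast
  obtain r where r: "\<And>n. r n \<in> borel_measurable lborel" "\<And>n. finite (range (r n))"
      "AE t in lborel. (\<lambda>n. r n t) \<longlonglongrightarrow> g t"
    using assms(2) unfolding strongly_measurable_def by blast
  have sf: "simple_function lborel (\<lambda>t. s n t + r n t)" for n
    by (rule simple_function_compose2)
       (use s r in \<open>auto intro!: simple_function_borel_measurable\<close>)
  have "AE t in lborel. (\<lambda>n. s n t + r n t) \<longlonglongrightarrow> f t + g t"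
    using s(3) r(3) by eventually_elim (rule tendsto_add)
  then show ?thesis
    unfolding strongly_measurable_def
    using borel_measurable_simple_function[OF sf] simple_functionD(1)[OF sf]
    by (intro exI[of _ "\<lambda>n t. s n t + r n t"]) auto
qed

lemma strongly_measurable_comp_continuous:
  fixes F :: "'a::banach \<Rightarrow> 'b::banach"
  assumes "strongly_measurable f" "continuous_on UNIV F"
  shows "strongly_measurable (\<lambda>t. F (f t))"
proof -
  obtain s where s: "\<And>n. s n \<in> borel_measurable lborel" "\<And>n. finite (range (s n))"
      "AE t in lborel. (\<lambda>n. s n t) \<longlonglongrightarrow> f t"
    using assms(1) unfolding strongly_measurable_def by blast
  have "(\<lambda>t. F (s n t)) \<in> borel_measurable lborel" for n
    using s(1) assms(2) by (intro borel_measurable_continuous_on[OF assms(2)])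
  moreover have "finite (range (\<lambda>t. F (s n t)))" for n
    using finite_imageI[OF s(2), of F n] by (simp add: image_image)
  moreover have "AE t in lborel. (\<lambda>n. F (s n t)) \<longlonglongrightarrow> F (f t)"
    using s(3)
  proof eventually_elim
    case (elim t)
    then show ?case
      using continuous_on_tendsto_compose[OF assms(2)] by auto
  qed
  ultimately show ?thesis
    unfolding strongly_measurable_def by (intro exI[of _ "\<lambda>n t. F (s n t)"]) auto
qed

lemma strongly_measurable_bounded_linear:
  "bounded_linear L \<Longrightarrow> strongly_measurable f \<Longrightarrow> strongly_measurable (\<lambda>t. L (f t))"
  by (rule strongly_measurable_comp_continuous) (auto intro: linear_continuous_on)

lemma strongly_measurable_diff:
  assumes "strongly_measurable f" "strongly_measurable g"
  shows "strongly_measurable (\<lambda>t. f t - g t)"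
  using strongly_measurable_add[OF assms(1)
      strongly_measurable_bounded_linear[OF bounded_linear_minus[OF bounded_linear_ident] assms(2)]]
  by simp

lemma strongly_measurable_shift:
  assumes "strongly_measurable f"
  shows "strongly_measurable (\<lambda>t. f (t + h))"
proof -
  obtain s where s: "\<And>n. s n \<in> borel_measurable lborel" "\<And>n. finite (range (s n))"
      "AE t in lborel. (\<lambda>n. s n t) \<longlonglongrightarrow> f t"
    using assms(1) unfolding strongly_measurable_def by blast
  have "(\<lambda>t. s n (t + h)) \<in> borel_measurable lborel" for n
    using measurable_compose[of "\<lambda>t. t + h" borel borel "s n" borel] s(1) by simp
  moreover have "finite (range (\<lambda>t. s n (t + h)))" for n
    using s(2) by (rule finite_subset[rotated]) auto
  moreover have "AE t in lborel. (\<lambda>n. s n (t + h)) \<longlonglongrightarrow> f (t + h)"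
    using AE_lborel_shift[OF s(3)] .
  ultimately show ?thesis
    unfolding strongly_measurable_def by (intro exI[of _ "\<lambda>n t. s n (t + h)"]) auto
qed

lemma strongly_measurable_cong_AE:
  assumes "AE t in lborel. f t = g t" "strongly_measurable f"
  shows "strongly_measurable g"
proof -
  obtain s where s: "\<And>n. s n \<in> borel_measurable lborel" "\<And>n. finite (range (s n))"
      "AE t in lborel. (\<lambda>n. s n t) \<longlonglongrightarrow> f t"
    using assms(2) unfolding strongly_measurable_def by blast
  have "AE t in lborel. (\<lambda>n. s n t) \<longlonglongrightarrow> g t"
    using s(3) assms(1) by eventually_elim auto
  then show ?thesis
    unfolding strongly_measurable_def using s by blast
qed

lemma AE_limit_borel:
  fixes s :: "nat \<Rightarrow> real \<Rightarrow> 'a::banach"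
  assumes "\<And>n. s n \<in> borel_measurable borel" "AE t in lborel. (\<lambda>n. s n t) \<longlonglongrightarrow> f t"
    and D: "\<And>n t. s n t \<in> closure D"
  obtains f' where "f' \<in> borel_measurable borel" "AE t in lborel. f t = f' t"
    "\<And>t. f' t \<in> closure (insert 0 D)"
proof -
  obtain N where N: "{t \<in> space lborel. \<not> (\<lambda>n. s n t) \<longlonglongrightarrow> f t} \<subseteq> N"
      "emeasure lborel N = 0" "N \<in> sets lborel"
    using AE_E[OF assms(2)] by blast
  define f' where "f' = (\<lambda>t. if t \<in> N then 0 else f t)"
  have lim: "(\<lambda>n. if t \<in> N then 0 else s n t) \<longlonglongrightarrow> f' t" for t
    using N(1) by (auto simp: f'_def)
  have "f' \<in> borel_measurable borel"
  proof (rule borel_measurable_LIMSEQ_metric)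
    show "(\<lambda>t. if t \<in> N then 0 else s n t) \<in> borel_measurable borel" for n
      using N(3) assms(1)[of n] by (intro measurable_If_set) auto
  qed (use lim in auto)
  moreover have "AE t in lborel. t \<notin> N"
    using N by (intro AE_not_in) (auto simp: null_sets_def)
  then have "AE t in lborel. f t = f' t"
    by eventually_elim (auto simp: f'_def)
  moreover have "f' t \<in> closure (insert 0 D)" for t
  proof (rule closed_sequentially[OF closed_closure _ lim[of t]])
    show "(if t \<in> N then 0 else s n t) \<in> closure (insert 0 D)" for n
      using D[of n t] closure_mono[of D "insert 0 D"] closure_subset[of "insert 0 D"] by auto
  qed
  ultimately show ?thesis
    using that by blast
qed

lemma strongly_measurable_imp_borel:
  fixes f :: "real \<Rightarrow> 'a::banach"
  assumes "strongly_measurable f"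
  obtains f' D where "f' \<in> borel_measurable borel" "AE t in lborel. f t = f' t"
    "countable D" "range f' \<subseteq> closure D"
proof -
  obtain s where s: "\<And>n. s n \<in> borel_measurable lborel" "\<And>n. finite (range (s n))"
      "AE t in lborel. (\<lambda>n. s n t) \<longlonglongrightarrow> f t"
    using assms unfolding strongly_measurable_def by blast
  define D where "D = (\<Union>n. range (s n))"
  have "s n t \<in> closure D" for n t
    using closure_subset[of D] by (auto simp: D_def)
  from AE_limit_borel[OF _ s(3) this] s(1)
  obtain f' where "f' \<in> borel_measurable borel" "AE t in lborel. f t = f' t"
      "\<And>t. f' t \<in> closure (insert 0 D)"
    by auto
  moreover have "countable (insert 0 D)"
    using s(2) by (auto simp: D_def intro: countable_finite)
  ultimately show ?thesis
    by (intro that[of f' "insert 0 D"]) auto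
qed

lemma strongly_measurable_borel_separable:
  fixes f :: "real \<Rightarrow> 'a::banach"
  assumes f: "f \<in> borel_measurable borel" and D: "countable D" "\<And>t. f t \<in> closure D"
  shows "strongly_measurable f"
proof -
  have "D \<noteq> {}"
    using D(2)[of 0] by auto
  then obtain d :: "nat \<Rightarrow> 'a" where d: "range d = D"
    using D(1) by (metis uncountable_def)
  define k where "k = (\<lambda>n t. LEAST i. i \<le> n \<and> (\<forall>j\<le>n. dist (f t) (d i) \<le> dist (f t) (d j)))"
  have ex: "\<exists>i. i \<le> n \<and> (\<forall>j\<le>n. dist (f t) (d i) \<le> dist (f t) (d j))" for n t
  proof -
    let ?S = "(\<lambda>j. dist (f t) (d j)) ` {..n}"
    have "Min ?S \<in> ?S"
      by (intro Min_in) auto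
    then obtain i where i: "Min ?S = dist (f t) (d i)" "i \<in> {..n}"
      by (rule imageE)
    moreover have "\<forall>j\<le>n. Min ?S \<le> dist (f t) (d j)"
      by auto
    ultimately show ?thesis
      by (intro exI[of _ i]) auto
  qed
  have k: "k n t \<le> n" "j \<le> n \<Longrightarrow> dist (f t) (d (k n t)) \<le> dist (f t) (d j)" for n t j
    using LeastI_ex[OF ex[of n t]] by (auto simp: k_def)
  have [measurable]: "(\<lambda>t. dist (f t) (d j)) \<in> borel_measurable borel" for j
    by (rule borel_measurable_continuous_on[OF _ f]) (intro continuous_intros)
  have km [measurable]: "k n \<in> measurable borel (count_space UNIV)" for n
    unfolding k_def by measurable
  have "(\<lambda>t. d (k n t)) \<in> borel_measurable lborel" for n
    using measurable_compose[OF km, of d borel] by simp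
  moreover have "finite (range (\<lambda>t. d (k n t)))" for n
    by (rule finite_subset[of _ "d ` {..n}"]) (use k in auto)
  moreover have "(\<lambda>n. d (k n t)) \<longlonglongrightarrow> f t" for t
  proof (rule LIMSEQ_I)
    fix e :: real assume "e > 0"
    then obtain y where "y \<in> D" "dist y (f t) < e"
      using D(2)[of t] by (auto simp: closure_approachable)
    then obtain j where j: "dist (d j) (f t) < e"
      using d by auto
    have "norm (d (k n t) - f t) < e" if "n \<ge> j" for n
      using k(2)[OF that, of t] j by (simp add: dist_norm norm_minus_commute)
    then show "\<exists>no. \<forall>n\<ge>no. norm (d (k n t) - f t) < e"
      by blast
  qed
  ultimately show ?thesis
    unfolding strongly_measurable_def by (intro exI[of _ "\<lambda>n t. d (k n t)"]) auto
qed

lemma strongly_measurable_imp_borel_seq: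
  fixes f :: "nat \<Rightarrow> real \<Rightarrow> 'a::banach"
  assumes "\<And>n. strongly_measurable (f n)"
  obtains f' where "\<forall>n. f' n \<in> borel_measurable borel" "AE t in lborel. \<forall>n. f n t = f' n t"
proof -
  have "\<exists>f'. f' \<in> borel_measurable borel \<and> (AE t in lborel. f n t = f' t)" for n
  proof -
    obtain f' D where "f' \<in> borel_measurable borel" "AE t in lborel. f n t = f' t"
      "countable D" "range f' \<subseteq> closure D"
      by (rule strongly_measurable_imp_borel[OF assms[of n]])
    then show ?thesis
      by (intro exI[of _ f']) simp
  qed
  from choice[OF allI[OF this]] obtain f' where
      "\<forall>n. f' n \<in> borel_measurable borel \<and> (AE t in lborel. f n t = f' n t)"
    by (rule exE)
  then show ?thesis
    by (intro that[of f']) (auto simp: AE_all_countable)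
qed

lemma strongly_measurable_AE_limit:
  fixes f :: "nat \<Rightarrow> real \<Rightarrow> 'a::banach"
  assumes f: "\<And>n. strongly_measurable (f n)" and lim: "AE t in lborel. (\<lambda>n. f n t) \<longlonglongrightarrow> g t"
  shows "strongly_measurable g"
proof -
  have "\<exists>p. fst p \<in> borel_measurable borel \<and> (AE t in lborel. f n t = fst p t) \<and>
      countable (snd p) \<and> (\<forall>t. fst p t \<in> closure (snd p))" for n
  proof -
    obtain f' D where "f' \<in> borel_measurable borel" "AE t in lborel. f n t = f' t"
      "countable D" "range f' \<subseteq> closure D"
      by (rule strongly_measurable_imp_borel[OF f[of n]])
    then show ?thesis
      by (intro exI[of _ "(f', D)"]) auto
  qed
  from choice[OF allI[OF this]] obtain p where p:
      "\<forall>n. fst (p n) \<in> borel_measurable borel \<and> (AE t in lborel. f n t = fst (p n) t) \<and>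
      countable (snd (p n)) \<and> (\<forall>t. fst (p n) t \<in> closure (snd (p n)))"
    by (rule exE)
  define f' where "f' = (\<lambda>n. fst (p n))"
  define D where "D = (\<lambda>n. snd (p n))"
  have f': "\<And>n. f' n \<in> borel_measurable borel" "\<And>n. AE t in lborel. f n t = f' n t"
      "\<And>n. countable (D n)" "\<And>n t. f' n t \<in> closure (D n)"
    using p by (auto simp: f'_def D_def)
  have in_closure: "f' n t \<in> closure (\<Union>n. D n)" for n t
    using f'(4)[of n t] closure_mono[of "D n" "\<Union>n. D n"] by auto
  have "AE t in lborel. \<forall>n. f n t = f' n t"
    using f'(2) by (simp add: AE_all_countable)
  with lim have "AE t in lborel. (\<lambda>n. f' n t) \<longlonglongrightarrow> g t"
    by eventually_elim simp
  from AE_limit_borel[OF f'(1) this in_closure]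
  obtain g' where g': "g' \<in> borel_measurable borel" "AE t in lborel. g t = g' t"
      "\<And>t. g' t \<in> closure (insert 0 (\<Union>n. D n))"
    by auto
  have "strongly_measurable g'"
    using f'(3) by (intro strongly_measurable_borel_separable[OF g'(1) _ g'(3)]) auto
  then show ?thesis
    by (rule strongly_measurable_cong_AE[rotated]) (use g'(2) in eventually_elim, simp)
qed

lemma strongly_measurable_continuous:
  fixes f :: "real \<Rightarrow> 'a::banach"
  assumes "continuous_on UNIV f"
  shows "strongly_measurable f"
proof (rule strongly_measurable_borel_separable)
  show "f \<in> borel_measurable borel"
    using assms by (rule borel_measurable_continuous_onI)
  show "countable (f ` \<rat>)"
    using countable_rat by blast
  have "f ` closure \<rat> \<subseteq> closure (f ` \<rat>)"
    by (rule image_closure_subset)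
       (use assms in \<open>auto intro: continuous_on_subset simp: closure_subset[THEN subsetD]\<close>)
  then show "f t \<in> closure (f ` \<rat>)" for t
    by (auto simp: Rats_closure_real)
qed

section \<open>Weighted square integrals\<close>

definition wn :: "(real \<Rightarrow> real) \<Rightarrow> (real \<Rightarrow> 'a::banach) \<Rightarrow> ennreal" where
  "wn w f = (\<integral>\<^sup>+ t. ennreal ((norm (f t))\<^sup>2 * w t) \<partial>lborel)"

lemma wnorm_sq_eq_wn: "wnorm_sq \<rho> f = wn (\<lambda>t. exp (- 2 * \<rho> * t)) f"
  by (simp add: wnorm_sq_def wn_def)

lemma wn_cong_AE: "AE t in lborel. f t = g t \<Longrightarrow> wn w f = wn w g"
  unfolding wn_def by (intro nn_integral_cong_AE) auto

lemma wn_mono_AE: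
  assumes "AE t in lborel. norm (f t) \<le> norm (g t)" "\<And>t. w t \<ge> 0"
  shows "wn w f \<le> wn w g"
  unfolding wn_def
proof (rule nn_integral_mono_AE)
  show "AE t in lborel. ennreal ((norm (f t))\<^sup>2 * w t) \<le> ennreal ((norm (g t))\<^sup>2 * w t)"
    using assms(1)
    by eventually_elim (use assms(2) in \<open>auto intro!: ennreal_leI mult_right_mono power_mono\<close>)
qed

lemma wn_minus: "wn w (\<lambda>t. - f t) = wn w f"
  and wn_diff_commute: "wn w (\<lambda>t. f t - g t) = wn w (\<lambda>t. g t - f t)"
  and wn_zero: "wn w (\<lambda>t. 0) = 0"
  by (simp_all add: wn_def norm_minus_commute)

lemma wn_cmult_le_borel:
  fixes w :: "real \<Rightarrow> real"
  assumes m: "(\<lambda>t. ennreal ((norm (f t))\<^sup>2 * w t)) \<in> borel_measurable borel"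
    and "\<And>t. norm (g t) \<le> C * norm (f t)" "\<And>t. w t \<ge> 0"
  shows "wn w g \<le> ennreal (C\<^sup>2) * wn w f"
proof -
  have "wn w g \<le> (\<integral>\<^sup>+ t. ennreal (C\<^sup>2) * ennreal ((norm (f t))\<^sup>2 * w t) \<partial>lborel)"
    unfolding wn_def
  proof (rule nn_integral_mono)
    fix t
    have "(norm (g t))\<^sup>2 \<le> (C * norm (f t))\<^sup>2"
      using assms(2)[of t] by (intro power_mono) auto
    then have "(norm (g t))\<^sup>2 * w t \<le> C\<^sup>2 * ((norm (f t))\<^sup>2 * w t)"
      using mult_right_mono[of "(norm (g t))\<^sup>2" "(C * norm (f t))\<^sup>2" "w t"] assms(3)[of t]
      by (simp add: power_mult_distrib mult.assoc)
    then show "ennreal ((norm (g t))\<^sup>2 * w t) \<le> ennreal (C\<^sup>2) * ennreal ((norm (f t))\<^sup>2 * w t)"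
      using assms(3)[of t] by (simp add: ennreal_mult[symmetric] ennreal_leI)
  qed
  also have "\<dots> = ennreal (C\<^sup>2) * wn w f"
    unfolding wn_def using m by (intro nn_integral_cmult) simp
  finally show ?thesis .
qed

context
  fixes w :: "real \<Rightarrow> real"
  assumes w_borel [measurable]: "w \<in> borel_measurable borel" and w_nonneg: "\<And>t. w t \<ge> 0"
begin

lemma borel_measurable_norm_sq_weight:
  assumes "f \<in> borel_measurable borel"
  shows "(\<lambda>t. ennreal ((norm (f t))\<^sup>2 * w t)) \<in> borel_measurable borel"
proof -
  have [measurable]: "(\<lambda>t. norm (f t)) \<in> borel_measurable borel"
    by (rule borel_measurable_continuous_on[OF _ assms]) (intro continuous_intros)
  show ?thesis
    by measurable
qed

lemma wn_cmult_le:
  assumes "strongly_measurable f" "\<And>t. norm (g t) \<le> C * norm (f t)"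
  shows "wn w g \<le> ennreal (C\<^sup>2) * wn w f"
proof -
  obtain f' D where f': "f' \<in> borel_measurable borel" "AE t in lborel. f t = f' t"
      "countable D" "range f' \<subseteq> closure D"
    by (rule strongly_measurable_imp_borel[OF assms(1)])
  define g' where "g' = (\<lambda>t. if f t = f' t then g t else 0)"
  have "wn w g = wn w g'"
    by (rule wn_cong_AE) (use f'(2) in \<open>eventually_elim, simp add: g'_def\<close>)
  also have "\<dots> \<le> ennreal (\<bar>C\<bar>\<^sup>2) * wn w f'"
  proof (rule wn_cmult_le_borel)
    show "norm (g' t) \<le> \<bar>C\<bar> * norm (f' t)" for t
      using assms(2)[of t] mult_right_mono[OF abs_ge_self[of C], of "norm (f t)"]
      by (auto simp: g'_def)
  qed (use borel_measurable_norm_sq_weight[OF f'(1)] w_nonneg in auto)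
  also have "wn w f' = wn w f"
    by (rule wn_cong_AE) (use f'(2) in \<open>eventually_elim, simp\<close>)
  finally show ?thesis
    by simp
qed

lemma wn_add_le:
  assumes "strongly_measurable f" "strongly_measurable g"
  shows "wn w (\<lambda>t. f t + g t) \<le> 2 * wn w f + 2 * wn w g"
proof -
  obtain f' D where f': "f' \<in> borel_measurable borel" "AE t in lborel. f t = f' t"
      "countable D" "range f' \<subseteq> closure D"
    by (rule strongly_measurable_imp_borel[OF assms(1)])
  obtain g' D where g': "g' \<in> borel_measurable borel" "AE t in lborel. g t = g' t"
      "countable D" "range g' \<subseteq> closure D"
    by (rule strongly_measurable_imp_borel[OF assms(2)])
  note [measurable] = borel_measurable_norm_sq_weight[OF f'(1)] borel_measurable_norm_sq_weight[OF g'(1)]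
  have "wn w (\<lambda>t. f t + g t) = wn w (\<lambda>t. f' t + g' t)"
    by (rule wn_cong_AE) (use f'(2) g'(2) in \<open>eventually_elim, simp\<close>)
  also have "\<dots> \<le> (\<integral>\<^sup>+ t. 2 * ennreal ((norm (f' t))\<^sup>2 * w t) + 2 * ennreal ((norm (g' t))\<^sup>2 * w t) \<partial>lborel)"
    unfolding wn_def
  proof (rule nn_integral_mono)
    fix t
    have "(norm (f' t + g' t))\<^sup>2 \<le> (norm (f' t) + norm (g' t))\<^sup>2"
      by (intro power_mono norm_triangle_ineq) auto
    also have "\<dots> \<le> 2 * (norm (f' t))\<^sup>2 + 2 * (norm (g' t))\<^sup>2"
      using sum_squares_bound[of "norm (f' t)" "norm (g' t)"] by (simp add: power2_sum)
    finally have "(norm (f' t + g' t))\<^sup>2 * w t \<le> (2 * (norm (f' t))\<^sup>2 + 2 * (norm (g' t))\<^sup>2) * w t"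
      by (intro mult_right_mono w_nonneg)
    then have "ennreal ((norm (f' t + g' t))\<^sup>2 * w t) \<le>
        ennreal (2 * ((norm (f' t))\<^sup>2 * w t) + 2 * ((norm (g' t))\<^sup>2 * w t))"
      by (intro ennreal_leI) (simp add: algebra_simps)
    then show "ennreal ((norm (f' t + g' t))\<^sup>2 * w t) \<le>
        2 * ennreal ((norm (f' t))\<^sup>2 * w t) + 2 * ennreal ((norm (g' t))\<^sup>2 * w t)"
      using w_nonneg[of t] by (simp add: ennreal_plus ennreal_mult)
  qed
  also have "\<dots> = 2 * wn w f' + 2 * wn w g'"
    unfolding wn_def by (subst nn_integral_add) (auto simp: nn_integral_cmult)
  also have "wn w f' = wn w f"
    by (rule wn_cong_AE) (use f'(2) in \<open>eventually_elim, simp\<close>)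
  also have "wn w g' = wn w g"
    by (rule wn_cong_AE) (use g'(2) in \<open>eventually_elim, simp\<close>)
  finally show ?thesis .
qed

lemma wn_diff_le:
  assumes "strongly_measurable f" "strongly_measurable g"
  shows "wn w (\<lambda>t. f t - g t) \<le> 2 * wn w f + 2 * wn w g"
  using wn_add_le[OF assms(1) strongly_measurable_bounded_linear[OF
      bounded_linear_minus[OF bounded_linear_ident] assms(2)]]
  by (simp add: wn_minus)

lemma wn_dist_triangle:
  assumes "strongly_measurable f" "strongly_measurable g" "strongly_measurable k"
  shows "wn w (\<lambda>t. f t - k t) \<le> 2 * wn w (\<lambda>t. f t - g t) + 2 * wn w (\<lambda>t. g t - k t)"
  using wn_add_le[OF strongly_measurable_diff[OF assms(1,2)] strongly_measurable_diff[OF assms(2,3)]]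
  by simp

lemma wn_Fatou:
  fixes f :: "nat \<Rightarrow> real \<Rightarrow> 'a::banach"
  assumes f: "\<And>n. strongly_measurable (f n)" and lim: "AE t in lborel. (\<lambda>n. f n t) \<longlonglongrightarrow> g t"
    and le: "\<And>n. wn w (f n) \<le> K"
  shows "wn w g \<le> K"
proof -
  obtain f' where f'_borel: "\<forall>n. f' n \<in> borel_measurable borel"
      and f'_eq: "AE t in lborel. \<forall>n. f n t = f' n t"
    by (rule strongly_measurable_imp_borel_seq[OF f])
  have f': "\<And>n. f' n \<in> borel_measurable borel" "\<And>n. AE t in lborel. f n t = f' n t"
    using f'_borel f'_eq by (auto simp: AE_all_countable)
  have "AE t in lborel. \<forall>n. f n t = f' n t"
    using f'(2) by (simp add: AE_all_countable)
  with lim have lim': "AE t in lborel. (\<lambda>n. f' n t) \<longlonglongrightarrow> g t"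
    by eventually_elim simp
  have "wn w g = (\<integral>\<^sup>+ t. liminf (\<lambda>n. ennreal ((norm (f' n t))\<^sup>2 * w t)) \<partial>lborel)"
    unfolding wn_def
  proof (rule nn_integral_cong_AE)
    show "AE t in lborel. ennreal ((norm (g t))\<^sup>2 * w t) = liminf (\<lambda>n. ennreal ((norm (f' n t))\<^sup>2 * w t))"
      using lim'
    proof eventually_elim
      case (elim t)
      then have "(\<lambda>n. ennreal ((norm (f' n t))\<^sup>2 * w t)) \<longlonglongrightarrow> ennreal ((norm (g t))\<^sup>2 * w t)"
        by (intro tendsto_intros)
      then show ?case
        by (intro lim_imp_Liminf[symmetric]) auto
    qed
  qed
  also have "\<dots> \<le> liminf (\<lambda>n. wn w (f' n))"
    unfolding wn_def using borel_measurable_norm_sq_weight[OF f'(1)]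
    by (intro nn_integral_liminf) simp
  also have "\<dots> \<le> K"
  proof -
    have "wn w (f' n) \<le> K" for n
      using le[of n] wn_cong_AE[OF f'(2), of w n] by simp
    then have "liminf (\<lambda>n. wn w (f' n)) \<le> liminf (\<lambda>n. K)"
      by (intro Liminf_mono) auto
    then show ?thesis
      by (simp add: Liminf_const)
  qed
  finally show ?thesis .
qed

lemma wn_dominated:
  fixes f :: "nat \<Rightarrow> real \<Rightarrow> 'a::banach" and b :: "real \<Rightarrow> 'b::banach"
  assumes f: "\<And>n. strongly_measurable (f n)" and lim: "AE t in lborel. (\<lambda>n. f n t) \<longlonglongrightarrow> 0"
    and b: "strongly_measurable b" "wn w b < \<infinity>"
    and le: "\<And>n. AE t in lborel. norm (f n t) \<le> norm (b t)"
  shows "(\<lambda>n. wn w (f n)) \<longlonglongrightarrow> 0"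
proof -
  obtain f' where f'_borel: "\<forall>n. f' n \<in> borel_measurable borel"
      and f'_eq: "AE t in lborel. \<forall>n. f n t = f' n t"
    by (rule strongly_measurable_imp_borel_seq[OF f])
  have f': "\<And>n. f' n \<in> borel_measurable borel" "\<And>n. AE t in lborel. f n t = f' n t"
    using f'_borel f'_eq by (auto simp: AE_all_countable)
  obtain b' D where b': "b' \<in> borel_measurable borel" "AE t in lborel. b t = b' t"
      "countable D" "range b' \<subseteq> closure D"
    by (rule strongly_measurable_imp_borel[OF b(1)])
  note [measurable] = borel_measurable_norm_sq_weight[OF f'(1)] borel_measurable_norm_sq_weight[OF b'(1)]
  have eq: "AE t in lborel. \<forall>n. f n t = f' n t"
    using f'(2) by (simp add: AE_all_countable)
  have "(\<lambda>n. \<integral>\<^sup>+ t. ennreal ((norm (f' n t))\<^sup>2 * w t) \<partial>lborel) \<longlonglongrightarrow> (\<integral>\<^sup>+ t. 0 \<partial>(lborel::real measure))"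
  proof (rule nn_integral_dominated_convergence[where w = "\<lambda>t. ennreal ((norm (b' t))\<^sup>2 * w t)"])
    show "AE t in lborel. ennreal ((norm (f' n t))\<^sup>2 * w t) \<le> ennreal ((norm (b' t))\<^sup>2 * w t)" for n
      using le[of n] eq b'(2)
      by eventually_elim (auto intro!: ennreal_leI mult_right_mono power_mono w_nonneg)
    show "(\<integral>\<^sup>+ t. ennreal ((norm (b' t))\<^sup>2 * w t) \<partial>lborel) < \<infinity>"
      using b(2) wn_cong_AE[OF b'(2), of w] by (simp add: wn_def)
    show "AE t in lborel. (\<lambda>n. ennreal ((norm (f' n t))\<^sup>2 * w t)) \<longlonglongrightarrow> 0"
      using lim eq
    proof eventually_elim
      case (elim t)
      then have "(\<lambda>n. ennreal ((norm (f' n t))\<^sup>2 * w t)) \<longlonglongrightarrow> ennreal ((norm (0::'a))\<^sup>2 * w t)"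
        by (intro tendsto_intros) simp
      then show ?case
        by simp
    qed
  qed auto
  then show ?thesis
    using wn_cong_AE[OF f'(2), of w] by (simp add: wn_def)
qed

lemma wn_AE_geometric:
  fixes d :: "nat \<Rightarrow> real \<Rightarrow> 'a::banach"
  assumes pos: "\<And>t. w t > 0" and d: "\<And>n. strongly_measurable (d n)"
    and le: "\<And>n. wn w (d n) \<le> ennreal ((1/8) ^ n)"
  shows "AE t in lborel. \<exists>C. \<forall>n. norm (d n t) \<le> C * (1/2) ^ n"
proof -
  obtain d' where d'_borel: "\<forall>n. d' n \<in> borel_measurable borel"
      and d'_eq: "AE t in lborel. \<forall>n. d n t = d' n t"
    by (rule strongly_measurable_imp_borel_seq[OF d])
  have d': "\<And>n. d' n \<in> borel_measurable borel" "\<And>n. AE t in lborel. d n t = d' n t"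
    using d'_borel d'_eq by (auto simp: AE_all_countable)
  note [measurable] = borel_measurable_norm_sq_weight[OF d'(1)]
  have eq: "AE t in lborel. \<forall>n. d n t = d' n t"
    using d'(2) by (simp add: AE_all_countable)
  define F where "F = (\<lambda>n t. ennreal (4 ^ n) * ennreal ((norm (d' n t))\<^sup>2 * w t))"
  have [measurable]: "F n \<in> borel_measurable borel" for n
    unfolding F_def by measurable
  have "(\<integral>\<^sup>+ t. (\<Sum>n. F n t) \<partial>lborel) = (\<Sum>n. (\<integral>\<^sup>+ t. F n t \<partial>lborel))"
    by (rule nn_integral_suminf) simp
  also have "\<dots> \<le> (\<Sum>n. ennreal ((1/2) ^ n))"
  proof (rule suminf_le)
    fix n
    have "(\<integral>\<^sup>+ t. F n t \<partial>lborel) = ennreal (4 ^ n) * wn w (d' n)"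
      unfolding F_def wn_def by (rule nn_integral_cmult) simp
    also have "\<dots> \<le> ennreal (4 ^ n) * ennreal ((1/8) ^ n)"
      using le[of n] wn_cong_AE[OF d'(2), of w n] by (intro mult_left_mono) auto
    also have "\<dots> = ennreal ((1/2) ^ n)"
      by (simp add: ennreal_mult[symmetric] power_mult_distrib[symmetric])
    finally show "(\<integral>\<^sup>+ t. F n t \<partial>lborel) \<le> ennreal ((1/2) ^ n)" .
  qed auto
  also have "\<dots> = ennreal (\<Sum>n. (1/2) ^ n)"
    by (rule suminf_ennreal2) (auto intro: summable_geometric)
  finally have "(\<integral>\<^sup>+ t. (\<Sum>n. F n t) \<partial>lborel) < \<infinity>"
    by (simp add: le_less_trans ennreal_less_top)
  then have "AE t in lborel. (\<Sum>n. F n t) \<noteq> \<infinity>"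
    by (intro nn_integral_PInf_AE) auto
  with eq show ?thesis
  proof eventually_elim
    case (elim t)
    define C where "C = enn2real (\<Sum>n. F n t)"
    have C: "ennreal C = (\<Sum>n. F n t)"
      using elim by (simp add: C_def less_top)
    have "norm (d n t) \<le> sqrt (C / w t) * (1/2) ^ n" for n
    proof -
      have "F n t \<le> ennreal C"
        unfolding C using sum_le_suminf[of "\<lambda>n. F n t" "{n}"] by auto
      then have "ennreal (4 ^ n * ((norm (d' n t))\<^sup>2 * w t)) \<le> ennreal C"
        using pos[of t] by (simp add: F_def ennreal_mult[symmetric] less_imp_le)
      then have "4 ^ n * ((norm (d' n t))\<^sup>2 * w t) \<le> C"
        by (subst (asm) ennreal_le_iff) (auto simp: C_def)
      then have "(norm (d' n t))\<^sup>2 \<le> (C / w t) * ((1/2) ^ n)\<^sup>2"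
        using pos[of t] by (simp add: field_simps power_mult_distrib[symmetric] power2_eq_square)
      then have "sqrt ((norm (d' n t))\<^sup>2) \<le> sqrt ((C / w t) * ((1/2) ^ n)\<^sup>2)"
        by (rule real_sqrt_le_mono)
      then show ?thesis
        using elim by (simp only: real_sqrt_mult real_sqrt_abs) simp
    qed
    then show ?case
      by blast
  qed
qed

lemma wn_tendsto_AE_subseq:
  fixes f :: "nat \<Rightarrow> real \<Rightarrow> 'a::banach"
  assumes pos: "\<And>t. w t > 0" and f: "\<And>n. strongly_measurable (f n)" "strongly_measurable g"
    and lim: "(\<lambda>n. wn w (\<lambda>t. f n t - g t)) \<longlonglongrightarrow> 0"
  obtains r :: "nat \<Rightarrow> nat" where "AE t in lborel. (\<lambda>n. f (r n) t) \<longlonglongrightarrow> g t"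
proof -
  have "\<exists>m. wn w (\<lambda>t. f m t - g t) \<le> ennreal ((1/8) ^ n)" for n
  proof -
    have "eventually (\<lambda>m. wn w (\<lambda>t. f m t - g t) < ennreal ((1/8) ^ n)) sequentially"
      by (rule order_tendstoD(2)[OF lim]) simp
    then show ?thesis
      by (auto simp: eventually_sequentially intro: less_imp_le)
  qed
  then have "\<forall>n. \<exists>m. wn w (\<lambda>t. f m t - g t) \<le> ennreal ((1/8) ^ n)"
    by blast
  from choice[OF this] obtain r
    where r: "\<And>n. wn w (\<lambda>t. f (r n) t - g t) \<le> ennreal ((1/8) ^ n)"
    by auto
  have "AE t in lborel. \<exists>C. \<forall>n. norm (f (r n) t - g t) \<le> C * (1/2) ^ n"
    by (rule wn_AE_geometric[OF pos _ r]) (intro strongly_measurable_diff f)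
  then have "AE t in lborel. (\<lambda>n. f (r n) t) \<longlonglongrightarrow> g t"
  proof eventually_elim
    case (elim t)
    then obtain C where C: "\<And>n. norm (f (r n) t - g t) \<le> C * (1/2) ^ n"
      by blast
    have "(\<lambda>n. C * (1/2::real) ^ n) \<longlonglongrightarrow> C * 0"
      by (intro tendsto_intros LIMSEQ_realpow_zero) auto
    then have "(\<lambda>n. C * (1/2::real) ^ n) \<longlonglongrightarrow> 0"
      by simp
    then have "(\<lambda>n. f (r n) t - g t) \<longlonglongrightarrow> 0"
      by (rule Lim_null_comparison[OF always_eventually[OF allI[OF C]]])
    then show ?case
      by (simp add: LIM_zero_iff)
  qed
  then show ?thesis
    by (rule that)
qed

lemma wn_complete:
  fixes f :: "nat \<Rightarrow> real \<Rightarrow> 'a::banach"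
  assumes pos: "\<And>t. w t > 0" and f: "\<And>n. strongly_measurable (f n)" "\<And>n. wn w (f n) < \<infinity>"
    and cauchy: "\<And>e. e > 0 \<Longrightarrow> \<exists>N. \<forall>m\<ge>N. \<forall>n\<ge>N. wn w (\<lambda>t. f m t - f n t) \<le> ennreal e"
  obtains g where "strongly_measurable g" "wn w g < \<infinity>" "(\<lambda>n. wn w (\<lambda>t. f n t - g t)) \<longlonglongrightarrow> 0"
proof -
  have "\<forall>k. \<exists>N. \<forall>m\<ge>N. \<forall>n\<ge>N. wn w (\<lambda>t. f m t - f n t) \<le> ennreal ((1/8) ^ k)"
    by (intro allI cauchy) simp
  from choice[OF this] obtain N
    where N: "\<And>k m n. m \<ge> N k \<Longrightarrow> n \<ge> N k \<Longrightarrow> wn w (\<lambda>t. f m t - f n t) \<le> ennreal ((1/8) ^ k)"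
    by auto
  define r where "r = (\<lambda>k. (\<Sum>i\<le>k. N i))"
  have r: "r k \<ge> N k" "r (Suc k) \<ge> r k" for k
    by (auto simp: r_def sum.atMost_Suc intro: member_le_sum)
  have "wn w (\<lambda>t. f (r (Suc k)) t - f (r k) t) \<le> ennreal ((1/8) ^ k)" for k
    using r[of k] by (intro N) auto
  then have "AE t in lborel. \<exists>C. \<forall>k. norm (f (r (Suc k)) t - f (r k) t) \<le> C * (1/2) ^ k"
    by (intro wn_AE_geometric[OF pos] strongly_measurable_diff f)
  then have "AE t in lborel. convergent (\<lambda>k. f (r k) t)"
  proof eventually_elim
    case (elim t)
    then obtain C where C: "\<And>k. norm (f (r (Suc k)) t - f (r k) t) \<le> C * (1/2) ^ k"
      by blast
    have "summable (\<lambda>k. f (r (Suc k)) t - f (r k) t)"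
      by (rule summable_comparison_test'[of "\<lambda>k. C * (1/2) ^ k"])
         (use C in \<open>auto intro!: summable_mult summable_geometric\<close>)
    then have "convergent (\<lambda>n. \<Sum>k<n. f (r (Suc k)) t - f (r k) t)"
      by (simp add: summable_iff_convergent)
    then have "convergent (\<lambda>n. f (r n) t - f (r 0) t)"
      by (simp add: sum_lessThan_telescope[of "\<lambda>n. f (r n) t"])
    then show ?case
      by (subst (asm) convergent_diff_const_right_iff)
  qed
  then have lim: "AE t in lborel. (\<lambda>k. f (r k) t) \<longlonglongrightarrow> lim (\<lambda>k. f (r k) t)"
    by eventually_elim (simp add: convergent_LIMSEQ_iff)
  define g where "g = (\<lambda>t. lim (\<lambda>k. f (r k) t))"
  have g: "strongly_measurable g"
    unfolding g_def by (rule strongly_measurable_AE_limit[OF f(1) lim])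
  have Fatou: "wn w (\<lambda>t. f n t - g t) \<le> ennreal ((1/8) ^ k)" if "n \<ge> r k" for n k
  proof (rule wn_Fatou)
    show "strongly_measurable (\<lambda>t. f n t - f (r (j + k)) t)" for j
      by (intro strongly_measurable_diff f)
    show "AE t in lborel. (\<lambda>j. f n t - f (r (j + k)) t) \<longlonglongrightarrow> f n t - g t"
      using lim
    proof eventually_elim
      case (elim t)
      then show ?case
        unfolding g_def by (intro tendsto_intros LIMSEQ_ignore_initial_segment)
    qed
    have "r k \<le> r (j + k)" for j
      by (rule lift_Suc_mono_le[of r]) (use r in auto)
    then show "wn w (\<lambda>t. f n t - f (r (j + k)) t) \<le> ennreal ((1/8) ^ k)" for j
      using r(1)[of k] that by (intro N) (auto intro: order_trans)
  qed
  have "(\<lambda>n. wn w (\<lambda>t. f n t - g t)) \<longlonglongrightarrow> 0"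
  proof (rule order_tendstoI)
    fix e :: ennreal assume e: "0 < e"
    have "(\<lambda>k. ennreal ((1/8) ^ k)) \<longlonglongrightarrow> ennreal 0"
      by (intro tendsto_ennrealI LIMSEQ_realpow_zero) auto
    then have "eventually (\<lambda>k. ennreal ((1/8) ^ k) < e) sequentially"
      using e by (intro order_tendstoD(2)) auto
    then obtain k where "ennreal ((1/8) ^ k) < e"
      by (auto simp: eventually_sequentially)
    then show "eventually (\<lambda>n. wn w (\<lambda>t. f n t - g t) < e) sequentially"
      using Fatou[of k] by (auto simp: eventually_sequentially intro: le_less_trans)
  qed auto
  moreover have "wn w g < \<infinity>"
  proof -
    have "wn w g \<le> 2 * wn w (f (r 0)) + 2 * wn w (\<lambda>t. f (r 0) t - g t)"
      using wn_diff_le[OF f(1)[of "r 0"] strongly_measurable_diff[OF f(1)[of "r 0"] g]] by simp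
    also have "\<dots> < \<infinity>"
      using f(2)[of "r 0"] Fatou[of 0 "r 0"]
      by (auto simp: ennreal_mult_less_top intro: le_less_trans)
    finally show ?thesis .
  qed
  ultimately show ?thesis
    using that g by blast
qed

end

section \<open>Smooth functions\<close>

definition smooth :: "(real \<Rightarrow> 'a::real_normed_vector) \<Rightarrow> bool" where
  "smooth f \<longleftrightarrow> (\<exists>d. d 0 = f \<and> (\<forall>k t. (d k has_vector_derivative d (Suc k) t) (at t)))"

lemma smooth_coinduct:
  assumes "f \<in> F" "\<And>g. g \<in> F \<Longrightarrow> \<exists>g'\<in>F. \<forall>t. (g has_vector_derivative g' t) (at t)"
  shows "smooth f"
proof -
  have "\<exists>d. \<forall>k. (d k \<in> F \<and> (k = 0 \<longrightarrow> d k = f)) \<and>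
      (\<forall>t. (d k has_vector_derivative d (Suc k) t) (at t))"
    by (rule dependent_nat_choice) (use assms in blast)+
  then show ?thesis
    unfolding smooth_def by blast
qed

lemma smooth_derivE:
  assumes "smooth f"
  obtains f' where "smooth f'" "\<forall>t. (f has_vector_derivative f' t) (at t)"
proof -
  obtain d where d: "d 0 = f" "\<forall>k t. (d k has_vector_derivative d (Suc k) t) (at t)"
    using assms unfolding smooth_def by blast
  have "smooth (d 1)"
    unfolding smooth_def using d(2) by (intro exI[of _ "\<lambda>k. d (Suc k)"]) auto
  then show ?thesis
    using d that[of "d 1"] by fastforce
qed

lemma smooth_continuous: "smooth f \<Longrightarrow> continuous_on UNIV f"
  by (metis smooth_derivE has_vector_derivative_continuous continuous_at_imp_continuous_on)

lemma smooth_const: "smooth (\<lambda>t. c)"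
  by (rule smooth_coinduct[of _ "range (\<lambda>c t. c)"])
     (auto intro!: exI[of _ 0] has_vector_derivative_const)

lemma smooth_add:
  assumes "smooth f" "smooth g"
  shows "smooth (\<lambda>t. f t + g t)"
proof (rule smooth_coinduct[of _ "{\<lambda>t. f t + g t | f g. smooth f \<and> smooth g}"])
  fix k assume "k \<in> {\<lambda>t. f t + g t | f g :: real \<Rightarrow> 'a. smooth f \<and> smooth g}"
  then obtain f g where k: "k = (\<lambda>t. f t + g t)" "smooth f" "smooth g"
    by blast
  obtain f' where f': "smooth f'" "\<forall>t. (f has_vector_derivative f' t) (at t)"
    using smooth_derivE[OF k(2)] .
  obtain g' where g': "smooth g'" "\<forall>t. (g has_vector_derivative g' t) (at t)"
    using smooth_derivE[OF k(3)] .
  show "\<exists>k'\<in>{\<lambda>t. f t + g t | f g. smooth f \<and> smooth g}. \<forall>t. (k has_vector_derivative k' t) (at t)"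
    unfolding k(1) using f' g'
    by (intro bexI[of _ "\<lambda>t. f' t + g' t"]) (auto intro: has_vector_derivative_add)
qed (use assms in blast)

lemma smooth_bounded_linear:
  assumes "bounded_linear L" "smooth f"
  shows "smooth (\<lambda>t. L (f t))"
proof (rule smooth_coinduct[of _ "{\<lambda>t. L (f t) | f. smooth f}"])
  fix k assume "k \<in> {\<lambda>t. L (f t) | f. smooth f}"
  then obtain f where k: "k = (\<lambda>t. L (f t))" "smooth f"
    by blast
  obtain f' where f': "smooth f'" "\<forall>t. (f has_vector_derivative f' t) (at t)"
    using smooth_derivE[OF k(2)] .
  show "\<exists>k'\<in>{\<lambda>t. L (f t) | f. smooth f}. \<forall>t. (k has_vector_derivative k' t) (at t)"
    unfolding k(1) using f'
    by (intro bexI[of _ "\<lambda>t. L (f' t)"])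
       (auto intro: bounded_linear.has_vector_derivative[OF assms(1)])
qed (use assms in blast)

lemma smooth_compose_affine:
  assumes "smooth f"
  shows "smooth (\<lambda>t. f (a + b * t))"
proof (rule smooth_coinduct[of _ "{\<lambda>t. f (a + b * t) | f. smooth f}"])
  fix k assume "k \<in> {\<lambda>t. f (a + b * t) | f :: real \<Rightarrow> 'a. smooth f}"
  then obtain f where k: "k = (\<lambda>t. f (a + b * t))" "smooth f"
    by blast
  obtain f' where f': "smooth f'" "\<forall>t. (f has_vector_derivative f' t) (at t)"
    using smooth_derivE[OF k(2)] .
  have "((\<lambda>t. f (a + b * t)) has_vector_derivative b *\<^sub>R f' (a + b * t)) (at t)" for t
  proof -
    have "((\<lambda>t. a + b * t) has_real_derivative b) (at t)"
      by (auto intro!: derivative_eq_intros)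
    then show ?thesis
      using vector_diff_chain_at[OF _ f'(2)[rule_format], of "\<lambda>t. a + b * t" b t]
      by (simp add: has_real_derivative_iff_has_vector_derivative o_def)
  qed
  moreover have "smooth (\<lambda>t. b *\<^sub>R f' t)"
    by (rule smooth_bounded_linear[OF bounded_linear_scaleR_right f'(1)])
  ultimately show "\<exists>k'\<in>{\<lambda>t. f (a + b * t) | f. smooth f}. \<forall>t. (k has_vector_derivative k' t) (at t)"
    unfolding k(1)
    by (intro bexI[of _ "\<lambda>t. b *\<^sub>R f' (a + b * t)"] allI CollectI exI[of _ "\<lambda>t. b *\<^sub>R f' t"] conjI refl)
qed (use assms in blast)

inductive_set scaleR_sums :: "(real \<Rightarrow> 'a::real_normed_vector) set" where
  prod: "smooth \<phi> \<Longrightarrow> smooth v \<Longrightarrow> (\<lambda>t. \<phi> t *\<^sub>R v t) \<in> scaleR_sums"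
| sum: "f \<in> scaleR_sums \<Longrightarrow> g \<in> scaleR_sums \<Longrightarrow> (\<lambda>t. f t + g t) \<in> scaleR_sums"

lemma smooth_scaleR:
  assumes "smooth \<phi>" "smooth v"
  shows "smooth (\<lambda>t. \<phi> t *\<^sub>R v t)"
proof (rule smooth_coinduct[of _ scaleR_sums])
  show "\<exists>g'\<in>scaleR_sums. \<forall>t. (g has_vector_derivative g' t) (at t)"
    if "g \<in> scaleR_sums" for g :: "real \<Rightarrow> 'a"
    using that
  proof induction
    case (prod \<phi> v)
    obtain \<phi>' where \<phi>': "smooth \<phi>'" "\<forall>t. (\<phi> has_vector_derivative \<phi>' t) (at t)"
      using smooth_derivE[OF prod(1)] .
    obtain v' where v': "smooth v'" "\<forall>t. (v has_vector_derivative v' t) (at t)"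
      using smooth_derivE[OF prod(2)] .
    have "((\<lambda>t. \<phi> t *\<^sub>R v t) has_vector_derivative (\<phi> t *\<^sub>R v' t + \<phi>' t *\<^sub>R v t)) (at t)" for t
      using \<phi>' v' by (intro has_vector_derivative_scaleR)
        (auto simp: has_real_derivative_iff_has_vector_derivative)
    moreover have "(\<lambda>t. \<phi> t *\<^sub>R v' t + \<phi>' t *\<^sub>R v t) \<in> scaleR_sums"
      using prod \<phi>' v' by (intro scaleR_sums.intros)
    ultimately show ?case
      by (intro bexI[rotated] allI)
  next
    case (sum f g)
    then obtain f' g' where "f' \<in> scaleR_sums" "\<forall>t. (f has_vector_derivative f' t) (at t)"
        "g' \<in> scaleR_sums" "\<forall>t. (g has_vector_derivative g' t) (at t)"
      by blast
    then show ?case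
      by (intro bexI[of _ "\<lambda>t. f' t + g' t"])
         (auto intro: has_vector_derivative_add scaleR_sums.intros)
  qed
qed (use assms in \<open>auto intro: scaleR_sums.intros\<close>)

definition flat_power :: "nat \<Rightarrow> real \<Rightarrow> real" where
  "flat_power k x = (if x \<le> 0 then 0 else (1/x) ^ k * exp (- (1/x)))"

lemma flat_power_tendsto_0: "(flat_power k \<longlongrightarrow> 0) (at 0)"
proof -
  have "((\<lambda>x. (inverse x) ^ k / exp (inverse x)) \<longlongrightarrow> 0) (at_right (0::real))"
    by (rule filterlim_compose[OF tendsto_power_div_exp_0 filterlim_inverse_at_top_right])
  then have "(flat_power k \<longlongrightarrow> 0) (at_right 0)"
    by (rule Lim_transform_eventually)
       (auto simp: eventually_at_right_less flat_power_def field_simps exp_minus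
         intro!: eventually_at_rightI[of 0 1])
  moreover have "(flat_power k \<longlongrightarrow> 0) (at_left 0)"
    by (rule Lim_transform_eventually[OF tendsto_const])
       (auto simp: flat_power_def intro!: eventually_at_leftI[of "-1" 0])
  ultimately show ?thesis
    by (simp add: filterlim_at_split)
qed

lemma flat_power_has_derivative:
  "(flat_power k has_real_derivative (flat_power (k + 2) x - real k * flat_power (k + 1) x)) (at x)"
proof -
  consider "x < 0" | "x = 0" | "x > 0"
    by linarith
  then show ?thesis
  proof cases
    case 1
    have "((\<lambda>x. 0) has_real_derivative 0) (at x)"
      by simp
    then have "(flat_power k has_real_derivative 0) (at x)"
      by (rule has_field_derivative_transform_within_open[of _ _ _ "{..<0}"]) (use 1 in \<open>auto simp: flat_power_def\<close>)
    then show ?thesis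
      using 1 by (simp add: flat_power_def)
  next
    case 2
    have "((\<lambda>y. (flat_power k y - flat_power k 0) / (y - 0)) \<longlongrightarrow> 0) (at 0)"
      by (rule Lim_transform_eventually[OF flat_power_tendsto_0[of "k + 1"]])
         (auto simp: flat_power_def eventually_at_filter)
    then show ?thesis
      using 2 by (simp add: has_field_derivative_iff flat_power_def)
  next
    case 3
    have "((\<lambda>x. (1/x) ^ k * exp (- (1/x))) has_real_derivative
        ((1/x) ^ (k + 2) * exp (- (1/x)) - real k * ((1/x) ^ (k + 1) * exp (- (1/x))))) (at x)"
    proof (cases k)
      case 0
      then show ?thesis
        using 3 by (auto intro!: derivative_eq_intros simp: field_simps power2_eq_square)
    next
      case (Suc m)
      have inv: "((\<lambda>x. 1/x) has_real_derivative - 1 / x\<^sup>2) (at x)"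
        using 3 by (auto intro!: derivative_eq_intros simp: power2_eq_square)
      have "((\<lambda>x. (1/x) ^ Suc m * exp (- (1/x))) has_real_derivative
          (real (Suc m) * ((- 1 / x\<^sup>2) * (1/x) ^ m)) * exp (- (1/x)) +
          (exp (- (1/x)) * (- (- 1 / x\<^sup>2))) * (1/x) ^ Suc m) (at x)"
        using DERIV_mult[OF DERIV_power[OF inv, of "Suc m"] DERIV_fun_exp[OF DERIV_minus[OF inv]]]
        by simp
      moreover have "(real (Suc m) * ((- 1 / x\<^sup>2) * (1/x) ^ m)) * exp (- (1/x)) +
          (exp (- (1/x)) * (- (- 1 / x\<^sup>2))) * (1/x) ^ Suc m =
          (1/x) ^ (k + 2) * exp (- (1/x)) - real k * ((1/x) ^ (k + 1) * exp (- (1/x)))"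
        by (simp add: Suc power_divide power2_eq_square algebra_simps)
      ultimately show ?thesis
        by (simp only: Suc)
    qed
    then have "(flat_power k has_real_derivative
        ((1/x) ^ (k + 2) * exp (- (1/x)) - real k * ((1/x) ^ (k + 1) * exp (- (1/x))))) (at x)"
      by (rule has_field_derivative_transform_within_open[of _ _ _ "{0<..}"]) (use 3 in \<open>auto simp: flat_power_def\<close>)
    then show ?thesis
      using 3 by (simp add: flat_power_def)
  qed
qed

inductive_set flat_span :: "(real \<Rightarrow> real) set" where
  base: "(\<lambda>x. c * flat_power k x) \<in> flat_span"
| sum: "f \<in> flat_span \<Longrightarrow> g \<in> flat_span \<Longrightarrow> (\<lambda>t. f t + g t) \<in> flat_span"

lemma smooth_flat_power: "smooth (flat_power k)"
proof (rule smooth_coinduct[of _ flat_span])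
  show "flat_power k \<in> flat_span"
    using flat_span.base[of 1 k] by simp
  show "\<exists>g'\<in>flat_span. \<forall>t. (g has_vector_derivative g' t) (at t)" if "g \<in> flat_span" for g
    using that
  proof induction
    case (base c k)
    have "((\<lambda>x. c * flat_power k x) has_vector_derivative
        (c * flat_power (k + 2) x + (- c * real k) * flat_power (k + 1) x)) (at x)" for x
      using DERIV_cmult[OF flat_power_has_derivative[of k x], of c]
      by (simp add: has_real_derivative_iff_has_vector_derivative[symmetric] algebra_simps)
    moreover have "(\<lambda>x. c * flat_power (k + 2) x + (- c * real k) * flat_power (k + 1) x) \<in> flat_span"
      by (intro flat_span.intros)
    ultimately show ?case
      by (intro bexI[rotated] allI)
  next
    case (sum f g)
    then obtain f' g' where "f' \<in> flat_span" "\<forall>t. (f has_vector_derivative f' t) (at t)"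
        "g' \<in> flat_span" "\<forall>t. (g has_vector_derivative g' t) (at t)"
      by blast
    then show ?case
      by (intro bexI[of _ "\<lambda>t. f' t + g' t"])
         (auto intro: has_vector_derivative_add flat_span.intros)
  qed
qed

definition bump :: "real \<Rightarrow> real \<Rightarrow> real \<Rightarrow> real" where
  "bump a b t = flat_power 0 (t - a) * flat_power 0 (b - t)"

lemma smooth_bump: "smooth (bump a b)"
proof -
  have "smooth (\<lambda>t. flat_power 0 (- a + 1 * t) *\<^sub>R flat_power 0 (b + (-1) * t))"
    by (intro smooth_scaleR smooth_compose_affine smooth_flat_power)
  then show ?thesis
    by (simp add: bump_def[abs_def])
qed

lemma bump_bounds: "0 \<le> bump a b t" "bump a b t \<le> 1"
  by (auto simp: bump_def flat_power_def intro!: mult_le_one)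

lemma bump_pos: "a < t \<Longrightarrow> t < b \<Longrightarrow> 0 < bump a b t"
  and bump_outside: "t \<le> a \<or> b \<le> t \<Longrightarrow> bump a b t = 0"
  by (auto simp: bump_def flat_power_def)

lemma deriv_zero_open:
  fixes f :: "real \<Rightarrow> 'a::real_normed_vector"
  assumes "\<forall>t. (f has_vector_derivative f' t) (at t)" "open S" "\<forall>t\<in>S. f t = 0" "t \<in> S"
  shows "f' t = 0"
proof -
  have "((\<lambda>t. 0) has_vector_derivative f' t) (at t)"
    by (rule has_vector_derivative_transform_within_open[OF assms(1)[rule_format] assms(2,4)])
       (use assms(3) in auto)
  then show ?thesis
    by (rule vector_derivative_unique_at[OF _ has_vector_derivative_const])
qed

lemma deriv_zero_outside:
  fixes f :: "real \<Rightarrow> 'a::real_normed_vector"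
  assumes "\<forall>t. (f has_vector_derivative f' t) (at t)" "\<forall>t. R < \<bar>t\<bar> \<longrightarrow> f t = 0" "R < \<bar>t\<bar>"
  shows "f' t = 0"
  by (rule deriv_zero_open[OF assms(1), of "{t. R < \<bar>t\<bar>}"])
     (use assms(2,3) in \<open>auto intro!: open_Collect_less continuous_intros\<close>)

section \<open>Density of smooth compactly supported functions\<close>

lemma strongly_measurable_simple:
  "s \<in> borel_measurable borel \<Longrightarrow> finite (range s) \<Longrightarrow> strongly_measurable s"
  unfolding strongly_measurable_def by (intro exI[of _ "\<lambda>n. s"]) auto

lemma indicator_scaleR_borel:
  fixes x :: "'a::banach"
  assumes "E \<in> sets borel"
  shows "(\<lambda>t. indicat_real E t *\<^sub>R x) \<in> borel_measurable borel"
proof -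
  have "(\<lambda>r. r *\<^sub>R x) \<in> borel_measurable borel"
    by (intro borel_measurable_continuous_onI continuous_intros)
  then show ?thesis
    using measurable_compose[of "indicat_real E" borel borel "\<lambda>r. r *\<^sub>R x" borel] assms by simp
qed

lemma strongly_measurable_indicator:
  assumes "E \<in> sets borel"
  shows "strongly_measurable (\<lambda>t. indicat_real E t *\<^sub>R x)"
proof (rule strongly_measurable_simple[OF indicator_scaleR_borel[OF assms]])
  have "range (\<lambda>t. indicat_real E t *\<^sub>R x) \<subseteq> {0, x}"
    by (auto simp: indicator_def)
  then show "finite (range (\<lambda>t. indicat_real E t *\<^sub>R x))"
    by (rule finite_subset) simp
qed

lemma wn_finite_bounded_support:
  assumes "continuous_on UNIV w" "\<And>t. w t \<ge> 0"
    and "\<And>t. norm (f t) \<le> K" "\<And>t. R < \<bar>t\<bar> \<Longrightarrow> f t = 0"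
  shows "wn w f < \<infinity>"
proof -
  have "bounded (w ` {- R..R})"
    using continuous_on_subset[OF assms(1)]
    by (intro compact_imp_bounded compact_continuous_image) auto
  then obtain C where "\<forall>x\<in>w ` {- R..R}. norm x \<le> C"
    unfolding bounded_iff by blast
  then have C: "\<bar>w t\<bar> \<le> C" if "t \<in> {- R..R}" for t
    using that by auto
  have "wn w f \<le> (\<integral>\<^sup>+ t. ennreal (K\<^sup>2 * C) * indicator {- R..R} t \<partial>lborel)"
    unfolding wn_def
  proof (rule nn_integral_mono)
    fix t
    show "ennreal ((norm (f t))\<^sup>2 * w t) \<le> ennreal (K\<^sup>2 * C) * indicator {- R..R} t"
    proof (cases "t \<in> {- R..R}")
      case True
      have "(norm (f t))\<^sup>2 * w t \<le> K\<^sup>2 * C"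
        using C[OF True] assms(2)[of t] assms(3)[of t] by (intro mult_mono power_mono) auto
      then show ?thesis
        using True by (simp add: ennreal_leI)
    next
      case False
      then have "f t = 0"
        by (intro assms(4)) auto
      then show ?thesis
        by simp
    qed
  qed
  also have "\<dots> = ennreal (K\<^sup>2 * C) * emeasure lborel {- R..R}"
    by (intro nn_integral_cmult_indicator) simp
  also have "\<dots> < \<infinity>"
    by (cases "- R \<le> R") (auto simp: ennreal_mult_less_top)
  finally show ?thesis .
qed

inductive_set tensors :: "'a::banach set \<Rightarrow> (real \<Rightarrow> 'a) set" for X where
  base: "smooth \<phi> \<Longrightarrow> \<forall>t. R < \<bar>t\<bar> \<longrightarrow> \<phi> t = 0 \<Longrightarrow> x \<in> X \<Longrightarrow> (\<lambda>t. \<phi> t *\<^sub>R x) \<in> tensors X"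
| sum: "f \<in> tensors X \<Longrightarrow> g \<in> tensors X \<Longrightarrow> (\<lambda>t. f t + g t) \<in> tensors X"

lemma tensors_smooth: "f \<in> tensors X \<Longrightarrow> smooth f"
  by (induction rule: tensors.induct) (auto intro: smooth_scaleR smooth_const smooth_add)

lemma tensors_support: "f \<in> tensors X \<Longrightarrow> \<exists>R. \<forall>t. R < \<bar>t\<bar> \<longrightarrow> f t = 0"
proof (induction rule: tensors.induct)
  case (sum f g)
  then obtain R S where "\<forall>t. R < \<bar>t\<bar> \<longrightarrow> f t = 0" "\<forall>t. S < \<bar>t\<bar> \<longrightarrow> g t = 0"
    by blast
  then show ?case
    by (intro exI[of _ "max R S"]) auto
qed auto

lemma tensors_minus:
  assumes "\<And>x. x \<in> X \<Longrightarrow> - x \<in> X"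
  shows "f \<in> tensors X \<Longrightarrow> (\<lambda>t. - f t) \<in> tensors X"
proof (induction rule: tensors.induct)
  case (base \<phi> R x)
  then show ?case
    using tensors.base[of \<phi> R "- x" X] assms by simp
next
  case (sum f g)
  then show ?case
    using tensors.sum[of "\<lambda>t. - f t" X "\<lambda>t. - g t"] by simp
qed

context
  fixes w :: "real \<Rightarrow> real" and X :: "'a::banach set"
  assumes w_cont: "continuous_on UNIV w" and w_nonneg: "\<And>t. w t \<ge> 0"
    and X_dense: "closure X = UNIV" and X_minus: "\<And>x. x \<in> X \<Longrightarrow> - x \<in> X" and X_0: "0 \<in> X"
begin

definition approximable :: "(real \<Rightarrow> 'a) set" where
  "approximable = {f. strongly_measurable f \<and>
    (\<forall>e>0. \<exists>g\<in>tensors X. wn w (\<lambda>t. f t - g t) \<le> ennreal e)}"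

lemma w_borel: "w \<in> borel_measurable borel"
  using w_cont by (rule borel_measurable_continuous_onI)

lemma tensors_strongly_measurable: "g \<in> tensors X \<Longrightarrow> strongly_measurable g"
  by (intro strongly_measurable_continuous smooth_continuous tensors_smooth)

lemma approximable_limit:
  assumes "strongly_measurable f" "\<And>e. e > 0 \<Longrightarrow> \<exists>g\<in>approximable. wn w (\<lambda>t. f t - g t) \<le> ennreal e"
  shows "f \<in> approximable"
  unfolding approximable_def
proof (intro CollectI conjI allI impI assms(1))
  fix e :: real assume e: "e > 0"
  obtain g where g: "g \<in> approximable" "wn w (\<lambda>t. f t - g t) \<le> ennreal (e/4)"
    using assms(2)[of "e/4"] e by auto
  then obtain k where k: "k \<in> tensors X" "wn w (\<lambda>t. g t - k t) \<le> ennreal (e/4)"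
    using e unfolding approximable_def by (auto dest: spec[of _ "e/4"])
  have "wn w (\<lambda>t. f t - k t) \<le> 2 * wn w (\<lambda>t. f t - g t) + 2 * wn w (\<lambda>t. g t - k t)"
    using g(1) by (intro wn_dist_triangle w_borel w_nonneg assms(1) tensors_strongly_measurable[OF k(1)])
      (auto simp: approximable_def)
  also have "\<dots> \<le> 2 * ennreal (e/4) + 2 * ennreal (e/4)"
    by (intro add_mono mult_left_mono g k) auto
  also have "\<dots> = ennreal e"
    using e by (simp add: ennreal_mult[of 2, simplified, symmetric] ennreal_plus[symmetric] del: ennreal_plus)
  finally show "\<exists>g\<in>tensors X. wn w (\<lambda>t. f t - g t) \<le> ennreal e"
    using k(1) by blast
qed

lemma approximable_seq:
  assumes "\<And>n. f n \<in> approximable" "strongly_measurable g" "(\<lambda>n. wn w (\<lambda>t. f n t - g t)) \<longlonglongrightarrow> 0"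
  shows "g \<in> approximable"
proof (rule approximable_limit[OF assms(2)])
  fix e :: real assume "e > 0"
  then have "eventually (\<lambda>n. wn w (\<lambda>t. f n t - g t) < ennreal e) sequentially"
    by (intro order_tendstoD(2)[OF assms(3)]) auto
  then obtain n where "wn w (\<lambda>t. f n t - g t) < ennreal e"
    by (auto simp: eventually_sequentially)
  then show "\<exists>g'\<in>approximable. wn w (\<lambda>t. g t - g' t) \<le> ennreal e"
    using assms(1) by (intro bexI[of _ "f n"]) (auto simp: wn_diff_commute)
qed

lemma approximable_add:
  assumes "f \<in> approximable" "g \<in> approximable"
  shows "(\<lambda>t. f t + g t) \<in> approximable"
  unfolding approximable_def
proof (intro CollectI conjI allI impI)
  have fg: "strongly_measurable f" "strongly_measurable g"
    using assms by (auto simp: approximable_def)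
  then show "strongly_measurable (\<lambda>t. f t + g t)"
    by (rule strongly_measurable_add)
  fix e :: real assume e: "e > 0"
  obtain k where k: "k \<in> tensors X" "wn w (\<lambda>t. f t - k t) \<le> ennreal (e/4)"
    using assms(1) e unfolding approximable_def by (auto dest: spec[of _ "e/4"])
  obtain l where l: "l \<in> tensors X" "wn w (\<lambda>t. g t - l t) \<le> ennreal (e/4)"
    using assms(2) e unfolding approximable_def by (auto dest: spec[of _ "e/4"])
  have "wn w (\<lambda>t. (f t - k t) + (g t - l t)) \<le> 2 * wn w (\<lambda>t. f t - k t) + 2 * wn w (\<lambda>t. g t - l t)"
    by (intro wn_add_le w_borel w_nonneg strongly_measurable_diff fg
        tensors_strongly_measurable[OF k(1)] tensors_strongly_measurable[OF l(1)])
  also have "\<dots> \<le> 2 * ennreal (e/4) + 2 * ennreal (e/4)"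
    by (intro add_mono mult_left_mono k l) auto
  also have "\<dots> = ennreal e"
    using e by (simp add: ennreal_mult[of 2, simplified, symmetric] ennreal_plus[symmetric] del: ennreal_plus)
  finally have "wn w (\<lambda>t. (f t + g t) - (k t + l t)) \<le> ennreal e"
    by (simp add: algebra_simps)
  then show "\<exists>g'\<in>tensors X. wn w (\<lambda>t. f t + g t - g' t) \<le> ennreal e"
    using tensors.sum[OF k(1) l(1)] by (intro bexI[of _ "\<lambda>t. k t + l t"])
qed

lemma approximable_minus:
  assumes "f \<in> approximable"
  shows "(\<lambda>t. - f t) \<in> approximable"
  unfolding approximable_def
proof (intro CollectI conjI allI impI)
  show "strongly_measurable (\<lambda>t. - f t)"
    using assms strongly_measurable_bounded_linear[OF bounded_linear_minus[OF bounded_linear_ident]]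
    by (auto simp: approximable_def)
  fix e :: real assume e: "e > 0"
  obtain k where k: "k \<in> tensors X" "wn w (\<lambda>t. f t - k t) \<le> ennreal e"
    using assms e unfolding approximable_def by auto
  have "wn w (\<lambda>t. - f t - - k t) = wn w (\<lambda>t. f t - k t)"
    unfolding wn_diff_commute[of w f] by simp
  then show "\<exists>g'\<in>tensors X. wn w (\<lambda>t. - f t - g' t) \<le> ennreal e"
    using tensors_minus[OF X_minus k(1)] k(2) by (intro bexI[of _ "\<lambda>t. - k t"]) auto
qed

lemma approximable_tensors: "f \<in> tensors X \<Longrightarrow> f \<in> approximable"
  unfolding approximable_def
  by (auto intro!: tensors_strongly_measurable bexI[of _ f] simp: wn_zero)

lemma approximable_0: "(\<lambda>t. 0) \<in> approximable"
  using approximable_tensors[OF tensors.base[of "\<lambda>t. 0" 0 0 X]] X_0 by (simp add: smooth_const)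

lemma approximable_sum: "finite I \<Longrightarrow> (\<And>i. i \<in> I \<Longrightarrow> f i \<in> approximable) \<Longrightarrow> (\<lambda>t. \<Sum>i\<in>I. f i t) \<in> approximable"
  by (induction I rule: finite_induct) (auto intro: approximable_0 approximable_add)

lemma wn_indicator_finite:
  assumes "E \<subseteq> {-R..R}"
  shows "wn w (\<lambda>t. indicat_real E t *\<^sub>R (x::'a)) < \<infinity>"
proof (rule wn_finite_bounded_support[OF w_cont w_nonneg])
  show "norm (indicat_real E t *\<^sub>R x) \<le> norm x" for t
    by (auto simp: indicator_def)
  show "R < \<bar>t\<bar> \<Longrightarrow> indicat_real E t *\<^sub>R x = 0" for t
    using assms by (auto simp: indicator_def subset_iff abs_if split: if_splits)
qed

lemma approximable_interval_X:
  assumes "x \<in> X"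
  shows "(\<lambda>t. indicat_real {a<..<b} t *\<^sub>R x) \<in> approximable"
proof (rule approximable_seq)
  define \<phi> where "\<phi> = (\<lambda>n t. 1 - (1 - bump a b t) ^ n)"
  have pow: "smooth (\<lambda>t. (1 - bump a b t) ^ n)" for n
  proof (induction n)
    case (Suc n)
    have "smooth (\<lambda>t. 1 + - bump a b t)"
      by (intro smooth_add smooth_const smooth_bump
          smooth_bounded_linear[OF bounded_linear_minus[OF bounded_linear_ident]])
    then have "smooth (\<lambda>t. (1 - bump a b t) *\<^sub>R (1 - bump a b t) ^ n)"
      by (intro smooth_scaleR Suc) simp
    then show ?case
      by simp
  qed (simp add: smooth_const)
  have "smooth (\<lambda>t. 1 + - ((1 - bump a b t) ^ n))" for n
    by (intro smooth_add smooth_const pow smooth_bounded_linear[OF bounded_linear_minus[OF bounded_linear_ident]])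
  then have smooth: "smooth (\<phi> n)" for n
    by (simp add: \<phi>_def)
  define R where "R = max \<bar>a\<bar> \<bar>b\<bar>"
  have "\<phi> n t = 0" if "R < \<bar>t\<bar>" for n t
  proof -
    have "t \<le> a \<or> b \<le> t"
      using that by (auto simp: R_def)
    then show ?thesis
      by (simp add: bump_outside \<phi>_def)
  qed
  then show tens: "(\<lambda>t. \<phi> n t *\<^sub>R x) \<in> approximable" for n
    using smooth assms by (intro approximable_tensors tensors.base[of _ R]) auto
  show "strongly_measurable (\<lambda>t. indicat_real {a<..<b} t *\<^sub>R x)"
    by (intro strongly_measurable_indicator) simp
  show "(\<lambda>n. wn w (\<lambda>t. \<phi> n t *\<^sub>R x - indicat_real {a<..<b} t *\<^sub>R x)) \<longlonglongrightarrow> 0"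
  proof (rule wn_dominated[OF w_borel w_nonneg, where b="\<lambda>t. indicat_real {a<..<b} t *\<^sub>R x"])
    show "strongly_measurable (\<lambda>t. \<phi> n t *\<^sub>R x - indicat_real {a<..<b} t *\<^sub>R x)" for n
      using tens[of n] by (intro strongly_measurable_diff strongly_measurable_indicator)
        (auto simp: approximable_def)
    show "strongly_measurable (\<lambda>t. indicat_real {a<..<b} t *\<^sub>R x)"
      by (intro strongly_measurable_indicator) simp
    show "wn w (\<lambda>t. indicat_real {a<..<b} t *\<^sub>R x) < \<infinity>"
      by (rule wn_indicator_finite[of _ R]) (auto simp: R_def)
    have eq: "\<phi> n t *\<^sub>R x - indicat_real {a<..<b} t *\<^sub>R x =
        (indicat_real {a<..<b} t * - ((1 - bump a b t) ^ n)) *\<^sub>R x" for n t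
      using bump_outside[of t a b] by (auto simp: \<phi>_def indicator_def algebra_simps)
    have "norm ((indicat_real {a<..<b} t * - ((1 - bump a b t) ^ n)) *\<^sub>R x)
        \<le> norm (indicat_real {a<..<b} t *\<^sub>R x)" for n t
      using bump_bounds[of a b t] power_le_one[of "1 - bump a b t" n]
      by (auto simp: indicator_def intro!: mult_left_le_one_le)
    then show "AE t in lborel. norm (\<phi> n t *\<^sub>R x - indicat_real {a<..<b} t *\<^sub>R x)
        \<le> norm (indicat_real {a<..<b} t *\<^sub>R x)" for n
      unfolding eq by simp
    have "(\<lambda>n. (indicat_real {a<..<b} t * - ((1 - bump a b t) ^ n)) *\<^sub>R x) \<longlonglongrightarrow> 0" for t
    proof (cases "t \<in> {a<..<b}")
      case True
      then have "(\<lambda>n. (1 - bump a b t) ^ n) \<longlonglongrightarrow> 0"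
        using bump_pos[of a t b] bump_bounds[of a b t] by (intro LIMSEQ_realpow_zero) auto
      then have "(\<lambda>n. (indicat_real {a<..<b} t * - ((1 - bump a b t) ^ n)) *\<^sub>R x)
          \<longlonglongrightarrow> (indicat_real {a<..<b} t * - 0) *\<^sub>R x"
        by (intro tendsto_scaleR tendsto_mult tendsto_const tendsto_minus)
      then show ?thesis
        by (simp only: minus_zero mult_zero_right scaleR_zero_left)
    qed simp
    then show "AE t in lborel. (\<lambda>n. \<phi> n t *\<^sub>R x - indicat_real {a<..<b} t *\<^sub>R x) \<longlonglongrightarrow> 0"
      unfolding eq by simp
  qed
qed

lemma approximable_interval: "(\<lambda>t. indicat_real {a<..<b} t *\<^sub>R x) \<in> approximable"
proof -
  have "x \<in> closure X"
    using X_dense by simp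
  then obtain y where y: "\<And>n. y n \<in> X" "y \<longlonglongrightarrow> x"
    unfolding closure_sequential by blast
  obtain K where K: "\<And>n. norm (y n - x) \<le> K"
    using tendsto_diff[OF y(2) tendsto_const[of x]] convergent_imp_bounded[of "\<lambda>n. y n - x"]
    by (auto simp: bounded_iff)
  show ?thesis
  proof (rule approximable_seq[of "\<lambda>n t. indicat_real {a<..<b} t *\<^sub>R y n"])
    show "(\<lambda>n. wn w (\<lambda>t. indicat_real {a<..<b} t *\<^sub>R y n - indicat_real {a<..<b} t *\<^sub>R x)) \<longlonglongrightarrow> 0"
    proof (rule wn_dominated[OF w_borel w_nonneg, where b="\<lambda>t. indicat_real {a<..<b} t * K"])
      have "wn w (\<lambda>t. indicat_real {a<..<b} t * K) < \<infinity>"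
        by (rule wn_finite_bounded_support[OF w_cont w_nonneg, of _ "\<bar>K\<bar>" "max \<bar>a\<bar> \<bar>b\<bar>"])
           (auto simp: indicator_def)
      then show "wn w (\<lambda>t. indicat_real {a<..<b} t * K) < \<infinity>" .
      show "strongly_measurable (\<lambda>t. indicat_real {a<..<b} t * K)"
        using strongly_measurable_indicator[of "{a<..<b}" K] by simp
      show "AE t in lborel. norm (indicat_real {a<..<b} t *\<^sub>R y n - indicat_real {a<..<b} t *\<^sub>R x)
          \<le> norm (indicat_real {a<..<b} t * K)" for n
        using order_trans[OF K[of n] abs_ge_self] by (auto simp: indicator_def)
      have "(\<lambda>n. indicat_real {a<..<b} t *\<^sub>R y n - indicat_real {a<..<b} t *\<^sub>R x)
          \<longlonglongrightarrow> indicat_real {a<..<b} t *\<^sub>R x - indicat_real {a<..<b} t *\<^sub>R x" for t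
        by (intro tendsto_intros y)
      then show "AE t in lborel. (\<lambda>n. indicat_real {a<..<b} t *\<^sub>R y n - indicat_real {a<..<b} t *\<^sub>R x) \<longlonglongrightarrow> 0"
        by simp
    qed (intro strongly_measurable_diff strongly_measurable_indicator; simp)
  qed (auto intro!: approximable_interval_X y strongly_measurable_indicator)
qed

lemma approximable_indicator:
  assumes "E \<in> sets borel"
  shows "(\<lambda>t. indicat_real (E \<inter> {-R<..<R}) t *\<^sub>R x) \<in> approximable"
proof -
  let ?G = "range (\<lambda>(a, b). box a (b::real))"
  have "Int_stable ?G"
    unfolding Int_stable_def by (auto simp: image_iff)
  moreover have "?G \<subseteq> Pow UNIV"
    by simp
  moreover have "E \<in> sigma_sets UNIV ?G"
    using assms by (subst (asm) borel_eq_box) (simp add: sets_measure_of del: box_real)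
  ultimately show ?thesis
  proof (induction rule: sigma_sets_induct_disjoint)
    case (basic A)
    then obtain a b where "A = {a<..<b}"
      by auto
    then have "A \<inter> {-R<..<R} = {max a (-R)<..<min b R}"
      by auto
    then show ?case
      using approximable_interval by simp
  next
    case empty
    then show ?case
      using approximable_0 by simp
  next
    case (compl A)
    have "(\<lambda>t. indicat_real {-R<..<R} t *\<^sub>R x + - (indicat_real (A \<inter> {-R<..<R}) t *\<^sub>R x)) \<in> approximable"
      by (intro approximable_add approximable_minus approximable_interval compl)
    also have "(\<lambda>t. indicat_real {-R<..<R} t *\<^sub>R x + - (indicat_real (A \<inter> {-R<..<R}) t *\<^sub>R x)) =
        (\<lambda>t. indicat_real ((UNIV - A) \<inter> {-R<..<R}) t *\<^sub>R x)"
      by (auto simp: indicator_def)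
    finally show ?case .
  next
    case (union A)
    have A: "A i \<in> sets borel" for i
      using union(2) by (subst borel_eq_box) (auto simp: sets_measure_of simp del: box_real)
    let ?I = "\<lambda>E t. indicat_real (E \<inter> {-R<..<R}) t *\<^sub>R x"
    show ?case
    proof (rule approximable_seq)
      show "(\<lambda>t. \<Sum>i<n. ?I (A i) t) \<in> approximable" for n
        by (intro approximable_sum union) auto
      show "strongly_measurable (?I (\<Union>i. A i))"
        using A by (intro strongly_measurable_indicator) auto
      have eq: "(\<Sum>i<n. ?I (A i) t) = ?I (\<Union>i<n. A i) t" for n t
      proof (induction n)
        case (Suc n)
        have "t \<notin> A n" if mem: "t \<in> (\<Union>i<n. A i)"
        proof -
          obtain i where "i < n" "t \<in> A i"
            using mem by auto
          then show ?thesis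
            using disjoint_family_onD[OF union(1), of i n] by auto
        qed
        then show ?case
          using Suc by (auto simp: indicator_def less_Suc_eq)
      qed simp
      show "(\<lambda>n. wn w (\<lambda>t. (\<Sum>i<n. ?I (A i) t) - ?I (\<Union>i. A i) t)) \<longlonglongrightarrow> 0"
        unfolding eq
      proof (rule wn_dominated[OF w_borel w_nonneg, where b="?I UNIV"])
        show "strongly_measurable (\<lambda>t. ?I (\<Union>i<n. A i) t - ?I (\<Union>i. A i) t)" for n
          using A by (intro strongly_measurable_diff strongly_measurable_indicator) auto
        show "strongly_measurable (?I UNIV)"
          by (intro strongly_measurable_indicator) auto
        show "wn w (?I UNIV) < \<infinity>"
          by (rule wn_indicator_finite[of _ R]) auto
        show "AE t in lborel. norm (?I (\<Union>i<n. A i) t - ?I (\<Union>i. A i) t) \<le> norm (?I UNIV t)" for n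
          by (auto simp: indicator_def)
        have "(\<lambda>n. ?I (\<Union>i<n. A i) t - ?I (\<Union>i. A i) t) \<longlonglongrightarrow> 0" for t
        proof (cases "\<exists>j. t \<in> A j")
          case True
          then obtain j where "t \<in> A j"
            by blast
          then have "eventually (\<lambda>n. ?I (\<Union>i<n. A i) t - ?I (\<Union>i. A i) t = 0) sequentially"
            by (intro eventually_sequentiallyI[of "Suc j"]) (auto simp: indicator_def Suc_le_eq)
          then show ?thesis
            by (rule tendsto_eventually)
        qed (simp add: indicator_def)
        then show "AE t in lborel. (\<lambda>n. ?I (\<Union>i<n. A i) t - ?I (\<Union>i. A i) t) \<longlonglongrightarrow> 0"
          by simp
      qed
    qed
  qed
qed

lemma approximable_simple:
  assumes s: "s \<in> borel_measurable borel" "finite (range s)"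
  shows "(\<lambda>t. indicat_real {-R<..<R} t *\<^sub>R s t) \<in> approximable"
proof -
  have "(\<lambda>t. \<Sum>x\<in>range s. indicat_real (s -` {x} \<inter> {-R<..<R}) t *\<^sub>R x) \<in> approximable"
    using s measurable_sets[OF s(1), of "{_}"]
    by (intro approximable_sum approximable_indicator) auto
  also have "(\<lambda>t. \<Sum>x\<in>range s. indicat_real (s -` {x} \<inter> {-R<..<R}) t *\<^sub>R x) =
      (\<lambda>t. indicat_real {-R<..<R} t *\<^sub>R s t)"
  proof
    fix t
    have "(\<Sum>x\<in>range s. indicat_real (s -` {x} \<inter> {-R<..<R}) t *\<^sub>R x) =
        (\<Sum>x\<in>range s. if x = s t then indicat_real {-R<..<R} t *\<^sub>R x else 0)"
      by (intro sum.cong) (auto simp: indicator_def)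
    also have "\<dots> = indicat_real {-R<..<R} t *\<^sub>R s t"
      using s(2) by (simp add: sum.delta)
    finally show "(\<Sum>x\<in>range s. indicat_real (s -` {x} \<inter> {-R<..<R}) t *\<^sub>R x) =
        indicat_real {-R<..<R} t *\<^sub>R s t" .
  qed
  finally show ?thesis .
qed

lemma tensors_dense:
  assumes f: "strongly_measurable f" "wn w f < \<infinity>" and e: "e > 0"
  obtains g where "g \<in> tensors X" "wn w (\<lambda>t. f t - g t) \<le> ennreal e"
proof -
  obtain f' D where f': "f' \<in> borel_measurable borel" "AE t in lborel. f t = f' t"
      "countable D" "range f' \<subseteq> closure D"
    by (rule strongly_measurable_imp_borel[OF f(1)])
  obtain s where s: "\<And>n. s n \<in> borel_measurable lborel" "\<And>n. finite (range (s n))"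
      "AE t in lborel. (\<lambda>n. s n t) \<longlonglongrightarrow> f t"
    using f(1) unfolding strongly_measurable_def by blast
  \<comment> \<open>Cutting off where the simple function exceeds twice the norm of f provides the dominating function.\<close>
  define q where "q = (\<lambda>n t. if norm (s n t) \<le> 2 * norm (f' t) then s n t else 0)"
  have norm_borel [measurable]: "(\<lambda>t. norm (s n t)) \<in> borel_measurable borel"
    "(\<lambda>t. norm (f' t)) \<in> borel_measurable borel" for n
    using borel_measurable_continuous_on[OF _ f'(1), of norm]
      borel_measurable_continuous_on[OF _ s(1)[of n], of norm] by (auto intro: continuous_intros)
  have "{t. norm (s n t) \<le> 2 * norm (f' t)} \<in> sets borel" for n
    by measurable
  then have q_borel: "q n \<in> borel_measurable borel" for n
    unfolding q_def using s(1)[of n] by (intro measurable_If) auto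
  have q_fin: "finite (range (q n))" for n
    by (rule finite_subset[of _ "insert 0 (range (s n))"]) (use s(2) in \<open>auto simp: q_def\<close>)
  let ?q = "\<lambda>n t. indicat_real {-real n<..<real n} t *\<^sub>R q n t"
  have "f \<in> approximable"
  proof (rule approximable_seq[of ?q])
    show q: "?q n \<in> approximable" for n
      by (intro approximable_simple q_borel q_fin)
    show "(\<lambda>n. wn w (\<lambda>t. ?q n t - f t)) \<longlonglongrightarrow> 0"
    proof (rule wn_dominated[OF w_borel w_nonneg, where b="\<lambda>t. 3 *\<^sub>R f t"])
      show "strongly_measurable (\<lambda>t. ?q n t - f t)" for n
        using q[of n] f(1) by (intro strongly_measurable_diff) (auto simp: approximable_def)
      show "strongly_measurable (\<lambda>t. 3 *\<^sub>R f t)"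
        by (rule strongly_measurable_bounded_linear[OF bounded_linear_scaleR_right f(1)])
      have "wn w (\<lambda>t. 3 *\<^sub>R f t) \<le> ennreal (3\<^sup>2) * wn w f"
        by (rule wn_cmult_le[OF w_borel w_nonneg f(1)]) simp
      also have "\<dots> < \<infinity>"
        using f(2) by (simp add: ennreal_mult_less_top)
      finally show "wn w (\<lambda>t. 3 *\<^sub>R f t) < \<infinity>" .
      show "AE t in lborel. norm (?q n t - f t) \<le> norm (3 *\<^sub>R f t)" for n
        using f'(2)
      proof eventually_elim
        case (elim t)
        have "norm (?q n t) \<le> 2 * norm (f t)"
          using elim by (auto simp: q_def indicator_def)
        then show ?case
          using norm_triangle_ineq4[of "?q n t" "f t"] by simp
      qed
      show "AE t in lborel. (\<lambda>n. ?q n t - f t) \<longlonglongrightarrow> 0"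
        using f'(2) s(3)
      proof eventually_elim
        case (elim t)
        have "(\<lambda>n. q n t) \<longlonglongrightarrow> f t"
        proof (cases "f t = 0")
          case True
          then show ?thesis
            using elim by (intro tendsto_eventually always_eventually) (simp add: q_def)
        next
          case False
          have "(\<lambda>n. norm (s n t)) \<longlonglongrightarrow> norm (f t)"
            using elim by (intro tendsto_norm)
          then have "eventually (\<lambda>n. norm (s n t) < 2 * norm (f t)) sequentially"
            using False by (intro order_tendstoD(2)) auto
          then have "eventually (\<lambda>n. s n t = q n t) sequentially"
            by eventually_elim (use elim in \<open>auto simp: q_def\<close>)
          with elim(2) show ?thesis
            by (rule Lim_transform_eventually)
        qed
        moreover have "eventually (\<lambda>n. q n t = ?q n t) sequentially"
        proof -
          obtain N :: nat where "\<bar>t\<bar> < real N"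
            using reals_Archimedean2 by blast
          then show ?thesis
            by (intro eventually_sequentiallyI[of N]) (auto simp: indicator_def)
        qed
        ultimately have "(\<lambda>n. ?q n t) \<longlonglongrightarrow> f t"
          by (rule Lim_transform_eventually)
        then show ?case
          by (simp add: LIM_zero_iff)
      qed
    qed
  qed (rule f(1))
  then show ?thesis
    using that e unfolding approximable_def by blast
qed

end

section \<open>The spaces \<open>Hrho\<close> and graph closures\<close>

lemma weight_continuous: "continuous_on UNIV (\<lambda>t. exp (- 2 * \<rho> * t) :: real)"
  by (intro continuous_intros)

lemma weight_borel: "(\<lambda>t. exp (- 2 * \<rho> * t) :: real) \<in> borel_measurable borel"
  by measurable

lemma weight_pos: "0 < (exp (- 2 * \<rho> * t) :: real)"
  and weight_nonneg: "0 \<le> (exp (- 2 * \<rho> * t) :: real)"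
  by simp_all

lemmas wnorm_sq_cong_AE = wn_cong_AE[of _ _ "\<lambda>t. exp (- 2 * _ * t)", folded wnorm_sq_eq_wn]
lemmas wnorm_sq_cmult_le = wn_cmult_le[OF weight_borel weight_nonneg, folded wnorm_sq_eq_wn]
lemmas wnorm_sq_add_le = wn_add_le[OF weight_borel weight_nonneg, folded wnorm_sq_eq_wn]
lemmas wnorm_sq_diff_le = wn_diff_le[OF weight_borel weight_nonneg, folded wnorm_sq_eq_wn]
lemmas wnorm_sq_dist_triangle = wn_dist_triangle[OF weight_borel weight_nonneg, folded wnorm_sq_eq_wn]
lemmas wnorm_sq_Fatou = wn_Fatou[OF weight_borel weight_nonneg, folded wnorm_sq_eq_wn]
lemmas wnorm_sq_dominated = wn_dominated[OF weight_borel weight_nonneg, folded wnorm_sq_eq_wn]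
lemmas wnorm_sq_tendsto_AE_subseq =
  wn_tendsto_AE_subseq[OF weight_borel weight_nonneg weight_pos, folded wnorm_sq_eq_wn]
lemmas wnorm_sq_complete = wn_complete[OF weight_borel weight_nonneg weight_pos, folded wnorm_sq_eq_wn]
lemmas wnorm_sq_diff_commute = wn_diff_commute[of "\<lambda>t. exp (- 2 * _ * t)", folded wnorm_sq_eq_wn]
lemmas wnorm_sq_zero = wn_zero[of "\<lambda>t. exp (- 2 * _ * t)", folded wnorm_sq_eq_wn]
lemmas wnorm_sq_finite_bounded_support =
  wn_finite_bounded_support[OF weight_continuous weight_nonneg, folded wnorm_sq_eq_wn]

lemma Hrho_strongly_measurable: "f \<in> Hrho \<rho> \<Longrightarrow> strongly_measurable f"
  and Hrho_finite: "f \<in> Hrho \<rho> \<Longrightarrow> wnorm_sq \<rho> f < \<infinity>"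
  and HrhoI: "strongly_measurable f \<Longrightarrow> wnorm_sq \<rho> f < \<infinity> \<Longrightarrow> f \<in> Hrho \<rho>"
  by (auto simp: Hrho_def)

lemma Hrho_cong_AE:
  assumes "AE t in lborel. f t = g t" "f \<in> Hrho \<rho>"
  shows "g \<in> Hrho \<rho>"
  using strongly_measurable_cong_AE[OF assms(1)] wnorm_sq_cong_AE[OF assms(1)] assms(2)
  by (auto simp: Hrho_def)

lemma Hrho_add:
  assumes "f \<in> Hrho \<rho>" "g \<in> Hrho \<rho>"
  shows "(\<lambda>t. f t + g t) \<in> Hrho \<rho>"
proof (rule HrhoI)
  show "wnorm_sq \<rho> (\<lambda>t. f t + g t) < \<infinity>"
    by (rule le_less_trans[OF wnorm_sq_add_le])
       (use assms in \<open>auto simp: Hrho_def ennreal_mult_less_top\<close>)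
qed (use assms in \<open>auto simp: Hrho_def intro: strongly_measurable_add\<close>)

lemma Hrho_diff:
  assumes "f \<in> Hrho \<rho>" "g \<in> Hrho \<rho>"
  shows "(\<lambda>t. f t - g t) \<in> Hrho \<rho>"
proof (rule HrhoI)
  show "wnorm_sq \<rho> (\<lambda>t. f t - g t) < \<infinity>"
    by (rule le_less_trans[OF wnorm_sq_diff_le])
       (use assms in \<open>auto simp: Hrho_def ennreal_mult_less_top\<close>)
qed (use assms in \<open>auto simp: Hrho_def intro: strongly_measurable_diff\<close>)

lemma wnorm_sq_bounded_linear_le:
  assumes "bounded_linear L" "strongly_measurable f"
  shows "wnorm_sq \<rho> (\<lambda>t. L (f t)) \<le> ennreal ((onorm L)\<^sup>2) * wnorm_sq \<rho> f"
  by (rule wnorm_sq_cmult_le[OF assms(2)]) (rule onorm[OF assms(1)])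

lemma Hrho_bounded_linear:
  assumes "bounded_linear L" "f \<in> Hrho \<rho>"
  shows "(\<lambda>t. L (f t)) \<in> Hrho \<rho>"
proof (rule HrhoI)
  show "wnorm_sq \<rho> (\<lambda>t. L (f t)) < \<infinity>"
    by (rule le_less_trans[OF wnorm_sq_bounded_linear_le[OF assms(1)]])
       (use assms(2) in \<open>auto simp: Hrho_def ennreal_mult_less_top\<close>)
qed (use assms in \<open>auto simp: Hrho_def intro: strongly_measurable_bounded_linear\<close>)

lemma Hrho_scaleR: "f \<in> Hrho \<rho> \<Longrightarrow> (\<lambda>t. c *\<^sub>R f t) \<in> Hrho \<rho>"
  by (rule Hrho_bounded_linear[OF bounded_linear_scaleR_right])

lemma wnorm_sq_shift:
  assumes "strongly_measurable f"
  shows "wnorm_sq \<rho> (\<lambda>t. f (t + h)) = ennreal (exp (2 * \<rho> * h)) * wnorm_sq \<rho> f"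
proof -
  obtain f' D where f': "f' \<in> borel_measurable borel" "AE t in lborel. f t = f' t"
      "countable D" "range f' \<subseteq> closure D"
    by (rule strongly_measurable_imp_borel[OF assms(1)])
  define F where "F = (\<lambda>t. ennreal ((norm (f' t))\<^sup>2 * exp (- 2 * \<rho> * t)))"
  have F: "F \<in> borel_measurable borel"
    unfolding F_def using borel_measurable_norm_sq_weight[OF weight_borel weight_nonneg f'(1)] .
  have [measurable]: "(\<lambda>t. F (h + t)) \<in> borel_measurable borel"
    using measurable_compose[of "\<lambda>t. h + t" borel borel, OF _ F] by simp
  have "wnorm_sq \<rho> (\<lambda>t. f (t + h)) = wnorm_sq \<rho> (\<lambda>t. f' (t + h))"
    by (rule wnorm_sq_cong_AE) (rule AE_lborel_shift[OF f'(2)])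
  also have "\<dots> = (\<integral>\<^sup>+ t. ennreal (exp (2 * \<rho> * h)) * F (h + t) \<partial>lborel)"
    unfolding wnorm_sq_def F_def
    by (intro nn_integral_cong)
       (simp add: ennreal_mult[symmetric] mult.left_commute exp_add[symmetric] algebra_simps)
  also have "\<dots> = ennreal (exp (2 * \<rho> * h)) * (\<integral>\<^sup>+ t. F (h + t) \<partial>lborel)"
    by (intro nn_integral_cmult) simp
  also have "(\<integral>\<^sup>+ t. F (h + t) \<partial>lborel) = wnorm_sq \<rho> f'"
    using nn_integral_real_affine[of F 1 h] F by (simp add: wnorm_sq_def F_def)
  also have "wnorm_sq \<rho> f' = wnorm_sq \<rho> f"
    by (rule wnorm_sq_cong_AE) (use f'(2) in \<open>eventually_elim, simp\<close>)
  finally show ?thesis .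
qed

lemma Hrho_shift: "f \<in> Hrho \<rho> \<Longrightarrow> (\<lambda>t. f (t + h)) \<in> Hrho \<rho>"
  by (auto simp: Hrho_def wnorm_sq_shift strongly_measurable_shift ennreal_mult_less_top)

lemma Hrho_continuous_compact:
  fixes f :: "real \<Rightarrow> 'a::banach"
  assumes "continuous_on UNIV f" "\<forall>t. R < \<bar>t\<bar> \<longrightarrow> f t = 0"
  shows "f \<in> Hrho \<rho>"
proof -
  have "bounded (f ` {- R..R})"
    using continuous_on_subset[OF assms(1)]
    by (intro compact_imp_bounded compact_continuous_image) auto
  then obtain C where C: "C > 0" "\<forall>x\<in>f ` {- R..R}. norm x \<le> C"
    unfolding bounded_pos by blast
  have "norm (f t) \<le> C" for t
  proof (cases "R < \<bar>t\<bar>")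
    case False
    then have "t \<in> {- R..R}"
      by auto
    then show ?thesis
      using C by blast
  qed (use C assms(2) in auto)
  then show ?thesis
    using assms(2) by (intro HrhoI strongly_measurable_continuous assms(1)
        wnorm_sq_finite_bounded_support[of f C R]) auto
qed

lemma Hrho_interpolate:
  assumes "f \<in> Hrho \<mu>" "f \<in> Hrho \<rho>" "\<mu> \<le> \<nu>" "\<nu> \<le> \<rho>"
  shows "f \<in> Hrho \<nu>"
proof (rule HrhoI)
  show sm: "strongly_measurable f"
    using assms(1) by (rule Hrho_strongly_measurable)
  obtain f' D where f': "f' \<in> borel_measurable borel" "AE t in lborel. f t = f' t"
      "countable D" "range f' \<subseteq> closure D"
    by (rule strongly_measurable_imp_borel[OF sm])
  have eq: "wnorm_sq \<rho> f = wnorm_sq \<rho> f'" for \<rho>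
    by (rule wnorm_sq_cong_AE[OF f'(2)])
  have "wnorm_sq \<nu> f' \<le> (\<integral>\<^sup>+ t. ennreal ((norm (f' t))\<^sup>2 * exp (- 2 * \<mu> * t)) +
      ennreal ((norm (f' t))\<^sup>2 * exp (- 2 * \<rho> * t)) \<partial>lborel)"
    unfolding wnorm_sq_def
  proof (rule nn_integral_mono)
    fix t
    have "exp (- 2 * \<nu> * t) \<le> exp (- 2 * \<mu> * t) + exp (- 2 * \<rho> * t)"
    proof (cases "t \<ge> 0")
      case True
      then have "\<mu> * t \<le> \<nu> * t"
        using assms(3) by (intro mult_right_mono)
      then have "exp (- 2 * \<nu> * t) \<le> exp (- 2 * \<mu> * t)"
        by simp
      then show ?thesis
        by (intro add_increasing2) auto
    next
      case False
      then have "\<rho> * t \<le> \<nu> * t"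
        using assms(4) by (intro mult_right_mono_neg) auto
      then have "exp (- 2 * \<nu> * t) \<le> exp (- 2 * \<rho> * t)"
        by simp
      then show ?thesis
        by (intro add_increasing) auto
    qed
    then have "(norm (f' t))\<^sup>2 * exp (- 2 * \<nu> * t) \<le>
        (norm (f' t))\<^sup>2 * exp (- 2 * \<mu> * t) + (norm (f' t))\<^sup>2 * exp (- 2 * \<rho> * t)"
      unfolding distrib_left[symmetric] by (intro mult_left_mono) auto
    then show "ennreal ((norm (f' t))\<^sup>2 * exp (- 2 * \<nu> * t)) \<le>
        ennreal ((norm (f' t))\<^sup>2 * exp (- 2 * \<mu> * t)) + ennreal ((norm (f' t))\<^sup>2 * exp (- 2 * \<rho> * t))"
      using ennreal_leI by (subst ennreal_plus[symmetric]) (simp_all del: ennreal_plus)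
  qed
  also have "\<dots> = wnorm_sq \<mu> f' + wnorm_sq \<rho> f'"
    unfolding wnorm_sq_def
    using borel_measurable_norm_sq_weight[OF weight_borel weight_nonneg f'(1)]
    by (intro nn_integral_add) auto
  also have "\<dots> < \<infinity>"
    using assms(1,2) eq by (auto simp: Hrho_def)
  finally show "wnorm_sq \<nu> f < \<infinity>"
    using eq by simp
qed

lemma wnorm_sq_eq_nrm: "f \<in> Hrho \<rho> \<Longrightarrow> wnorm_sq \<rho> f = ennreal ((nrm \<rho> f)\<^sup>2)"
  by (auto simp: nrm_def Hrho_def less_top)

lemma nrm_tendsto_0_iff:
  assumes "\<And>n. f n \<in> Hrho \<rho>"
  shows "(\<lambda>n. nrm \<rho> (f n)) \<longlonglongrightarrow> 0 \<longleftrightarrow> (\<lambda>n. wnorm_sq \<rho> (f n)) \<longlonglongrightarrow> 0"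
proof
  assume "(\<lambda>n. nrm \<rho> (f n)) \<longlonglongrightarrow> 0"
  then have "(\<lambda>n. ennreal ((nrm \<rho> (f n))\<^sup>2)) \<longlonglongrightarrow> ennreal (0\<^sup>2)"
    by (intro tendsto_ennrealI tendsto_power)
  then show "(\<lambda>n. wnorm_sq \<rho> (f n)) \<longlonglongrightarrow> 0"
    by (simp add: wnorm_sq_eq_nrm[OF assms])
next
  assume "(\<lambda>n. wnorm_sq \<rho> (f n)) \<longlonglongrightarrow> 0"
  then have "(\<lambda>n. enn2real (wnorm_sq \<rho> (f n))) \<longlonglongrightarrow> enn2real 0"
    by (intro tendsto_enn2real) (auto simp: zero_ennreal_def[symmetric])
  then have "(\<lambda>n. sqrt (enn2real (wnorm_sq \<rho> (f n)))) \<longlonglongrightarrow> sqrt (enn2real 0)"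
    by (rule tendsto_real_sqrt)
  then show "(\<lambda>n. nrm \<rho> (f n)) \<longlonglongrightarrow> 0"
    by (simp add: nrm_def)
qed

lemma nrm_eq_0_iff: "f \<in> Hrho \<rho> \<Longrightarrow> nrm \<rho> f = 0 \<longleftrightarrow> wnorm_sq \<rho> f = 0"
  by (auto simp: wnorm_sq_eq_nrm)

lemma wnorm_sq_eq_0_imp_AE:
  assumes "strongly_measurable f" "wnorm_sq \<rho> f = 0"
  shows "AE t in lborel. f t = 0"
proof -
  obtain f' D where f': "f' \<in> borel_measurable borel" "AE t in lborel. f t = f' t"
      "countable D" "range f' \<subseteq> closure D"
    by (rule strongly_measurable_imp_borel[OF assms(1)])
  have "(\<integral>\<^sup>+ t. ennreal ((norm (f' t))\<^sup>2 * exp (- 2 * \<rho> * t)) \<partial>lborel) = 0"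
    using assms(2) wnorm_sq_cong_AE[OF f'(2)] by (simp add: wnorm_sq_def)
  then have "AE t in lborel. ennreal ((norm (f' t))\<^sup>2 * exp (- 2 * \<rho> * t)) = 0"
    using borel_measurable_norm_sq_weight[OF weight_borel weight_nonneg f'(1)]
    by (subst (asm) nn_integral_0_iff_AE) auto
  with f'(2) show ?thesis
    by eventually_elim (auto simp: ennreal_eq_0_iff mult_le_0_iff)
qed

lemma ennreal_squeeze_0:
  fixes a b :: "nat \<Rightarrow> ennreal"
  assumes "b \<longlonglongrightarrow> 0" "\<And>n. a n \<le> b n"
  shows "a \<longlonglongrightarrow> 0"
  by (rule tendsto_sandwich[OF _ _ tendsto_const assms(1)]) (use assms(2) in auto)

lemma ennreal_tendsto_0_lincomb:
  fixes a b :: "nat \<Rightarrow> ennreal"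
  assumes "a \<longlonglongrightarrow> 0" "b \<longlonglongrightarrow> 0" "C < \<infinity>" "D < \<infinity>"
  shows "(\<lambda>n. C * a n + D * b n) \<longlonglongrightarrow> 0"
proof -
  have "(\<lambda>n. C * a n + D * b n) \<longlonglongrightarrow> C * 0 + D * 0"
    using assms by (intro tendsto_add ennreal_tendsto_cmult) auto
  then show ?thesis
    by simp
qed

lemma gclosureI:
  assumes "u \<in> Hrho \<rho>" "f \<in> Hrho \<rho>"
    and "\<And>n. (un n, fn n) \<in> G" "\<And>n. un n \<in> Hrho \<rho>" "\<And>n. fn n \<in> Hrho \<rho>"
    and "(\<lambda>n. wnorm_sq \<rho> (\<lambda>t. un n t - u t)) \<longlonglongrightarrow> 0" "(\<lambda>n. wnorm_sq \<rho> (\<lambda>t. fn n t - f t)) \<longlonglongrightarrow> 0"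
  shows "(u, f) \<in> gclosure \<rho> G"
proof -
  have "(\<lambda>n. nrm \<rho> (\<lambda>t. un n t - u t)) \<longlonglongrightarrow> 0" "(\<lambda>n. nrm \<rho> (\<lambda>t. fn n t - f t)) \<longlonglongrightarrow> 0"
    by (rule nrm_tendsto_0_iff[THEN iffD2, OF Hrho_diff assms(6)] nrm_tendsto_0_iff[THEN iffD2, OF Hrho_diff assms(7)];
        rule assms)+
  then show ?thesis
    unfolding gclosure_def using assms by blast
qed

lemma gclosureE:
  assumes "(u, f) \<in> gclosure \<rho> G"
  obtains un fn where "u \<in> Hrho \<rho>" "f \<in> Hrho \<rho>"
    "\<forall>n. (un n, fn n) \<in> G" "\<forall>n. un n \<in> Hrho \<rho>" "\<forall>n. fn n \<in> Hrho \<rho>"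
    "(\<lambda>n. wnorm_sq \<rho> (\<lambda>t. un n t - u t)) \<longlonglongrightarrow> 0" "(\<lambda>n. wnorm_sq \<rho> (\<lambda>t. fn n t - f t)) \<longlonglongrightarrow> 0"
proof -
  obtain un fn where *: "u \<in> Hrho \<rho>" "f \<in> Hrho \<rho>"
      "\<And>n. (un n, fn n) \<in> G" "\<And>n. un n \<in> Hrho \<rho>" "\<And>n. fn n \<in> Hrho \<rho>"
      "(\<lambda>n. nrm \<rho> (\<lambda>t. un n t - u t)) \<longlonglongrightarrow> 0" "(\<lambda>n. nrm \<rho> (\<lambda>t. fn n t - f t)) \<longlonglongrightarrow> 0"
    using assms unfolding gclosure_def by blast
  have "(\<lambda>n. wnorm_sq \<rho> (\<lambda>t. un n t - u t)) \<longlonglongrightarrow> 0" "(\<lambda>n. wnorm_sq \<rho> (\<lambda>t. fn n t - f t)) \<longlonglongrightarrow> 0"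
    by (rule nrm_tendsto_0_iff[THEN iffD1, OF Hrho_diff *(6)] nrm_tendsto_0_iff[THEN iffD1, OF Hrho_diff *(7)];
        rule *)+
  with * show ?thesis
    by (intro that) auto
qed

lemma gclosure_Hrho: "(u, f) \<in> gclosure \<rho> G \<Longrightarrow> u \<in> Hrho \<rho>" "(u, f) \<in> gclosure \<rho> G \<Longrightarrow> f \<in> Hrho \<rho>"
  by (auto simp: gclosure_def)

lemma gclosure_closed:
  assumes uf: "u \<in> Hrho \<rho>" "f \<in> Hrho \<rho>" and G: "\<And>n. (un n, fn n) \<in> gclosure \<rho> G"
    and lim: "(\<lambda>n. wnorm_sq \<rho> (\<lambda>t. un n t - u t)) \<longlonglongrightarrow> 0" "(\<lambda>n. wnorm_sq \<rho> (\<lambda>t. fn n t - f t)) \<longlonglongrightarrow> 0"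
  shows "(u, f) \<in> gclosure \<rho> G"
proof -
  have "\<forall>n. \<exists>p. p \<in> G \<and> fst p \<in> Hrho \<rho> \<and> snd p \<in> Hrho \<rho> \<and>
      wnorm_sq \<rho> (\<lambda>t. fst p t - un n t) \<le> ennreal (inverse (real (Suc n))) \<and>
      wnorm_sq \<rho> (\<lambda>t. snd p t - fn n t) \<le> ennreal (inverse (real (Suc n)))"
  proof
    fix n
    obtain a b where ab: "un n \<in> Hrho \<rho>" "fn n \<in> Hrho \<rho>"
        "\<forall>k. (a k, b k) \<in> G" "\<forall>k. a k \<in> Hrho \<rho>" "\<forall>k. b k \<in> Hrho \<rho>"
        "(\<lambda>k. wnorm_sq \<rho> (\<lambda>t. a k t - un n t)) \<longlonglongrightarrow> 0" "(\<lambda>k. wnorm_sq \<rho> (\<lambda>t. b k t - fn n t)) \<longlonglongrightarrow> 0"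
      by (rule gclosureE[OF G[of n]])
    have "eventually (\<lambda>k. wnorm_sq \<rho> (\<lambda>t. a k t - un n t) < ennreal (inverse (real (Suc n))) \<and>
        wnorm_sq \<rho> (\<lambda>t. b k t - fn n t) < ennreal (inverse (real (Suc n)))) sequentially"
      by (intro eventually_conj order_tendstoD(2)[OF ab(6)] order_tendstoD(2)[OF ab(7)]) simp_all
    then obtain k where "wnorm_sq \<rho> (\<lambda>t. a k t - un n t) < ennreal (inverse (real (Suc n)))"
        "wnorm_sq \<rho> (\<lambda>t. b k t - fn n t) < ennreal (inverse (real (Suc n)))"
      by (auto simp: eventually_sequentially)
    then show "\<exists>p. p \<in> G \<and> fst p \<in> Hrho \<rho> \<and> snd p \<in> Hrho \<rho> \<and>
      wnorm_sq \<rho> (\<lambda>t. fst p t - un n t) \<le> ennreal (inverse (real (Suc n))) \<and>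
      wnorm_sq \<rho> (\<lambda>t. snd p t - fn n t) \<le> ennreal (inverse (real (Suc n)))"
      using ab(3-5) by (intro exI[of _ "(a k, b k)"]) (auto intro: less_imp_le)
  qed
  from choice[OF this] obtain p where p: "\<And>n. p n \<in> G" "\<And>n. fst (p n) \<in> Hrho \<rho>" "\<And>n. snd (p n) \<in> Hrho \<rho>"
      "\<And>n. wnorm_sq \<rho> (\<lambda>t. fst (p n) t - un n t) \<le> ennreal (inverse (real (Suc n)))"
      "\<And>n. wnorm_sq \<rho> (\<lambda>t. snd (p n) t - fn n t) \<le> ennreal (inverse (real (Suc n)))"
    by auto
  have inv: "(\<lambda>n. ennreal (inverse (real (Suc n)))) \<longlonglongrightarrow> 0"
    using tendsto_ennrealI[OF LIMSEQ_inverse_real_of_nat] by simp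
  show ?thesis
  proof (rule gclosureI[OF uf])
    show "(fst (p n), snd (p n)) \<in> G" for n
      using p(1)[of n] by simp
    show "(\<lambda>n. wnorm_sq \<rho> (\<lambda>t. fst (p n) t - u t)) \<longlonglongrightarrow> 0"
    proof (rule ennreal_squeeze_0[OF ennreal_tendsto_0_lincomb[OF inv lim(1), of 2 2]])
      fix n
      have "wnorm_sq \<rho> (\<lambda>t. fst (p n) t - u t) \<le>
          2 * wnorm_sq \<rho> (\<lambda>t. fst (p n) t - un n t) + 2 * wnorm_sq \<rho> (\<lambda>t. un n t - u t)"
        by (intro wnorm_sq_dist_triangle Hrho_strongly_measurable[OF p(2)] Hrho_strongly_measurable[OF uf(1)]
            Hrho_strongly_measurable[OF gclosure_Hrho(1)[OF G]])
      also have "\<dots> \<le> 2 * ennreal (inverse (real (Suc n))) + 2 * wnorm_sq \<rho> (\<lambda>t. un n t - u t)"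
        by (intro add_mono mult_left_mono p) auto
      finally show "wnorm_sq \<rho> (\<lambda>t. fst (p n) t - u t) \<le>
          2 * ennreal (inverse (real (Suc n))) + 2 * wnorm_sq \<rho> (\<lambda>t. un n t - u t)" .
    qed auto
    show "(\<lambda>n. wnorm_sq \<rho> (\<lambda>t. snd (p n) t - f t)) \<longlonglongrightarrow> 0"
    proof (rule ennreal_squeeze_0[OF ennreal_tendsto_0_lincomb[OF inv lim(2), of 2 2]])
      fix n
      have "wnorm_sq \<rho> (\<lambda>t. snd (p n) t - f t) \<le>
          2 * wnorm_sq \<rho> (\<lambda>t. snd (p n) t - fn n t) + 2 * wnorm_sq \<rho> (\<lambda>t. fn n t - f t)"
        by (intro wnorm_sq_dist_triangle Hrho_strongly_measurable[OF p(3)] Hrho_strongly_measurable[OF uf(2)]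
            Hrho_strongly_measurable[OF gclosure_Hrho(2)[OF G]])
      also have "\<dots> \<le> 2 * ennreal (inverse (real (Suc n))) + 2 * wnorm_sq \<rho> (\<lambda>t. fn n t - f t)"
        by (intro add_mono mult_left_mono p) auto
      finally show "wnorm_sq \<rho> (\<lambda>t. snd (p n) t - f t) \<le>
          2 * ennreal (inverse (real (Suc n))) + 2 * wnorm_sq \<rho> (\<lambda>t. fn n t - f t)" .
    qed auto
  qed (use p in auto)
qed

lemma gclosure_subset:
  assumes "(u, f) \<in> G" "u \<in> Hrho \<rho>" "f \<in> Hrho \<rho>"
  shows "(u, f) \<in> gclosure \<rho> G"
  by (rule gclosureI[of _ _ _ "\<lambda>_. u" "\<lambda>_. f"]) (use assms in \<open>auto simp: wnorm_sq_zero\<close>)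

lemma gclosure_add:
  assumes G: "\<And>u f v g. (u, f) \<in> G \<Longrightarrow> (v, g) \<in> G \<Longrightarrow> ((\<lambda>t. u t + v t), (\<lambda>t. f t + g t)) \<in> G"
    and uf: "(u, f) \<in> gclosure \<rho> G" and vg: "(v, g) \<in> gclosure \<rho> G"
  shows "((\<lambda>t. u t + v t), (\<lambda>t. f t + g t)) \<in> gclosure \<rho> G"
proof -
  obtain un fn where *: "u \<in> Hrho \<rho>" "f \<in> Hrho \<rho>"
      "\<forall>n. (un n, fn n) \<in> G" "\<forall>n. un n \<in> Hrho \<rho>" "\<forall>n. fn n \<in> Hrho \<rho>"
      "(\<lambda>n. wnorm_sq \<rho> (\<lambda>t. un n t - u t)) \<longlonglongrightarrow> 0" "(\<lambda>n. wnorm_sq \<rho> (\<lambda>t. fn n t - f t)) \<longlonglongrightarrow> 0"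
    by (rule gclosureE[OF uf])
  obtain vn gn where **: "v \<in> Hrho \<rho>" "g \<in> Hrho \<rho>"
      "\<forall>n. (vn n, gn n) \<in> G" "\<forall>n. vn n \<in> Hrho \<rho>" "\<forall>n. gn n \<in> Hrho \<rho>"
      "(\<lambda>n. wnorm_sq \<rho> (\<lambda>t. vn n t - v t)) \<longlonglongrightarrow> 0" "(\<lambda>n. wnorm_sq \<rho> (\<lambda>t. gn n t - g t)) \<longlonglongrightarrow> 0"
    by (rule gclosureE[OF vg])
  have lim: "(\<lambda>n. wnorm_sq \<rho> (\<lambda>t. (an n t + bn n t) - (a t + b t))) \<longlonglongrightarrow> 0"
    if "\<forall>n. an n \<in> Hrho \<rho>" "\<forall>n. bn n \<in> Hrho \<rho>" "a \<in> Hrho \<rho>" "b \<in> Hrho \<rho>"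
      and la: "(\<lambda>n. wnorm_sq \<rho> (\<lambda>t. an n t - a t)) \<longlonglongrightarrow> 0"
      and lb: "(\<lambda>n. wnorm_sq \<rho> (\<lambda>t. bn n t - b t)) \<longlonglongrightarrow> 0" for an bn a and b :: "real \<Rightarrow> 'a"
  proof (rule ennreal_squeeze_0[OF ennreal_tendsto_0_lincomb[OF la lb, of 2 2]])
    fix n
    have "wnorm_sq \<rho> (\<lambda>t. (an n t - a t) + (bn n t - b t)) \<le>
        2 * wnorm_sq \<rho> (\<lambda>t. an n t - a t) + 2 * wnorm_sq \<rho> (\<lambda>t. bn n t - b t)"
      using that(1-4) by (intro wnorm_sq_add_le strongly_measurable_diff) (auto simp: Hrho_def)
    then show "wnorm_sq \<rho> (\<lambda>t. (an n t + bn n t) - (a t + b t)) \<le>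
        2 * wnorm_sq \<rho> (\<lambda>t. an n t - a t) + 2 * wnorm_sq \<rho> (\<lambda>t. bn n t - b t)"
      by (simp add: algebra_simps)
  qed auto
  show ?thesis
    by (rule gclosureI[of _ _ _ "\<lambda>n t. un n t + vn n t" "\<lambda>n t. fn n t + gn n t"])
       (use * ** in \<open>auto intro!: Hrho_add G lim\<close>)
qed

lemma gclosure_bounded_linear:
  assumes L: "bounded_linear L" and G: "\<And>u f. (u, f) \<in> G \<Longrightarrow> ((\<lambda>t. L (u t)), (\<lambda>t. L (f t))) \<in> G"
    and uf: "(u, f) \<in> gclosure \<rho> G"
  shows "((\<lambda>t. L (u t)), (\<lambda>t. L (f t))) \<in> gclosure \<rho> G"
proof -
  obtain un fn where *: "u \<in> Hrho \<rho>" "f \<in> Hrho \<rho>"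
      "\<forall>n. (un n, fn n) \<in> G" "\<forall>n. un n \<in> Hrho \<rho>" "\<forall>n. fn n \<in> Hrho \<rho>"
      "(\<lambda>n. wnorm_sq \<rho> (\<lambda>t. un n t - u t)) \<longlonglongrightarrow> 0" "(\<lambda>n. wnorm_sq \<rho> (\<lambda>t. fn n t - f t)) \<longlonglongrightarrow> 0"
    by (rule gclosureE[OF uf])
  have lim: "(\<lambda>n. wnorm_sq \<rho> (\<lambda>t. L (an n t) - L (a t))) \<longlonglongrightarrow> 0"
    if "\<forall>n. an n \<in> Hrho \<rho>" "a \<in> Hrho \<rho>" and la: "(\<lambda>n. wnorm_sq \<rho> (\<lambda>t. an n t - a t)) \<longlonglongrightarrow> 0" for an a
  proof (rule ennreal_squeeze_0[OF ennreal_tendsto_0_lincomb[OF la la, of "ennreal ((onorm L)\<^sup>2)" 0]])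
    fix n
    have "wnorm_sq \<rho> (\<lambda>t. L (an n t - a t)) \<le> ennreal ((onorm L)\<^sup>2) * wnorm_sq \<rho> (\<lambda>t. an n t - a t)"
      using that(1,2) by (intro wnorm_sq_bounded_linear_le L strongly_measurable_diff) (auto simp: Hrho_def)
    then show "wnorm_sq \<rho> (\<lambda>t. L (an n t) - L (a t)) \<le>
        ennreal ((onorm L)\<^sup>2) * wnorm_sq \<rho> (\<lambda>t. an n t - a t) + 0 * wnorm_sq \<rho> (\<lambda>t. an n t - a t)"
      using L by (simp add: bounded_linear.linear linear_diff)
  qed auto
  show ?thesis
    by (rule gclosureI[of _ _ _ "\<lambda>n t. L (un n t)" "\<lambda>n t. L (fn n t)"])
       (use * in \<open>auto intro!: Hrho_bounded_linear[OF L] G lim\<close>)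
qed

lemma gclosure_cong_AE:
  assumes "(u, f) \<in> gclosure \<rho> G" "AE t in lborel. u t = u' t"
  shows "(u', f) \<in> gclosure \<rho> G"
proof (rule gclosure_closed[of _ _ _ "\<lambda>_. u" "\<lambda>_. f"])
  have "wnorm_sq \<rho> (\<lambda>t. u t - u' t) = wnorm_sq \<rho> (\<lambda>t. 0::'a)"
    by (rule wnorm_sq_cong_AE) (use assms(2) in \<open>eventually_elim, simp\<close>)
  then show "(\<lambda>n. wnorm_sq \<rho> (\<lambda>t. u t - u' t)) \<longlonglongrightarrow> 0"
    by (simp add: wnorm_sq_zero)
  show "u' \<in> Hrho \<rho>"
    using Hrho_cong_AE[OF assms(2) gclosure_Hrho(1)[OF assms(1)]] .
qed (use assms gclosure_Hrho in \<open>auto simp: wnorm_sq_zero\<close>)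

section \<open>Difference quotients and the time derivative\<close>

definition dq :: "real \<Rightarrow> (real \<Rightarrow> 'a::banach) \<Rightarrow> real \<Rightarrow> 'a" where
  "dq \<epsilon> f t = (1/\<epsilon>) *\<^sub>R (f t - f (t - \<epsilon>))"

lemma dq_strongly_measurable: "strongly_measurable f \<Longrightarrow> strongly_measurable (dq \<epsilon> f)"
  unfolding dq_def[abs_def] using strongly_measurable_shift[of f "-\<epsilon>"]
  by (intro strongly_measurable_bounded_linear[OF bounded_linear_scaleR_right] strongly_measurable_diff) auto

lemma dq_Hrho: "f \<in> Hrho \<rho> \<Longrightarrow> dq \<epsilon> f \<in> Hrho \<rho>"
  unfolding dq_def[abs_def] using Hrho_shift[of f \<rho> "-\<epsilon>"] by (intro Hrho_scaleR Hrho_diff) auto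

lemma dq_diff: "dq \<epsilon> (\<lambda>t. f t - g t) = (\<lambda>t. dq \<epsilon> f t - dq \<epsilon> g t)"
  by (simp add: fun_eq_iff dq_def algebra_simps)

lemma integral_square_le:
  fixes k :: "real \<Rightarrow> real"
  assumes "continuous_on UNIV k" "\<And>s. k s \<ge> 0" "\<epsilon> > 0"
  shows "(integral {t - \<epsilon>..t} k)\<^sup>2 \<le> \<epsilon> * integral {t - \<epsilon>..t} (\<lambda>s. (k s)\<^sup>2)"
proof -
  let ?K = "integral {t - \<epsilon>..t} k" and ?Q = "integral {t - \<epsilon>..t} (\<lambda>s. (k s)\<^sup>2)"
  have int: "k integrable_on {t - \<epsilon>..t}" "(\<lambda>s. (k s)\<^sup>2) integrable_on {t - \<epsilon>..t}"
    using assms(1) by (auto intro!: integrable_continuous_real continuous_intros intro: continuous_on_subset)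
  have "((\<lambda>s. (?K/\<epsilon>)\<^sup>2 - 2 * (?K/\<epsilon>) * k s + (k s)\<^sup>2) has_integral
      (t - (t - \<epsilon>)) *\<^sub>R (?K/\<epsilon>)\<^sup>2 - 2 * (?K/\<epsilon>) * ?K + ?Q) {t - \<epsilon>..t}"
    using assms(3) by (intro has_integral_add has_integral_diff has_integral_const_real[THEN has_integral_eq_rhs]
        has_integral_mult_right integrable_integral int) auto
  then have "0 \<le> (t - (t - \<epsilon>)) *\<^sub>R (?K/\<epsilon>)\<^sup>2 - 2 * (?K/\<epsilon>) * ?K + ?Q"
    by (rule has_integral_nonneg) (use sum_squares_bound[of "?K/\<epsilon>"] in \<open>simp add: algebra_simps\<close>)
  then have "?K\<^sup>2 / \<epsilon> \<le> ?Q"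
    using assms(3) by (simp add: power2_eq_square field_simps)
  then show ?thesis
    using assms(3) by (simp add: field_simps)
qed

lemma wnorm_sq_window_le:
  fixes k :: "real \<Rightarrow> 'a::banach"
  assumes k: "continuous_on UNIV k" and \<epsilon>: "\<epsilon> > 0" and \<rho>: "\<rho> \<ge> 0"
  shows "wnorm_sq \<rho> (\<lambda>t. integral {t - \<epsilon>..t} (\<lambda>s. norm (k s))) \<le> ennreal (\<epsilon>\<^sup>2) * wnorm_sq \<rho> k"
proof -
  have cn: "continuous_on UNIV (\<lambda>s. norm (k s))"
    using k by (intro continuous_intros)
  have [measurable]: "(\<lambda>s. norm (k s)) \<in> borel_measurable borel"
    by (rule borel_measurable_continuous_onI[OF cn])
  define F where "F = (\<lambda>t s. ennreal \<epsilon> * ennreal ((norm (k s))\<^sup>2) * indicator {0..\<epsilon>} (t - s) * ennreal (exp (- 2 * \<rho> * t)))"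
  have "wnorm_sq \<rho> (\<lambda>t. integral {t - \<epsilon>..t} (\<lambda>s. norm (k s))) \<le> (\<integral>\<^sup>+ t. (\<integral>\<^sup>+ s. F t s \<partial>lborel) \<partial>lborel)"
    unfolding wnorm_sq_def
  proof (rule nn_integral_mono)
    fix t
    let ?K = "integral {t - \<epsilon>..t} (\<lambda>s. norm (k s))" and ?Q = "integral {t - \<epsilon>..t} (\<lambda>s. (norm (k s))\<^sup>2)"
    have "(\<lambda>s. (norm (k s))\<^sup>2) integrable_on {t - \<epsilon>..t}"
      using k by (auto intro!: integrable_continuous_real continuous_intros intro: continuous_on_subset)
    then have Q: "(\<integral>\<^sup>+ s. ennreal ((norm (k s))\<^sup>2) * indicator {t - \<epsilon>..t} s \<partial>lborel) = ennreal ?Q"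
      by (intro nn_integral_has_integral_lebesgue' integrable_integral) auto
    have "ennreal ((norm ?K)\<^sup>2 * exp (- 2 * \<rho> * t)) \<le> ennreal (\<epsilon> * ?Q * exp (- 2 * \<rho> * t))"
      using integral_square_le[OF cn _ \<epsilon>, of t] by (intro ennreal_leI mult_right_mono) auto
    also have "\<dots> = ennreal \<epsilon> * ennreal ?Q * ennreal (exp (- 2 * \<rho> * t))"
      using \<epsilon> by (simp add: ennreal_mult[symmetric] integral_nonneg \<open>(\<lambda>s. (norm (k s))\<^sup>2) integrable_on {t - \<epsilon>..t}\<close>)
    also have "\<dots> = (\<integral>\<^sup>+ s. ennreal \<epsilon> * (ennreal ((norm (k s))\<^sup>2) * indicator {t - \<epsilon>..t} s) * ennreal (exp (- 2 * \<rho> * t)) \<partial>lborel)"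
      unfolding Q[symmetric] by (simp add: nn_integral_multc nn_integral_cmult)
    also have "\<dots> = (\<integral>\<^sup>+ s. F t s \<partial>lborel)"
      unfolding F_def by (intro nn_integral_cong) (auto simp: indicator_def)
    finally show "ennreal ((norm ?K)\<^sup>2 * exp (- 2 * \<rho> * t)) \<le> (\<integral>\<^sup>+ s. F t s \<partial>lborel)" .
  qed
  also have "\<dots> = (\<integral>\<^sup>+ s. (\<integral>\<^sup>+ t. F t s \<partial>lborel) \<partial>lborel)"
    unfolding F_def by (rule lborel_pair.Fubini'[symmetric]) measurable
  also have "\<dots> \<le> (\<integral>\<^sup>+ s. ennreal (\<epsilon>\<^sup>2) * ennreal ((norm (k s))\<^sup>2 * exp (- 2 * \<rho> * s)) \<partial>lborel)"
  proof (rule nn_integral_mono)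
    fix s
    have "(\<integral>\<^sup>+ t. F t s \<partial>lborel) \<le>
        (\<integral>\<^sup>+ t. ennreal (\<epsilon> * (norm (k s))\<^sup>2 * exp (- 2 * \<rho> * s)) * indicator {s..s + \<epsilon>} t \<partial>lborel)"
    proof (rule nn_integral_mono)
      fix t
      show "F t s \<le> ennreal (\<epsilon> * (norm (k s))\<^sup>2 * exp (- 2 * \<rho> * s)) * indicator {s..s + \<epsilon>} t"
      proof (cases "t \<in> {s..s + \<epsilon>}")
        case True
        then have "\<rho> * s \<le> \<rho> * t"
          using \<rho> by (intro mult_left_mono) auto
        then have "\<epsilon> * (norm (k s))\<^sup>2 * exp (- 2 * \<rho> * t) \<le> \<epsilon> * (norm (k s))\<^sup>2 * exp (- 2 * \<rho> * s)"
          using \<epsilon> by (intro mult_left_mono) auto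
        then show ?thesis
          using True \<epsilon> by (simp add: F_def indicator_def ennreal_mult[symmetric] ennreal_leI)
      next
        case False
        then show ?thesis
          by (auto simp: F_def indicator_def)
      qed
    qed
    also have "\<dots> = ennreal (\<epsilon> * (norm (k s))\<^sup>2 * exp (- 2 * \<rho> * s)) * ennreal \<epsilon>"
      using \<epsilon> by (subst nn_integral_cmult_indicator) auto
    also have "\<dots> = ennreal (\<epsilon>\<^sup>2) * ennreal ((norm (k s))\<^sup>2 * exp (- 2 * \<rho> * s))"
      using \<epsilon> by (simp add: ennreal_mult[symmetric] power2_eq_square algebra_simps)
    finally show "(\<integral>\<^sup>+ t. F t s \<partial>lborel) \<le> ennreal (\<epsilon>\<^sup>2) * ennreal ((norm (k s))\<^sup>2 * exp (- 2 * \<rho> * s))" .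
  qed
  also have "\<dots> = ennreal (\<epsilon>\<^sup>2) * wnorm_sq \<rho> k"
    unfolding wnorm_sq_def by (intro nn_integral_cmult) measurable
  finally show ?thesis .
qed

lemma increment_le_integral:
  fixes v :: "real \<Rightarrow> 'a::banach"
  assumes v: "\<forall>t. (v has_vector_derivative v' t) (at t)" and v': "continuous_on UNIV v'"
    and "t - \<epsilon> \<le> s" "s \<le> t"
  shows "norm (v t - v s) \<le> integral {t - \<epsilon>..t} (\<lambda>s. norm (v' s))"
proof -
  have int: "(\<lambda>s. norm (v' s)) integrable_on {a..b}" "v' integrable_on {a..b}" for a b
    using v' by (auto intro!: integrable_continuous_real continuous_intros intro: continuous_on_subset)
  have "(v' has_integral (v t - v s)) {s..t}"
    using v assms(4) by (intro fundamental_theorem_of_calculus) (auto intro: has_vector_derivative_at_within)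
  then have "norm (v t - v s) = norm (integral {s..t} v')"
    by (simp add: integral_unique)
  also have "\<dots> \<le> integral {s..t} (\<lambda>s. norm (v' s))"
    by (intro integral_norm_bound_integral int) auto
  also have "\<dots> \<le> integral {t - \<epsilon>..t} (\<lambda>s. norm (v' s))"
    using assms(3) by (intro integral_subset_le int) auto
  finally show ?thesis .
qed

lemma dq_wnorm_sq_le:
  fixes v :: "real \<Rightarrow> 'a::banach"
  assumes v: "\<forall>t. (v has_vector_derivative v' t) (at t)" and v': "continuous_on UNIV v'"
    and \<epsilon>: "\<epsilon> > 0" and \<rho>: "\<rho> \<ge> 0"
  shows "wnorm_sq \<rho> (dq \<epsilon> v) \<le> wnorm_sq \<rho> v'"
proof -
  let ?K = "\<lambda>t. integral {t - \<epsilon>..t} (\<lambda>s. norm (v' s))"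
  have "continuous_on UNIV v"
    using has_vector_derivative_continuous[OF v[rule_format]]
    by (intro continuous_at_imp_continuous_on) auto
  then have sm: "strongly_measurable (\<lambda>t. v t - v (t - \<epsilon>))"
    using strongly_measurable_shift[OF strongly_measurable_continuous, of v "- \<epsilon>"]
    by (intro strongly_measurable_diff) (simp_all add: strongly_measurable_continuous)
  have "wnorm_sq \<rho> (dq \<epsilon> v) \<le> ennreal ((1/\<epsilon>)\<^sup>2) * wnorm_sq \<rho> (\<lambda>t. v t - v (t - \<epsilon>))"
    by (rule wnorm_sq_cmult_le[OF sm]) (use \<epsilon> in \<open>simp add: dq_def\<close>)
  also have "wnorm_sq \<rho> (\<lambda>t. v t - v (t - \<epsilon>)) \<le> wnorm_sq \<rho> ?K"
    unfolding wnorm_sq_eq_wn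
  proof (rule wn_mono_AE)
    have "norm (v t - v (t - \<epsilon>)) \<le> norm (?K t)" for t
      using increment_le_integral[OF v v', of t \<epsilon> "t - \<epsilon>"] \<epsilon> abs_ge_self[of "?K t"] by simp
    then show "AE t in lborel. norm (v t - v (t - \<epsilon>)) \<le> norm (?K t)"
      by simp
  qed simp
  also have "\<dots> \<le> ennreal (\<epsilon>\<^sup>2) * wnorm_sq \<rho> v'"
    by (rule wnorm_sq_window_le[OF v' \<epsilon> \<rho>])
  also have "ennreal ((1/\<epsilon>)\<^sup>2) * (ennreal (\<epsilon>\<^sup>2) * wnorm_sq \<rho> v') = wnorm_sq \<rho> v'"
    using \<epsilon> by (simp add: mult.assoc[symmetric] ennreal_mult[symmetric] power_divide)
  finally show ?thesis
    by (simp add: mult_left_mono)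
qed

lemma dq_error_wnorm_sq_le:
  fixes v :: "real \<Rightarrow> 'a::banach"
  assumes v: "\<forall>t. (v has_vector_derivative v' t) (at t)"
    and v': "\<forall>t. (v' has_vector_derivative v'' t) (at t)" and v'': "continuous_on UNIV v''"
    and \<epsilon>: "\<epsilon> > 0" and \<rho>: "\<rho> \<ge> 0"
  shows "wnorm_sq \<rho> (\<lambda>t. v' t - dq \<epsilon> v t) \<le> ennreal (\<epsilon>\<^sup>2) * wnorm_sq \<rho> v''"
proof -
  let ?K = "\<lambda>t. integral {t - \<epsilon>..t} (\<lambda>s. norm (v'' s))"
  have "norm (v' t - dq \<epsilon> v t) \<le> ?K t" for t
  proof -
    have "(v' has_integral (v t - v (t - \<epsilon>))) {t - \<epsilon>..t}"
      using v \<epsilon> by (intro fundamental_theorem_of_calculus) (auto intro: has_vector_derivative_at_within)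
    then have int: "((\<lambda>s. v' t - v' s) has_integral ((t - (t - \<epsilon>)) *\<^sub>R v' t - (v t - v (t - \<epsilon>)))) {t - \<epsilon>..t}"
      using \<epsilon> by (intro has_integral_diff has_integral_const_real[THEN has_integral_eq_rhs]) auto
    have nonneg: "0 \<le> ?K t"
      using increment_le_integral[OF v' v'', of t \<epsilon> t] \<epsilon> by simp
    have "norm ((t - (t - \<epsilon>)) *\<^sub>R v' t - (v t - v (t - \<epsilon>))) \<le> ?K t * (t - (t - \<epsilon>))"
      using has_integral_bound_real[OF nonneg _ int, of "{}"] increment_le_integral[OF v' v'', of t \<epsilon>] \<epsilon>
      by auto
    then have "(1/\<epsilon>) * norm (\<epsilon> *\<^sub>R v' t - (v t - v (t - \<epsilon>))) \<le> ?K t"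
      using \<epsilon> by (simp add: field_simps)
    moreover have "v' t - dq \<epsilon> v t = (1/\<epsilon>) *\<^sub>R (\<epsilon> *\<^sub>R v' t - (v t - v (t - \<epsilon>)))"
      using \<epsilon> by (simp add: dq_def algebra_simps)
    ultimately show ?thesis
      using \<epsilon> by simp
  qed
  then have "AE t in lborel. norm (v' t - dq \<epsilon> v t) \<le> norm (?K t)"
    by (intro AE_I2) (simp add: order_trans[OF _ abs_ge_self])
  then have "wnorm_sq \<rho> (\<lambda>t. v' t - dq \<epsilon> v t) \<le> wnorm_sq \<rho> ?K"
    unfolding wnorm_sq_eq_wn by (rule wn_mono_AE) simp
  also have "\<dots> \<le> ennreal (\<epsilon>\<^sup>2) * wnorm_sq \<rho> v''"
    by (rule wnorm_sq_window_le[OF v'' \<epsilon> \<rho>])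
  finally show ?thesis .
qed

lemma dq_wnorm_sq_le_self:
  fixes f :: "real \<Rightarrow> 'a::banach"
  assumes f: "strongly_measurable f" and \<epsilon>: "\<epsilon> > 0" and \<rho>: "\<rho> \<ge> 0"
  shows "wnorm_sq \<rho> (dq \<epsilon> f) \<le> ennreal (4 / \<epsilon>\<^sup>2) * wnorm_sq \<rho> f"
proof -
  have sh: "strongly_measurable (\<lambda>t. f (t - \<epsilon>))"
    using strongly_measurable_shift[OF f, of "- \<epsilon>"] by simp
  have "wnorm_sq \<rho> (\<lambda>t. f (t - \<epsilon>)) = ennreal (exp (2 * \<rho> * - \<epsilon>)) * wnorm_sq \<rho> f"
    using wnorm_sq_shift[OF f, of \<rho> "-\<epsilon>"] by simp
  also have "\<dots> \<le> ennreal 1 * wnorm_sq \<rho> f"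
    using \<epsilon> \<rho> by (intro mult_right_mono ennreal_leI) auto
  finally have le: "wnorm_sq \<rho> (\<lambda>t. f (t - \<epsilon>)) \<le> wnorm_sq \<rho> f"
    by simp
  have "wnorm_sq \<rho> (dq \<epsilon> f) \<le> ennreal ((1/\<epsilon>)\<^sup>2) * wnorm_sq \<rho> (\<lambda>t. f t - f (t - \<epsilon>))"
    by (rule wnorm_sq_cmult_le[OF strongly_measurable_diff[OF f sh]]) (use \<epsilon> in \<open>simp add: dq_def\<close>)
  also have "\<dots> \<le> ennreal ((1/\<epsilon>)\<^sup>2) * (2 * wnorm_sq \<rho> f + 2 * wnorm_sq \<rho> f)"
    by (intro mult_left_mono order_trans[OF wnorm_sq_diff_le[OF f sh]] add_left_mono le) auto
  also have "\<dots> = ennreal ((1/\<epsilon>)\<^sup>2) * (ennreal 4 * wnorm_sq \<rho> f)"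
    by (simp add: distrib_right[symmetric])
  also have "\<dots> = ennreal (4 / \<epsilon>\<^sup>2) * wnorm_sq \<rho> f"
    unfolding mult.assoc[symmetric] using \<epsilon>
    by (subst ennreal_mult[symmetric]) (auto simp: power_divide)
  finally show ?thesis .
qed

lemma Cc_deriv_graph_iff:
  "(\<phi>, \<psi>) \<in> Cc_deriv_graph \<longleftrightarrow>
    smooth \<phi> \<and> (\<forall>t. (\<phi> has_vector_derivative \<psi> t) (at t)) \<and> (\<exists>R. \<forall>t. R < \<bar>t\<bar> \<longrightarrow> \<phi> t = 0)"
proof
  assume "smooth \<phi> \<and> (\<forall>t. (\<phi> has_vector_derivative \<psi> t) (at t)) \<and> (\<exists>R. \<forall>t. R < \<bar>t\<bar> \<longrightarrow> \<phi> t = 0)"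
  moreover from this obtain d where d: "d 0 = \<phi>" "\<forall>k t. (d k has_vector_derivative d (Suc k) t) (at t)"
    unfolding smooth_def by blast
  moreover from calculation have "d 1 = \<psi>"
    using vector_derivative_unique_at[of \<phi> "d 1 t" t "\<psi> t" for t] by (metis One_nat_def ext)
  ultimately show "(\<phi>, \<psi>) \<in> Cc_deriv_graph"
    unfolding Cc_deriv_graph_def by blast
next
  assume "(\<phi>, \<psi>) \<in> Cc_deriv_graph"
  then obtain d where "d 0 = \<phi>" "d 1 = \<psi>" "\<forall>k t. (d k has_vector_derivative d (Suc k) t) (at t)"
      "\<exists>R. \<forall>t. R < \<bar>t\<bar> \<longrightarrow> \<phi> t = 0"
    unfolding Cc_deriv_graph_def by blast
  then show "smooth \<phi> \<and> (\<forall>t. (\<phi> has_vector_derivative \<psi> t) (at t)) \<and> (\<exists>R. \<forall>t. R < \<bar>t\<bar> \<longrightarrow> \<phi> t = 0)"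
    unfolding smooth_def by (metis One_nat_def)
qed

lemma smooth_compact_Hrho:
  fixes f :: "real \<Rightarrow> 'a::banach"
  assumes "smooth f" "\<forall>t. R < \<bar>t\<bar> \<longrightarrow> f t = 0"
  shows "f \<in> Hrho \<rho>"
  by (rule Hrho_continuous_compact[OF smooth_continuous[OF assms(1)] assms(2)])

lemma Cc_deriv_graph_derivE:
  fixes \<phi> :: "real \<Rightarrow> 'a::banach"
  assumes "(\<phi>, \<psi>) \<in> Cc_deriv_graph"
  obtains \<theta> where "smooth \<psi>" "\<forall>t. (\<psi> has_vector_derivative \<theta> t) (at t)" "smooth \<theta>"
    "\<phi> \<in> Hrho \<rho>" "\<psi> \<in> Hrho \<rho>" "\<theta> \<in> Hrho \<rho>"
proof -
  obtain R where \<phi>: "smooth \<phi>" "\<forall>t. (\<phi> has_vector_derivative \<psi> t) (at t)" "\<forall>t. R < \<bar>t\<bar> \<longrightarrow> \<phi> t = 0"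
    using assms unfolding Cc_deriv_graph_iff by blast
  obtain \<psi>' where \<psi>': "smooth \<psi>'" "\<forall>t. (\<phi> has_vector_derivative \<psi>' t) (at t)"
    by (rule smooth_derivE[OF \<phi>(1)])
  have "\<psi>' = \<psi>"
    by (rule ext) (rule vector_derivative_unique_at[OF \<psi>'(2)[rule_format] \<phi>(2)[rule_format]])
  then have \<psi>: "smooth \<psi>" "\<forall>t. R < \<bar>t\<bar> \<longrightarrow> \<psi> t = 0"
    using \<psi>' deriv_zero_outside[OF \<phi>(2,3)] by auto
  obtain \<theta> where \<theta>: "smooth \<theta>" "\<forall>t. (\<psi> has_vector_derivative \<theta> t) (at t)"
    by (rule smooth_derivE[OF \<psi>(1)])
  have \<theta>0: "\<forall>t. R < \<bar>t\<bar> \<longrightarrow> \<theta> t = 0"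
    using deriv_zero_outside[OF \<theta>(2) \<psi>(2)] by blast
  show ?thesis
    by (rule that[OF \<psi>(1) \<theta>(2,1)]) (intro smooth_compact_Hrho \<phi> \<psi> \<theta> \<theta>0; fact)+
qed

lemma d0_graph_dq:
  fixes f :: "real \<Rightarrow> 'a::banach"
  assumes fg: "(f, g) \<in> d0_graph \<rho>" and \<rho>: "\<rho> \<ge> 0" and \<eta>: "\<eta> > 0"
  shows "\<exists>\<epsilon>>0. wnorm_sq \<rho> (\<lambda>t. g t - dq \<epsilon> f t) \<le> ennreal \<eta>"
proof -
  define \<delta> where "\<delta> = \<eta> / 46"
  have \<delta>: "\<delta> > 0"
    using \<eta> by (simp add: \<delta>_def)
  obtain fn gn where H: "f \<in> Hrho \<rho>" "g \<in> Hrho \<rho>"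
      "\<forall>n. (fn n, gn n) \<in> Cc_deriv_graph" "\<forall>n. fn n \<in> Hrho \<rho>" "\<forall>n. gn n \<in> Hrho \<rho>"
      "(\<lambda>n. wnorm_sq \<rho> (\<lambda>t. fn n t - f t)) \<longlonglongrightarrow> 0" "(\<lambda>n. wnorm_sq \<rho> (\<lambda>t. gn n t - g t)) \<longlonglongrightarrow> 0"
    by (rule gclosureE[OF fg[unfolded d0_graph_def]])
  have sm: "strongly_measurable f" "strongly_measurable g" "strongly_measurable (fn n)" "strongly_measurable (gn n)" for n
    using H by (auto simp: Hrho_def)
  have "eventually (\<lambda>n. wnorm_sq \<rho> (\<lambda>t. gn n t - g t) < ennreal \<delta>) sequentially"
    using \<delta> by (intro order_tendstoD(2)[OF H(7)]) simp
  then obtain n where n: "\<And>m. m \<ge> n \<Longrightarrow> wnorm_sq \<rho> (\<lambda>t. gn m t - g t) < ennreal \<delta>"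
    by (auto simp: eventually_sequentially)
  obtain \<theta> where \<theta>: "smooth (gn n)" "\<forall>t. (gn n has_vector_derivative \<theta> t) (at t)" "smooth \<theta>"
      "fn n \<in> Hrho \<rho>" "gn n \<in> Hrho \<rho>" "\<theta> \<in> Hrho \<rho>"
    by (rule Cc_deriv_graph_derivE[OF H(3)[rule_format]])
  have deriv: "\<forall>t. (fn m has_vector_derivative gn m t) (at t)" for m
    using H(3) Cc_deriv_graph_iff by blast
  define X where "X = enn2real (wnorm_sq \<rho> \<theta>)"
  have X: "wnorm_sq \<rho> \<theta> = ennreal X" "X \<ge> 0"
    using \<theta>(6) by (auto simp: X_def Hrho_def)
  define \<epsilon> where "\<epsilon> = min 1 (\<delta> / (X + 1))"
  have \<epsilon>: "\<epsilon> > 0" "\<epsilon>\<^sup>2 * X \<le> \<delta>"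
  proof -
    show "\<epsilon> > 0"
      using X \<delta> by (simp add: \<epsilon>_def)
    have "\<epsilon>\<^sup>2 \<le> \<epsilon>"
      using \<open>\<epsilon> > 0\<close> by (intro power_decreasing[of 1 2 \<epsilon>, simplified]) (auto simp: \<epsilon>_def)
    then have "\<epsilon>\<^sup>2 * X \<le> \<epsilon> * X"
      using X by (intro mult_right_mono) auto
    also have "\<dots> \<le> (\<delta> / (X + 1)) * (X + 1)"
      using X \<delta> by (intro mult_mono) (auto simp: \<epsilon>_def)
    finally show "\<epsilon>\<^sup>2 * X \<le> \<delta>"
      using X by simp
  qed
  have "eventually (\<lambda>m. wnorm_sq \<rho> (\<lambda>t. fn m t - f t) < ennreal (\<delta> * \<epsilon>\<^sup>2 / 4)) sequentially"
    using \<delta> \<epsilon> by (intro order_tendstoD(2)[OF H(6)]) simp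
  then obtain m where m: "m \<ge> n" "wnorm_sq \<rho> (\<lambda>t. fn m t - f t) < ennreal (\<delta> * \<epsilon>\<^sup>2 / 4)"
    unfolding eventually_sequentially by (metis max.cobounded1 max.cobounded2)
  have b1: "wnorm_sq \<rho> (\<lambda>t. g t - gn n t) \<le> ennreal \<delta>"
    using n[of n] by (simp add: wnorm_sq_diff_commute[of _ g])
  have "wnorm_sq \<rho> (\<lambda>t. gn n t - dq \<epsilon> (fn n) t) \<le> ennreal (\<epsilon>\<^sup>2) * wnorm_sq \<rho> \<theta>"
    by (rule dq_error_wnorm_sq_le[OF deriv \<theta>(2) smooth_continuous[OF \<theta>(3)] \<epsilon>(1) \<rho>])
  also have "\<dots> \<le> ennreal \<delta>"
    using X \<epsilon> by (simp add: ennreal_mult[symmetric] ennreal_leI)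
  finally have b2: "wnorm_sq \<rho> (\<lambda>t. gn n t - dq \<epsilon> (fn n) t) \<le> ennreal \<delta>" .
  have "\<forall>t. ((\<lambda>t. fn n t - fn m t) has_vector_derivative (gn n t - gn m t)) (at t)"
    using deriv by (auto intro: has_vector_derivative_diff)
  moreover have "continuous_on UNIV (gn m)"
    by (rule Cc_deriv_graph_derivE[OF H(3)[rule_format, of m]]) (rule smooth_continuous)
  then have "continuous_on UNIV (\<lambda>t. gn n t - gn m t)"
    using smooth_continuous[OF \<theta>(1)] by (intro continuous_on_diff)
  ultimately have "wnorm_sq \<rho> (dq \<epsilon> (\<lambda>t. fn n t - fn m t)) \<le> wnorm_sq \<rho> (\<lambda>t. gn n t - gn m t)"
    by (rule dq_wnorm_sq_le[OF _ _ \<epsilon>(1) \<rho>])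
  also have "\<dots> \<le> 2 * wnorm_sq \<rho> (\<lambda>t. gn n t - g t) + 2 * wnorm_sq \<rho> (\<lambda>t. g t - gn m t)"
    by (intro wnorm_sq_dist_triangle sm)
  also have "\<dots> \<le> 2 * ennreal \<delta> + 2 * ennreal \<delta>"
    using n[of n] n[OF m(1)] unfolding wnorm_sq_diff_commute[of _ g]
    by (intro add_mono mult_left_mono) auto
  finally have b3: "wnorm_sq \<rho> (\<lambda>t. dq \<epsilon> (fn n) t - dq \<epsilon> (fn m) t) \<le> 2 * ennreal \<delta> + 2 * ennreal \<delta>"
    by (simp add: dq_diff)
  have "wnorm_sq \<rho> (dq \<epsilon> (\<lambda>t. fn m t - f t)) \<le> ennreal (4 / \<epsilon>\<^sup>2) * wnorm_sq \<rho> (\<lambda>t. fn m t - f t)"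
    by (intro dq_wnorm_sq_le_self strongly_measurable_diff sm \<epsilon> \<rho>)
  also have "\<dots> \<le> ennreal (4 / \<epsilon>\<^sup>2) * ennreal (\<delta> * \<epsilon>\<^sup>2 / 4)"
    using m(2) by (intro mult_left_mono) auto
  also have "\<dots> = ennreal \<delta>"
    using \<epsilon> \<delta> by (simp add: ennreal_mult[symmetric])
  finally have b4: "wnorm_sq \<rho> (\<lambda>t. dq \<epsilon> (fn m) t - dq \<epsilon> f t) \<le> ennreal \<delta>"
    by (simp add: dq_diff)
  note smd = dq_strongly_measurable[OF sm(1)] dq_strongly_measurable[OF sm(3)]
  have "wnorm_sq \<rho> (\<lambda>t. dq \<epsilon> (fn n) t - dq \<epsilon> f t) \<le>
      2 * wnorm_sq \<rho> (\<lambda>t. dq \<epsilon> (fn n) t - dq \<epsilon> (fn m) t) + 2 * wnorm_sq \<rho> (\<lambda>t. dq \<epsilon> (fn m) t - dq \<epsilon> f t)"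
    by (intro wnorm_sq_dist_triangle smd)
  also have "\<dots> \<le> 2 * (2 * ennreal \<delta> + 2 * ennreal \<delta>) + 2 * ennreal \<delta>"
    by (intro add_mono mult_left_mono b3 b4) auto
  finally have b5: "wnorm_sq \<rho> (\<lambda>t. dq \<epsilon> (fn n) t - dq \<epsilon> f t) \<le> 2 * (2 * ennreal \<delta> + 2 * ennreal \<delta>) + 2 * ennreal \<delta>" .
  have "wnorm_sq \<rho> (\<lambda>t. gn n t - dq \<epsilon> f t) \<le>
      2 * wnorm_sq \<rho> (\<lambda>t. gn n t - dq \<epsilon> (fn n) t) + 2 * wnorm_sq \<rho> (\<lambda>t. dq \<epsilon> (fn n) t - dq \<epsilon> f t)"
    by (intro wnorm_sq_dist_triangle smd sm)
  also have "\<dots> \<le> 2 * ennreal \<delta> + 2 * (2 * (2 * ennreal \<delta> + 2 * ennreal \<delta>) + 2 * ennreal \<delta>)"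
    by (intro add_mono mult_left_mono b2 b5) auto
  finally have b6: "wnorm_sq \<rho> (\<lambda>t. gn n t - dq \<epsilon> f t) \<le>
      2 * ennreal \<delta> + 2 * (2 * (2 * ennreal \<delta> + 2 * ennreal \<delta>) + 2 * ennreal \<delta>)" .
  have "wnorm_sq \<rho> (\<lambda>t. g t - dq \<epsilon> f t) \<le>
      2 * wnorm_sq \<rho> (\<lambda>t. g t - gn n t) + 2 * wnorm_sq \<rho> (\<lambda>t. gn n t - dq \<epsilon> f t)"
    by (intro wnorm_sq_dist_triangle smd sm)
  also have "\<dots> \<le> 2 * ennreal \<delta> + 2 * (2 * ennreal \<delta> + 2 * (2 * (2 * ennreal \<delta> + 2 * ennreal \<delta>) + 2 * ennreal \<delta>))"
    by (intro add_mono mult_left_mono b1 b6) auto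
  also have "\<dots> = 46 * ennreal \<delta>"
    by (simp add: distrib_left mult.assoc[symmetric]) (simp add: distrib_right[symmetric])
  also have "\<dots> = ennreal (46 * \<delta>)"
    using \<delta> by (simp add: ennreal_mult)
  also have "\<dots> = ennreal \<eta>"
    by (simp add: \<delta>_def)
  finally show ?thesis
    using \<epsilon>(1) by blast
qed

lemma smooth_d0_graph:
  fixes v :: "real \<Rightarrow> 'a::banach"
  assumes v: "smooth v" "\<forall>t. (v has_vector_derivative v' t) (at t)" and H: "v \<in> Hrho \<rho>" "v' \<in> Hrho \<rho>"
  shows "(v, v') \<in> d0_graph \<rho>"
proof -
  define b where "b = bump (-1) 1"
  have b0: "b 0 > 0"
    by (simp add: b_def bump_pos)
  have b: "smooth b" "\<And>t. 1 < \<bar>t\<bar> \<Longrightarrow> b t = 0" "\<And>t. \<bar>b t\<bar> \<le> 1"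
    by (auto simp: b_def smooth_bump bump_bounds intro!: bump_outside)
  obtain b' where b': "smooth b'" "\<forall>t. (b has_vector_derivative b' t) (at t)"
    by (rule smooth_derivE[OF b(1)])
  have b'0: "b' t = 0" if "1 < \<bar>t\<bar>" for t
    using deriv_zero_outside[OF b'(2) _ that] b(2) by blast
  obtain C where C: "C > 0" "\<And>t. \<bar>b' t\<bar> \<le> C"
  proof -
    have "bounded (b' ` {-1..1})"
      using continuous_on_subset[OF smooth_continuous[OF b'(1)]]
      by (intro compact_imp_bounded compact_continuous_image) auto
    then obtain C where C: "C > 0" "\<forall>x\<in>b' ` {-1..1}. norm x \<le> C"
      unfolding bounded_pos by blast
    have "\<bar>b' t\<bar> \<le> C" for t
    proof (cases "1 < \<bar>t\<bar>")
      case False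
      then have "t \<in> {-1..1}"
        by auto
      then show ?thesis
        using C(2) by (metis imageI real_norm_def)
    qed (use b'0 C in auto)
    then show ?thesis
      using C(1) that by blast
  qed
  define c where "c = (\<lambda>n t. b (0 + inverse (real (Suc n)) * t) / b 0)"
  define c' where "c' = (\<lambda>n t. inverse (real (Suc n)) * b' (0 + inverse (real (Suc n)) * t) / b 0)"
  have c_smooth: "smooth (c n)" for n
    unfolding c_def
    using smooth_bounded_linear[OF bounded_linear_mult_left[of "inverse (b 0)"]
        smooth_compose_affine[OF b(1), of 0 "inverse (real (Suc n))"]]
    by (simp add: divide_inverse)
  have c_deriv: "(c n has_real_derivative c' n t) (at t)" for n t
  proof -
    have "(b has_real_derivative b' s) (at s)" for s
      using b'(2) by (simp add: has_real_derivative_iff_has_vector_derivative)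
    from DERIV_chain'[OF _ this, of "\<lambda>t. 0 + inverse (real (Suc n)) * t" "inverse (real (Suc n))" t UNIV]
    have "((\<lambda>t. b (0 + inverse (real (Suc n)) * t)) has_real_derivative
        b' (0 + inverse (real (Suc n)) * t) * inverse (real (Suc n))) (at t)"
      by (auto intro!: derivative_eq_intros)
    from DERIV_cdivide[OF this, of "b 0"] show ?thesis
      unfolding c_def c'_def by (simp add: mult.commute)
  qed
  have c_le: "\<bar>c n t\<bar> \<le> 1 / b 0" for n t
    using b(3) b0 by (simp add: c_def divide_right_mono)
  have c'_le: "\<bar>c' n t\<bar> \<le> inverse (real (Suc n)) * (C / b 0)" for n t
    unfolding c'_def using C(2)[of "0 + inverse (real (Suc n)) * t"] b0
    by (simp add: abs_mult divide_simps)
  have c_lim: "(\<lambda>n. c n t) \<longlonglongrightarrow> 1" for t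
  proof -
    have "(\<lambda>n. 0 + inverse (real (Suc n)) * t) \<longlonglongrightarrow> 0 + 0 * t"
      by (intro tendsto_intros LIMSEQ_inverse_real_of_nat)
    then have "(\<lambda>n. b (0 + inverse (real (Suc n)) * t)) \<longlonglongrightarrow> b (0 + 0 * t)"
      using smooth_continuous[OF b(1)] by (intro isCont_tendsto_compose[of _ b])
        (auto simp: continuous_on_eq_continuous_at)
    then have "(\<lambda>n. b (0 + inverse (real (Suc n)) * t) / b 0) \<longlonglongrightarrow> b (0 + 0 * t) / b 0"
      using b0 by (intro tendsto_divide tendsto_const) auto
    then show ?thesis
      using b0 by (simp add: c_def)
  qed
  define p where "p = (\<lambda>n t. c n t *\<^sub>R v t)"
  define q where "q = (\<lambda>n t. c n t *\<^sub>R v' t + c' n t *\<^sub>R v t)"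
  have "(p n, q n) \<in> Cc_deriv_graph" for n
    unfolding Cc_deriv_graph_iff p_def q_def
  proof (intro conjI allI)
    show "smooth (\<lambda>t. c n t *\<^sub>R v t)"
      by (intro smooth_scaleR c_smooth v)
    show "((\<lambda>t. c n t *\<^sub>R v t) has_vector_derivative c n t *\<^sub>R v' t + c' n t *\<^sub>R v t) (at t)" for t
      by (rule has_vector_derivative_scaleR[OF c_deriv v(2)[rule_format]])
    have "b (0 + inverse (real (Suc n)) * t) = 0" if "real (Suc n) < \<bar>t\<bar>" for t
      using that by (intro b(2)) (simp add: abs_mult divide_simps)
    then show "\<exists>R. \<forall>t. R < \<bar>t\<bar> \<longrightarrow> c n t *\<^sub>R v t = 0"
      by (intro exI[of _ "real (Suc n)"]) (simp add: c_def)
  qed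
  note graph = this
  note Hpq = Cc_deriv_graph_derivE[OF graph]
  have pH: "p n \<in> Hrho \<rho>" and qH: "q n \<in> Hrho \<rho>" for n
    by (rule Hpq, assumption)+
  have smv: "strongly_measurable v" "strongly_measurable v'"
    using H by (auto simp: Hrho_def)
  define D where "D = 1 / b 0 + 1"
  have D: "D > 0"
    using b0 by (auto simp: D_def intro!: add_nonneg_pos)
  have cD: "\<bar>c n t - 1\<bar> \<le> D" for n t
    using c_le[of n t] by (simp add: D_def)
  show ?thesis
    unfolding d0_graph_def
  proof (rule gclosureI[OF H graph pH qH])
    show "(\<lambda>n. wnorm_sq \<rho> (\<lambda>t. p n t - v t)) \<longlonglongrightarrow> 0"
    proof (rule wnorm_sq_dominated[where b="\<lambda>t. D *\<^sub>R v t"])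
      show "strongly_measurable (\<lambda>t. p n t - v t)" for n
        using pH smv by (intro strongly_measurable_diff) (auto simp: Hrho_def)
      have "(\<lambda>n. c n t *\<^sub>R v t - v t) \<longlonglongrightarrow> 1 *\<^sub>R v t - v t" for t
        by (intro tendsto_intros c_lim)
      then show "AE t in lborel. (\<lambda>n. p n t - v t) \<longlonglongrightarrow> 0"
        by (simp add: p_def)
      show "strongly_measurable (\<lambda>t. D *\<^sub>R v t)" "wnorm_sq \<rho> (\<lambda>t. D *\<^sub>R v t) < \<infinity>"
        using Hrho_scaleR[OF H(1), of D] by (auto simp: Hrho_def)
      have "norm (p n t - v t) \<le> norm (D *\<^sub>R v t)" for n t
      proof -
        have "p n t - v t = (c n t - 1) *\<^sub>R v t"
          by (simp add: p_def algebra_simps)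
        then show ?thesis
          using cD[of n t] D by (simp add: mult_right_mono)
      qed
      then show "AE t in lborel. norm (p n t - v t) \<le> norm (D *\<^sub>R v t)" for n
        by simp
    qed
    show "(\<lambda>n. wnorm_sq \<rho> (\<lambda>t. q n t - v' t)) \<longlonglongrightarrow> 0"
    proof (rule wnorm_sq_dominated[where b="\<lambda>t. D * norm (v' t) + (C / b 0) * norm (v t)"])
      show "strongly_measurable (\<lambda>t. q n t - v' t)" for n
        using qH smv by (intro strongly_measurable_diff) (auto simp: Hrho_def)
      have c'_lim: "(\<lambda>n. c' n t) \<longlonglongrightarrow> 0" for t
      proof (rule Lim_null_comparison[OF always_eventually])
        show "\<forall>n. norm (c' n t) \<le> inverse (real (Suc n)) * (C / b 0)"
          using c'_le by simp
        show "(\<lambda>n. inverse (real (Suc n)) * (C / b 0)) \<longlonglongrightarrow> 0"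
          using tendsto_mult_left_zero[OF LIMSEQ_inverse_real_of_nat] .
      qed
      have "(\<lambda>n. c n t *\<^sub>R v' t + c' n t *\<^sub>R v t - v' t) \<longlonglongrightarrow> 1 *\<^sub>R v' t + 0 *\<^sub>R v t - v' t" for t
        by (intro tendsto_intros c_lim c'_lim)
      then show "AE t in lborel. (\<lambda>n. q n t - v' t) \<longlonglongrightarrow> 0"
        by (simp add: q_def)
      have nH: "(\<lambda>t. norm (g t)) \<in> Hrho \<rho>" if "g \<in> Hrho \<rho>" for g :: "real \<Rightarrow> 'a"
        using that strongly_measurable_comp_continuous[of g norm]
        by (auto simp: Hrho_def wnorm_sq_def intro: continuous_intros)
      have "(\<lambda>t. D *\<^sub>R norm (v' t) + (C / b 0) *\<^sub>R norm (v t)) \<in> Hrho \<rho>"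
        by (intro Hrho_add Hrho_scaleR nH H)
      then show "strongly_measurable (\<lambda>t. D * norm (v' t) + (C / b 0) * norm (v t))"
          "wnorm_sq \<rho> (\<lambda>t. D * norm (v' t) + (C / b 0) * norm (v t)) < \<infinity>"
        by (auto simp: Hrho_def)
      have "norm (q n t - v' t) \<le> norm (D * norm (v' t) + (C / b 0) * norm (v t))" for n t
      proof -
        have "q n t - v' t = (c n t - 1) *\<^sub>R v' t + c' n t *\<^sub>R v t"
          by (simp add: q_def algebra_simps)
        then have "norm (q n t - v' t) \<le> \<bar>c n t - 1\<bar> * norm (v' t) + \<bar>c' n t\<bar> * norm (v t)"
          using norm_triangle_ineq[of "(c n t - 1) *\<^sub>R v' t" "c' n t *\<^sub>R v t"] by simp
        also have "\<dots> \<le> D * norm (v' t) + (C / b 0) * norm (v t)"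
        proof (intro add_mono mult_right_mono cD)
          have "\<bar>c' n t\<bar> \<le> inverse (real (Suc n)) * (C / b 0)"
            by (rule c'_le)
          also have "\<dots> \<le> 1 * (C / b 0)"
            using C b0 by (intro mult_right_mono) (auto simp: divide_simps)
          finally show "\<bar>c' n t\<bar> \<le> C / b 0"
            by simp
        qed auto
        finally show ?thesis
          by simp
      qed
      then show "AE t in lborel. norm (q n t - v' t) \<le> norm (D * norm (v' t) + (C / b 0) * norm (v t))" for n
        by simp
    qed
  qed
qed

lemma d0_graph_add:
  fixes u v :: "real \<Rightarrow> 'a::banach"
  assumes "(u, f) \<in> d0_graph \<rho>" "(v, g) \<in> d0_graph \<rho>"
  shows "((\<lambda>t. u t + v t), (\<lambda>t. f t + g t)) \<in> d0_graph \<rho>"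
  unfolding d0_graph_def
proof (rule gclosure_add[OF _ assms[unfolded d0_graph_def]])
  fix u f v g :: "real \<Rightarrow> 'a"
  assume *: "(u, f) \<in> Cc_deriv_graph" "(v, g) \<in> Cc_deriv_graph"
  then obtain R S where "\<forall>t. R < \<bar>t\<bar> \<longrightarrow> u t = 0" "\<forall>t. S < \<bar>t\<bar> \<longrightarrow> v t = 0"
    unfolding Cc_deriv_graph_iff by blast
  then have "\<exists>R. \<forall>t. R < \<bar>t\<bar> \<longrightarrow> u t + v t = 0"
    by (intro exI[of _ "max R S"]) auto
  with * show "((\<lambda>t. u t + v t), (\<lambda>t. f t + g t)) \<in> Cc_deriv_graph"
    unfolding Cc_deriv_graph_iff by (auto intro: smooth_add has_vector_derivative_add)
qed

lemma d0_graph_bounded_linear: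
  fixes u :: "real \<Rightarrow> 'a::banach" and L :: "'a \<Rightarrow> 'a"
  assumes L: "bounded_linear L" and "(u, f) \<in> d0_graph \<rho>"
  shows "((\<lambda>t. L (u t)), (\<lambda>t. L (f t))) \<in> d0_graph \<rho>"
  unfolding d0_graph_def
proof (rule gclosure_bounded_linear[OF L _ assms(2)[unfolded d0_graph_def]])
  fix u f :: "real \<Rightarrow> 'a"
  assume *: "(u, f) \<in> Cc_deriv_graph"
  then obtain R where "\<forall>t. R < \<bar>t\<bar> \<longrightarrow> u t = 0"
    unfolding Cc_deriv_graph_iff by blast
  then have "\<exists>R. \<forall>t. R < \<bar>t\<bar> \<longrightarrow> L (u t) = 0"
    using linear_0[OF bounded_linear.linear[OF L]] by (intro exI[of _ R]) auto
  with * show "((\<lambda>t. L (u t)), (\<lambda>t. L (f t))) \<in> Cc_deriv_graph"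
    unfolding Cc_deriv_graph_iff
    by (auto intro: smooth_bounded_linear[OF L] bounded_linear.has_vector_derivative[OF L])
qed

section \<open>Maximal monotone linear operators\<close>

lemma subspace_closure:
  fixes S :: "'a::real_normed_vector set"
  assumes "subspace S"
  shows "subspace (closure S)"
proof (rule subspaceI)
  show "0 \<in> closure S"
    using subspace_0[OF assms] closure_subset by blast
  show "x + y \<in> closure S" if xy: "x \<in> closure S" "y \<in> closure S" for x y
  proof -
    obtain a b where "\<forall>n. a n \<in> S" "a \<longlonglongrightarrow> x" "\<forall>n. b n \<in> S" "b \<longlonglongrightarrow> y"
      using xy unfolding closure_sequential by blast
    then show ?thesis
      unfolding closure_sequential
      by (intro exI[of _ "\<lambda>n. a n + b n"]) (auto intro: subspace_add[OF assms] tendsto_add)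
  qed
  show "c *\<^sub>R x \<in> closure S" if x: "x \<in> closure S" for x c
  proof -
    obtain a where "\<forall>n. a n \<in> S" "a \<longlonglongrightarrow> x"
      using x unfolding closure_sequential by blast
    then show ?thesis
      unfolding closure_sequential
      by (intro exI[of _ "\<lambda>n. c *\<^sub>R a n"]) (auto intro: subspace_scale[OF assms] tendsto_scaleR)
  qed
qed

text \<open>Only the real inner product \<open>Re (ip x y)\<close> matters for monotonicity.\<close>

locale real_ip =
  fixes r :: "'a::banach \<Rightarrow> 'a \<Rightarrow> real"
  assumes r_add: "r (x + y) z = r x z + r y z"
    and r_scale: "r (a *\<^sub>R x) y = a * r x y"
    and r_sym: "r x y = r y x"
    and r_norm: "r x x = (norm x)\<^sup>2"
begin

lemma r_add_right: "r x (y + z) = r x y + r x z"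
  by (metis r_add r_sym)

lemma r_scale_right: "r x (a *\<^sub>R y) = a * r x y"
  by (metis r_scale r_sym)

lemma r_minus: "r (- x) y = - r x y" "r x (- y) = - r x y"
  using r_scale[of "-1" x y] r_scale_right[of x "-1" y] by simp_all

lemma r_diff: "r (x - y) z = r x z - r y z" "r x (y - z) = r x y - r x z"
  using r_add[of x "- y" z] r_add_right[of x y "- z"] by (simp_all add: r_minus)

lemma r_zero: "r 0 x = 0" "r x 0 = 0"
  using r_scale[of 0 x x] r_scale_right[of x 0 x] by simp_all

lemmas r_simps = r_add r_add_right r_scale r_scale_right r_minus r_diff r_zero

lemma norm_sq_add: "(norm (x + y))\<^sup>2 = (norm x)\<^sup>2 + 2 * r x y + (norm y)\<^sup>2"
  unfolding r_norm[symmetric] by (simp add: r_simps r_sym[of y x])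

lemma norm_sq_diff: "(norm (x - y))\<^sup>2 = (norm x)\<^sup>2 - 2 * r x y + (norm y)\<^sup>2"
  using norm_sq_add[of x "- y"] by (simp add: r_simps)

lemma r_Cauchy_Schwarz: "r x y \<le> norm x * norm y"
proof (cases "norm x = 0 \<or> norm y = 0")
  case True
  then show ?thesis
    by (auto simp: r_zero)
next
  case False
  have "0 \<le> (norm (norm y *\<^sub>R x - norm x *\<^sub>R y))\<^sup>2"
    by simp
  also have "\<dots> = 2 * (norm x * norm y) * (norm x * norm y - r x y)"
    unfolding norm_sq_diff by (simp add: r_simps power2_eq_square algebra_simps)
  finally have "0 \<le> 2 * (norm x * norm y) * (norm x * norm y - r x y)" .
  moreover have "0 < 2 * (norm x * norm y)"
    using False by simp
  ultimately show ?thesis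
    by (simp only: zero_le_mult_iff) linarith
qed

lemma tendsto_r:
  assumes "(f \<longlongrightarrow> x) F" "(g \<longlongrightarrow> y) F"
  shows "((\<lambda>n. r (f n) (g n)) \<longlongrightarrow> r x y) F"
proof -
  have "((\<lambda>n. ((norm (f n + g n))\<^sup>2 - (norm (f n))\<^sup>2 - (norm (g n))\<^sup>2) / 2) \<longlongrightarrow>
      ((norm (x + y))\<^sup>2 - (norm x)\<^sup>2 - (norm y)\<^sup>2) / 2) F"
    using assms by (intro tendsto_intros) auto
  then show ?thesis
    by (simp add: norm_sq_add)
qed

lemma orthogonal_vector:
  assumes S: "subspace S" "closed S" and z: "z \<notin> S"
  obtains y where "y \<noteq> 0" "\<forall>x\<in>S. r x y = 0"
proof -
  have S0: "0 \<in> S"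
    using S(1) by (rule subspace_0)
  define d where "d = infdist z S"
  have d_le: "d \<le> norm (z - x)" if "x \<in> S" for x
    using infdist_le[OF that, of z] by (simp add: d_def dist_norm)
  have "\<exists>x\<in>S. norm (z - x) < d + inverse (real (Suc n))" for n
  proof (rule ccontr)
    assume "\<not> ?thesis"
    then have "d + inverse (real (Suc n)) \<le> (INF x\<in>S. dist z x)"
      using S0 by (intro cINF_greatest) (auto simp: dist_norm not_less)
    also have "\<dots> = d"
      unfolding d_def using S0 by (intro infdist_notempty[symmetric]) auto
    finally show False
      by simp
  qed
  then have "\<forall>n. \<exists>x. x \<in> S \<and> norm (z - x) < d + inverse (real (Suc n))"
    by blast
  from choice[OF this] obtain x where x: "\<And>n. x n \<in> S" "\<And>n. norm (z - x n) < d + inverse (real (Suc n))"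
    by auto
  have d0: "d \<ge> 0"
    by (simp add: d_def infdist_nonneg)
  have par: "(norm (x m - x n))\<^sup>2 \<le> 2 * (norm (z - x m))\<^sup>2 + 2 * (norm (z - x n))\<^sup>2 - 4 * d\<^sup>2" for m n
  proof -
    have "(1/2) *\<^sub>R (x m + x n) \<in> S"
      using S(1) x by (intro subspace_scale subspace_add)
    then have "d \<le> norm (z - (1/2) *\<^sub>R (x m + x n))"
      by (rule d_le)
    then have "4 * d\<^sup>2 \<le> 4 * (norm (z - (1/2) *\<^sub>R (x m + x n)))\<^sup>2"
      using d0 by (intro mult_left_mono power_mono) auto
    also have "\<dots> = (norm ((z - x m) + (z - x n)))\<^sup>2"
    proof -
      have "(z - x m) + (z - x n) = 2 *\<^sub>R (z - (1/2) *\<^sub>R (x m + x n))"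
        by (simp add: algebra_simps scaleR_2)
      then show ?thesis
        by (simp add: power_mult_distrib)
    qed
    finally have "4 * d\<^sup>2 \<le> (norm ((z - x m) + (z - x n)))\<^sup>2" .
    moreover have "x m - x n = (z - x n) - (z - x m)"
      by simp
    ultimately show ?thesis
      unfolding \<open>x m - x n = _\<close> by (simp only: norm_sq_add norm_sq_diff r_sym[of "z - x n"]) argo
  qed
  have "Cauchy x"
  proof (rule metric_CauchyI)
    fix e :: real assume e: "e > 0"
    have "(\<lambda>n. (d + inverse (real (Suc n)))\<^sup>2) \<longlonglongrightarrow> (d + 0)\<^sup>2"
      by (intro tendsto_intros LIMSEQ_inverse_real_of_nat)
    then have "eventually (\<lambda>n. (d + inverse (real (Suc n)))\<^sup>2 < d\<^sup>2 + e\<^sup>2 / 4) sequentially"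
      using e by (intro order_tendstoD(2)) auto
    then obtain N where N: "\<And>n. n \<ge> N \<Longrightarrow> (d + inverse (real (Suc n)))\<^sup>2 < d\<^sup>2 + e\<^sup>2 / 4"
      by (auto simp: eventually_sequentially)
    have zx: "(norm (z - x n))\<^sup>2 < d\<^sup>2 + e\<^sup>2 / 4" if "n \<ge> N" for n
      using power_mono[OF less_imp_le[OF x(2)[of n]], of 2] N[OF that] by simp
    have "(norm (x m - x n))\<^sup>2 < e\<^sup>2" if "m \<ge> N" "n \<ge> N" for m n
      using par[of m n] zx[OF that(1)] zx[OF that(2)] by linarith
    then have "dist (x m) (x n) < e" if "m \<ge> N" "n \<ge> N" for m n
      using that e by (auto simp: dist_norm intro: power_less_imp_less_base[of _ 2])
    then show "\<exists>M. \<forall>m\<ge>M. \<forall>n\<ge>M. dist (x m) (x n) < e"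
      by blast
  qed
  then obtain p where p: "x \<longlonglongrightarrow> p"
    using Cauchy_convergent_iff convergent_def by blast
  have pS: "p \<in> S"
    by (rule closed_sequentially[OF S(2) x(1) p])
  have "(\<lambda>n. norm (z - x n)) \<longlonglongrightarrow> norm (z - p)"
    by (intro tendsto_intros p)
  moreover have "(\<lambda>n. d + inverse (real (Suc n))) \<longlonglongrightarrow> d + 0"
    by (intro tendsto_intros LIMSEQ_inverse_real_of_nat)
  ultimately have "norm (z - p) \<le> d + 0"
    by (rule LIMSEQ_le) (use x(2) less_imp_le in blast)
  have "r s (z - p) = 0" if s: "s \<in> S" for s
  proof (rule ccontr)
    assume nz: "r s (z - p) \<noteq> 0"
    define a where "a = r s (z - p) / (norm s)\<^sup>2"
    have "s \<noteq> 0"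
      using nz by (auto simp: r_zero)
    have "p + a *\<^sub>R s \<in> S"
      using S(1) pS s by (intro subspace_add subspace_scale)
    then have "d \<le> norm (z - p - a *\<^sub>R s)"
      using d_le[of "p + a *\<^sub>R s"] by (simp add: algebra_simps)
    then have "(norm (z - p))\<^sup>2 \<le> (norm (z - p - a *\<^sub>R s))\<^sup>2"
      using \<open>norm (z - p) \<le> d + 0\<close> by (intro power_mono) auto
    also have "\<dots> = (norm (z - p))\<^sup>2 - 2 * a * r s (z - p) + a\<^sup>2 * (norm s)\<^sup>2"
      unfolding norm_sq_diff[of "z - p"] by (simp add: r_scale_right r_sym[of s] power_mult_distrib)
    also have "\<dots> = (norm (z - p))\<^sup>2 - (r s (z - p))\<^sup>2 / (norm s)\<^sup>2"
      using \<open>s \<noteq> 0\<close> by (simp add: a_def field_simps power2_eq_square)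
    finally show False
      using nz \<open>s \<noteq> 0\<close> by (simp add: divide_le_0_iff)
  qed
  moreover have "z - p \<noteq> 0"
    using z pS by auto
  ultimately show ?thesis
    using that by blast
qed

end

locale max_mono = real_ip r for r :: "'a::banach \<Rightarrow> 'a \<Rightarrow> real" +
  fixes A :: "('a \<times> 'a) set"
  assumes A_zero: "(0, 0) \<in> A"
    and A_add: "(x, u) \<in> A \<Longrightarrow> (y, v) \<in> A \<Longrightarrow> (x + y, u + v) \<in> A"
    and A_scale: "(x, u) \<in> A \<Longrightarrow> (a *\<^sub>R x, a *\<^sub>R u) \<in> A"
    and A_fun: "(x, u) \<in> A \<Longrightarrow> (x, v) \<in> A \<Longrightarrow> u = v"
    and A_mono: "(x, u) \<in> A \<Longrightarrow> 0 \<le> r u x"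
    and A_max: "(\<And>x u. (x, u) \<in> A \<Longrightarrow> 0 \<le> r (u - v) (x - y)) \<Longrightarrow> (y, v) \<in> A"
begin

lemma A_diff: "(x, u) \<in> A \<Longrightarrow> (y, v) \<in> A \<Longrightarrow> (x - y, u - v) \<in> A"
  using A_add[of x u "- y" "- v"] A_scale[of y v "-1"] by simp

lemma A_closed:
  assumes "\<And>n. (x n, u n) \<in> A" "x \<longlonglongrightarrow> y" "u \<longlonglongrightarrow> v"
  shows "(y, v) \<in> A"
proof (rule A_max)
  fix a b assume ab: "(a, b) \<in> A"
  have "(\<lambda>n. r (b - u n) (a - x n)) \<longlonglongrightarrow> r (b - v) (a - y)"
    using assms by (intro tendsto_r tendsto_intros)
  moreover have "r (b - u n) (a - x n) \<ge> 0" for n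
    by (rule A_mono[OF A_diff[OF ab assms(1)]])
  ultimately show "0 \<le> r (b - v) (a - y)"
    by (intro LIMSEQ_le_const) auto
qed

lemma A_lower_bound:
  assumes "(x, u) \<in> A" "k > 0"
  shows "k * norm x \<le> norm (k *\<^sub>R x + u)"
proof (cases "x = 0")
  case False
  have "k * (norm x)\<^sup>2 \<le> r (k *\<^sub>R x + u) x"
    using A_mono[OF assms(1)] by (simp add: r_simps r_norm)
  also have "\<dots> \<le> norm (k *\<^sub>R x + u) * norm x"
    by (rule r_Cauchy_Schwarz)
  finally show ?thesis
    using False by (simp add: power2_eq_square)
qed simp

text \<open>A vector \<open>y\<close> orthogonal to the range of \<open>k + A\<close> makes \<open>(y, k y)\<close> monotonically related to \<open>A\<close>.\<close>

lemma range_plus_A: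
  assumes l: "k > 0"
  shows "\<exists>x u. (x, u) \<in> A \<and> k *\<^sub>R x + u = f"
proof -
  define S where "S = {k *\<^sub>R x + u | x u. (x, u) \<in> A}"
  have "subspace S"
  proof (rule subspaceI)
    show "0 \<in> S"
      unfolding S_def using A_zero by force
    show "a + b \<in> S" if ab: "a \<in> S" "b \<in> S" for a b
    proof -
      obtain x u y v where *: "(x, u) \<in> A" "a = k *\<^sub>R x + u" "(y, v) \<in> A" "b = k *\<^sub>R y + v"
        using ab unfolding S_def by blast
      then have "a + b = k *\<^sub>R (x + y) + (u + v)"
        by (simp add: algebra_simps)
      then show ?thesis
        unfolding S_def using A_add[OF *(1,3)] by blast
    qed
    show "c *\<^sub>R a \<in> S" if a: "a \<in> S" for a c
    proof -
      obtain x u where *: "(x, u) \<in> A" "a = k *\<^sub>R x + u"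
        using a unfolding S_def by blast
      then have "c *\<^sub>R a = k *\<^sub>R (c *\<^sub>R x) + c *\<^sub>R u"
        by (simp add: algebra_simps)
      then show ?thesis
        unfolding S_def using A_scale[OF *(1), of c] by blast
    qed
  qed
  moreover have "closed S"
    unfolding closed_sequential_limits
  proof (intro allI impI)
    fix g l' assume *: "(\<forall>n. g n \<in> S) \<and> g \<longlonglongrightarrow> l'"
    then have "\<forall>n. \<exists>p. p \<in> A \<and> g n = k *\<^sub>R fst p + snd p"
      unfolding S_def by fastforce
    from choice[OF this] obtain p where p: "\<And>n. p n \<in> A" "\<And>n. g n = k *\<^sub>R fst (p n) + snd (p n)"
      by auto
    have lb: "k * norm (fst (p m) - fst (p n)) \<le> norm (g m - g n)" for m n
      using A_lower_bound[OF A_diff[of "fst (p m)" "snd (p m)" "fst (p n)" "snd (p n)"] l] p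
      by (simp add: algebra_simps)
    have "Cauchy g"
      using * LIMSEQ_imp_Cauchy by blast
    have "Cauchy (\<lambda>n. fst (p n))"
    proof (rule metric_CauchyI)
      fix e :: real assume "e > 0"
      then obtain M where "\<forall>m\<ge>M. \<forall>n\<ge>M. dist (g m) (g n) < k * e"
        using metric_CauchyD[OF \<open>Cauchy g\<close>, of "k * e"] l by auto
      then have "k * norm (fst (p m) - fst (p n)) < k * e" if "m \<ge> M" "n \<ge> M" for m n
        using lb[of m n] that by (fastforce simp: dist_norm)
      then show "\<exists>M. \<forall>m\<ge>M. \<forall>n\<ge>M. dist (fst (p m)) (fst (p n)) < e"
        using l by (auto simp: dist_norm)
    qed
    then obtain x where x: "(\<lambda>n. fst (p n)) \<longlonglongrightarrow> x"
      using Cauchy_convergent_iff convergent_def by blast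
    have "(\<lambda>n. g n - k *\<^sub>R fst (p n)) \<longlonglongrightarrow> l' - k *\<^sub>R x"
      using * x by (intro tendsto_intros) auto
    then have lim: "(\<lambda>n. snd (p n)) \<longlonglongrightarrow> l' - k *\<^sub>R x"
      by (simp add: p(2))
    have "(fst (p n), snd (p n)) \<in> A" for n
      using p(1)[of n] by simp
    then have "(x, l' - k *\<^sub>R x) \<in> A"
      by (rule A_closed[OF _ x lim])
    moreover have "l' = k *\<^sub>R x + (l' - k *\<^sub>R x)"
      by simp
    ultimately show "l' \<in> S"
      unfolding S_def by blast
  qed
  moreover have "f \<in> S"
  proof (rule ccontr)
    assume "f \<notin> S"
    with calculation obtain y where y: "y \<noteq> 0" "\<forall>x\<in>S. r x y = 0"
      using orthogonal_vector by blast
    have orth: "r (k *\<^sub>R x + u) y = 0" if "(x, u) \<in> A" for x u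
      using y(2) that unfolding S_def by blast
    have "(y, k *\<^sub>R y) \<in> A"
    proof (rule A_max)
      fix x u assume xu: "(x, u) \<in> A"
      have "r (u - k *\<^sub>R y) (x - y) = r u x + k * (norm y)\<^sup>2"
        using orth[OF xu] by (simp add: r_simps r_norm r_sym[of y x])
      then show "0 \<le> r (u - k *\<^sub>R y) (x - y)"
        using A_mono[OF xu] l by simp
    qed
    from orth[OF this] have "2 * k * (norm y)\<^sup>2 = 0"
      by (simp add: r_simps r_norm)
    then show False
      using y(1) l by simp
  qed
  ultimately show ?thesis
    unfolding S_def by blast
qed

lemma domain_dense: "closure (fst ` A) = UNIV"
proof (rule ccontr)
  assume ne: "closure (fst ` A) \<noteq> UNIV"
  have sub: "subspace (fst ` A)"
  proof (rule subspaceI)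
    show "0 \<in> fst ` A"
      using A_zero by force
    show "a + b \<in> fst ` A" if "a \<in> fst ` A" "b \<in> fst ` A" for a b
      using that A_add by force
    show "c *\<^sub>R a \<in> fst ` A" if "a \<in> fst ` A" for a c
      using that A_scale by force
  qed
  obtain z where "z \<notin> closure (fst ` A)"
    using ne by blast
  then obtain y where y: "y \<noteq> 0" "\<forall>x\<in>closure (fst ` A). r x y = 0"
    using orthogonal_vector[OF subspace_closure[OF sub] closed_closure] by blast
  obtain x u where xu: "(x, u) \<in> A" "1 *\<^sub>R x + u = y"
    using range_plus_A[of 1 y] by auto
  have "x \<in> closure (fst ` A)"
    using xu(1) closure_subset by force
  then have "r x y = 0"
    using y(2) by blast
  then have "(norm x)\<^sup>2 + r u x = 0"
    unfolding xu(2)[symmetric] by (simp add: r_simps r_norm r_sym[of x u])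
  then have "x = 0"
    using A_mono[OF xu(1)] by (simp add: add_nonneg_eq_0_iff)
  then have "u = 0"
    using A_fun[OF xu(1)] A_zero by blast
  then show False
    using \<open>x = 0\<close> xu(2) y(1) by simp
qed

text \<open>For large \<open>l\<close> the map \<open>l - T\<close> has norm below \<open>l\<close>, so \<open>T + A\<close> is a small
  perturbation of \<open>l + A\<close> and Banach's fixed point theorem applies.\<close>

lemma resolvent_exists:
  assumes T: "bounded_linear T" and c: "c > 0" and T_pos: "\<And>x. c * (norm x)\<^sup>2 \<le> r (T x) x"
  obtains R where "bounded_linear R" "\<forall>f. (R f, f - T (R f)) \<in> A"
proof -
  have lower: "c * norm x \<le> norm (T x + u)" if xu: "(x, u) \<in> A" for x u
  proof (cases "x = 0")
    case False
    have "c * (norm x)\<^sup>2 \<le> r (T x + u) x"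
      using A_mono[OF xu] T_pos[of x] by (simp add: r_simps)
    also have "\<dots> \<le> norm (T x + u) * norm x"
      by (rule r_Cauchy_Schwarz)
    finally show ?thesis
      using False by (simp add: power2_eq_square)
  qed simp
  define K where "K = onorm T"
  define l where "l = K\<^sup>2 / c + c"
  define q where "q = sqrt (1 - c / l)"
  have l: "l \<ge> c" "l > 0"
    using c by (auto simp: l_def add_nonneg_pos)
  have q: "0 \<le> q" "q < 1"
    using l c by (auto simp: q_def)
  have contr: "norm (l *\<^sub>R x - T x) \<le> l * q * norm x" for x
  proof (rule power2_le_imp_le)
    have "(norm (T x))\<^sup>2 \<le> (K * norm x)\<^sup>2"
      unfolding K_def by (intro power_mono onorm T) auto
    then have "(norm (l *\<^sub>R x - T x))\<^sup>2 \<le> l\<^sup>2 * (norm x)\<^sup>2 - 2 * (l * (c * (norm x)\<^sup>2)) + K\<^sup>2 * (norm x)\<^sup>2"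
      using mult_left_mono[OF T_pos[of x] less_imp_le[OF l(2)]]
      unfolding norm_sq_diff r_scale r_sym[of x "T x"] by (simp add: power_mult_distrib)
    also have "\<dots> = (l\<^sup>2 - 2 * l * c + K\<^sup>2) * (norm x)\<^sup>2"
      by (simp add: algebra_simps)
    also have "\<dots> \<le> (l\<^sup>2 - l * c) * (norm x)\<^sup>2"
    proof (rule mult_right_mono)
      have "K\<^sup>2 \<le> l * c"
        using c by (simp add: l_def field_simps)
      then show "l\<^sup>2 - 2 * l * c + K\<^sup>2 \<le> l\<^sup>2 - l * c"
        by (simp add: mult.assoc mult.commute[of c])
    qed simp
    also have "\<dots> = (l * q * norm x)\<^sup>2"
    proof -
      have "q\<^sup>2 = 1 - c / l"
        using l c by (simp add: q_def)
      then have "l\<^sup>2 * q\<^sup>2 = l\<^sup>2 - l * c"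
        using l by (simp add: right_diff_distrib power2_eq_square)
      then show ?thesis
        by (simp add: power_mult_distrib)
    qed
    finally show "(norm (l *\<^sub>R x - T x))\<^sup>2 \<le> (l * q * norm x)\<^sup>2" .
    show "0 \<le> l * q * norm x"
      using l q by simp
  qed
  have "\<forall>f. \<exists>x. (x, f - l *\<^sub>R x) \<in> A"
  proof
    fix f
    obtain x u where "(x, u) \<in> A" "l *\<^sub>R x + u = f"
      using range_plus_A[OF l(2)] by blast
    then have "(x, f - l *\<^sub>R x) \<in> A"
      by (metis add_diff_cancel_left')
    then show "\<exists>x. (x, f - l *\<^sub>R x) \<in> A" ..
  qed
  from choice[OF this] obtain J where J: "\<And>f. (J f, f - l *\<^sub>R J f) \<in> A"
    by auto
  have J_lip: "l * norm (J f - J g) \<le> norm (f - g)" for f g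
    using A_lower_bound[OF A_diff[OF J[of f] J[of g]] l(2)] by (simp add: algebra_simps)
  have "\<exists>x. (x, f - T x) \<in> A" for f
  proof -
    have "\<exists>!x. J (f + (l *\<^sub>R x - T x)) = x"
    proof (rule banach_fix_type[OF q], intro allI)
      show "dist (J (f + (l *\<^sub>R x - T x))) (J (f + (l *\<^sub>R y - T y))) \<le> q * dist x y" for x y
      proof -
        have "l * norm (J (f + (l *\<^sub>R x - T x)) - J (f + (l *\<^sub>R y - T y)))
            \<le> norm (l *\<^sub>R (x - y) - T (x - y))"
          using J_lip[of "f + (l *\<^sub>R x - T x)" "f + (l *\<^sub>R y - T y)"]
          by (simp add: linear_diff[OF bounded_linear.linear[OF T]] algebra_simps)
        also have "\<dots> \<le> l * (q * norm (x - y))"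
          using contr[of "x - y"] by simp
        finally show ?thesis
          using l by (simp add: dist_norm)
      qed
    qed
    then obtain x where x: "J (f + (l *\<^sub>R x - T x)) = x"
      by blast
    have "(x, f - T x) \<in> A"
      using J[of "f + (l *\<^sub>R x - T x)"] unfolding x by (simp add: algebra_simps)
    then show ?thesis ..
  qed
  then have "\<forall>f. \<exists>x. (x, f - T x) \<in> A"
    by blast
  from choice[OF this] obtain R where R: "\<And>f. (R f, f - T (R f)) \<in> A"
    by auto
  have lin: "linear T"
    by (rule bounded_linear.linear[OF T])
  have uniq: "x = y" if "(x, f - T x) \<in> A" "(y, f - T y) \<in> A" for x y f
    using lower[OF A_diff[OF that]] c by (simp add: linear_diff[OF lin] mult_le_0_iff)
  have "bounded_linear R"
  proof (rule bounded_linear_intro[of _ "1 / c"])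
    show "R (f + g) = R f + R g" for f g
      by (rule uniq[OF R]) (use A_add[OF R[of f] R[of g]] in \<open>simp add: linear_add[OF lin] algebra_simps\<close>)
    show "R (a *\<^sub>R f) = a *\<^sub>R R f" for a f
      by (rule uniq[OF R]) (use A_scale[OF R[of f], of a] in \<open>simp add: linear_scale[OF lin] algebra_simps\<close>)
    show "norm (R f) \<le> norm f * (1 / c)" for f
      using lower[OF R[of f]] c by (simp add: field_simps)
  qed
  then show ?thesis
    using that R by blast
qed

end

section \<open>The energy estimate\<close>

locale evolution = max_mono r A for r :: "'a::banach \<Rightarrow> 'a \<Rightarrow> real" and A +
  fixes M0 M1 :: "'a \<Rightarrow> 'a" and c h :: real
  assumes M0_bl: "bounded_linear M0" and M1_bl: "bounded_linear M1"
    and M0_sym: "r (M0 x) y = r x (M0 y)" and M0_pos: "0 \<le> r (M0 x) x"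
    and M1_coercive: "c * (norm x)\<^sup>2 \<le> r (M1 x) x"
    and c_gt: "c > 1" and h_neg: "h < 0"
begin

abbreviation q :: "'a \<Rightarrow> real" where
  "q x \<equiv> r (M0 x) x"

lemma M0_linear: "linear M0" and M1_linear: "linear M1"
  using M0_bl M1_bl by (auto intro: bounded_linear.linear)

lemma q_le: "q x \<le> onorm M0 * (norm x)\<^sup>2"
proof -
  have "q x \<le> norm (M0 x) * norm x"
    by (rule r_Cauchy_Schwarz)
  also have "\<dots> \<le> (onorm M0 * norm x) * norm x"
    by (intro mult_right_mono onorm M0_bl) auto
  finally show ?thesis
    by (simp add: power2_eq_square)
qed

lemma M0_polar:
  assumes "a > 0"
  shows "r (M0 x) y \<le> (a * q x + q y / a) / 2"
proof -
  have "0 \<le> q (a *\<^sub>R x - y)"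
    by (rule M0_pos)
  also have "\<dots> = a\<^sup>2 * q x - 2 * a * r (M0 x) y + q y"
    using M0_sym[of y x] r_sym[of y "M0 x"]
    by (simp add: linear_diff[OF M0_linear] linear_scale[OF M0_linear] r_simps power2_eq_square algebra_simps)
  finally show ?thesis
    using assms by (simp add: field_simps power2_eq_square)
qed

lemma pointwise_energy:
  assumes A: "(x, g - (1/\<epsilon>) *\<^sub>R (M0 x - M0 z) - y - M1 x) \<in> A"
    and pos: "\<epsilon> > 0" "\<kappa> > 0" "\<alpha> > 0" "\<beta> > 0"
  shows "c * (norm x)\<^sup>2 + q x / \<epsilon> \<le> (norm g)\<^sup>2 / (2 * \<kappa>) + \<kappa> / 2 * (norm x)\<^sup>2
      + (\<beta> * (norm x)\<^sup>2 + (norm y)\<^sup>2 / \<beta>) / 2 + (\<alpha> * q x + q z / \<alpha>) / (2 * \<epsilon>)"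
proof -
  have young: "a * b \<le> (d * b\<^sup>2 + a\<^sup>2 / d) / 2" if "d > 0" for a b d :: real
  proof -
    have "0 \<le> (d * b - a)\<^sup>2"
      by simp
    then show ?thesis
      using that by (simp add: power2_eq_square field_simps)
  qed
  have "0 \<le> r (g - (1/\<epsilon>) *\<^sub>R (M0 x - M0 z) - y - M1 x) x"
    by (rule A_mono[OF A])
  also have "\<dots> = r g x - (q x - r (M0 z) x) / \<epsilon> - r y x - r (M1 x) x"
    by (simp add: r_simps)
  finally have "r (M1 x) x + q x / \<epsilon> \<le> r g x + r (- y) x + r (M0 z) x / \<epsilon>"
    by (simp add: r_simps diff_divide_distrib)
  moreover have "r g x \<le> (norm g)\<^sup>2 / (2 * \<kappa>) + \<kappa> / 2 * (norm x)\<^sup>2"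
    using r_Cauchy_Schwarz[of g x] young[OF pos(2), of "norm g" "norm x"] by (simp add: add_divide_distrib)
  moreover have "r (- y) x \<le> (\<beta> * (norm x)\<^sup>2 + (norm y)\<^sup>2 / \<beta>) / 2"
    using r_Cauchy_Schwarz[of "- y" x] young[OF pos(4), of "norm y" "norm x"] by simp
  moreover have "r (M0 z) x / \<epsilon> \<le> (\<alpha> * q x + q z / \<alpha>) / (2 * \<epsilon>)"
    using divide_right_mono[OF M0_polar[of "1 / \<alpha>" z x], of \<epsilon>] pos
    by (simp add: mult.commute add.commute)
  ultimately show ?thesis
    using M1_coercive[of x] by linarith
qed

definition trunc_weight :: "real \<Rightarrow> real \<Rightarrow> real \<Rightarrow> real" where
  "trunc_weight \<mu> T t = exp (- 2 * \<mu> * t) * indicator {..T} t"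

lemma trunc_weight_borel [measurable]: "trunc_weight \<mu> T \<in> borel_measurable borel"
  unfolding trunc_weight_def[abs_def] by measurable

lemma trunc_weight_nonneg: "0 \<le> trunc_weight \<mu> T t"
  by (simp add: trunc_weight_def)

lemma trunc_weight_shift:
  assumes "s \<ge> 0"
  shows "trunc_weight \<mu> T t \<le> exp (- 2 * \<mu> * s) * trunc_weight \<mu> T (t - s)"
proof -
  have "exp (- 2 * \<mu> * t) = exp (- 2 * \<mu> * s) * exp (- 2 * \<mu> * (t - s))"
    by (simp add: exp_add[symmetric] algebra_simps)
  then show ?thesis
    using assms by (auto simp: trunc_weight_def indicator_def)
qed

lemma shifted_weight_integral:
  assumes F: "F \<in> borel_measurable borel" "\<And>t. 0 \<le> F t" and s: "s \<ge> 0"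
    and int: "integrable lborel (\<lambda>t. F t * trunc_weight \<mu> T t)"
  shows "integrable lborel (\<lambda>t. F (t - s) * trunc_weight \<mu> T t)"
    and "(\<integral>t. F (t - s) * trunc_weight \<mu> T t \<partial>lborel) \<le>
      exp (- 2 * \<mu> * s) * (\<integral>t. F t * trunc_weight \<mu> T t \<partial>lborel)"
proof -
  let ?G = "\<lambda>t. F t * trunc_weight \<mu> T t"
  have [measurable]: "F \<in> borel_measurable borel"
    by (rule F(1))
  have G: "integrable lborel (\<lambda>t. ?G (t - s))"
    using lborel_integrable_real_affine[OF int, of 1 "- s"] by simp
  then have G': "integrable lborel (\<lambda>t. exp (- 2 * \<mu> * s) * ?G (t - s))"
    by simp
  have le: "F (t - s) * trunc_weight \<mu> T t \<le> exp (- 2 * \<mu> * s) * ?G (t - s)" for t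
    using mult_left_mono[OF trunc_weight_shift[OF s, of \<mu> T t] F(2)[of "t - s"]] by (simp add: algebra_simps)
  show int': "integrable lborel (\<lambda>t. F (t - s) * trunc_weight \<mu> T t)"
  proof (rule Bochner_Integration.integrable_bound[OF G'])
    show "AE t in lborel. norm (F (t - s) * trunc_weight \<mu> T t) \<le> norm (exp (- 2 * \<mu> * s) * ?G (t - s))"
      using le F(2) trunc_weight_nonneg by (intro AE_I2) (simp add: abs_mult)
  qed measurable
  have "(\<integral>t. F (t - s) * trunc_weight \<mu> T t \<partial>lborel) \<le> (\<integral>t. exp (- 2 * \<mu> * s) * ?G (t - s) \<partial>lborel)"
    using le by (intro integral_mono int' G') auto
  also have "\<dots> = exp (- 2 * \<mu> * s) * (\<integral>t. ?G (t - s) \<partial>lborel)"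
    by simp
  also have "(\<integral>t. ?G (t - s) \<partial>lborel) = (\<integral>t. ?G t \<partial>lborel)"
    using lborel_integral_real_affine[of 1 ?G "- s"] by simp
  finally show "(\<integral>t. F (t - s) * trunc_weight \<mu> T t \<partial>lborel) \<le>
      exp (- 2 * \<mu> * s) * (\<integral>t. ?G t \<partial>lborel)" .
qed

lemma energy_estimate:
  fixes u g :: "real \<Rightarrow> 'a"
  assumes u: "u \<in> borel_measurable borel" and g: "g \<in> borel_measurable borel"
    and \<epsilon>: "\<epsilon> > 0" and \<kappa>: "\<kappa> > 0" "\<kappa> \<le> c - exp (\<mu> * h)"
      "\<kappa> + (exp (- \<mu> * \<epsilon>) - 1) / \<epsilon> * onorm M0 \<le> c - exp (\<mu> * h)"
    and eq: "AE t in lborel. t \<le> T \<longrightarrow> (u t, g t - dq \<epsilon> (\<lambda>s. M0 (u s)) t - u (t + h) - M1 (u t)) \<in> A"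
    and fin: "wn (trunc_weight \<mu> T) u < \<infinity>"
  shows "wn (trunc_weight \<mu> T) u \<le> ennreal (1 / \<kappa>\<^sup>2) * wn (trunc_weight \<mu> T) g"
proof (cases "wn (trunc_weight \<mu> T) g = top")
  case True
  then show ?thesis
    using \<kappa>(1) by (simp add: ennreal_mult_top)
next
  case False
  then have g_fin: "wn (trunc_weight \<mu> T) g < \<infinity>"
    by (simp add: less_top)
  let ?w = "trunc_weight \<mu> T"
  have nu [measurable]: "(\<lambda>t. norm (u t)) \<in> borel_measurable borel" "(\<lambda>t. norm (g t)) \<in> borel_measurable borel"
    using borel_measurable_continuous_on[OF _ u, of norm] borel_measurable_continuous_on[OF _ g, of norm]
    by (auto intro: continuous_intros)
  have "continuous_on UNIV q"
    unfolding continuous_on_def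
    by (auto intro!: tendsto_r bounded_linear.tendsto[OF M0_bl] tendsto_ident_at)
  then have qu [measurable]: "(\<lambda>t. q (u t)) \<in> borel_measurable borel"
    by (rule borel_measurable_continuous_on[OF _ u])
  have intI: "integrable lborel (\<lambda>t. (norm (f t))\<^sup>2 * ?w t)"
    and intE: "wn ?w f = ennreal (\<integral>t. (norm (f t))\<^sup>2 * ?w t \<partial>lborel)"
    if [measurable]: "(\<lambda>t. norm (f t)) \<in> borel_measurable borel" and "wn ?w f < \<infinity>" for f :: "real \<Rightarrow> 'a"
  proof -
    show *: "integrable lborel (\<lambda>t. (norm (f t))\<^sup>2 * ?w t)"
      by (rule integrableI_nonneg) (use that(2) in \<open>auto simp: wn_def trunc_weight_nonneg\<close>)
    show "wn ?w f = ennreal (\<integral>t. (norm (f t))\<^sup>2 * ?w t \<partial>lborel)"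
      unfolding wn_def using * by (intro nn_integral_eq_integral) (auto simp: trunc_weight_nonneg)
  qed
  define E where "E = (\<integral>t. (norm (u t))\<^sup>2 * ?w t \<partial>lborel)"
  define G where "G = (\<integral>t. (norm (g t))\<^sup>2 * ?w t \<partial>lborel)"
  define Q where "Q = (\<integral>t. q (u t) * ?w t \<partial>lborel)"
  define Eh where "Eh = (\<integral>t. (norm (u (t - (- h))))\<^sup>2 * ?w t \<partial>lborel)"
  define Q\<epsilon> where "Q\<epsilon> = (\<integral>t. q (u (t - \<epsilon>)) * ?w t \<partial>lborel)"
  have iE: "integrable lborel (\<lambda>t. (norm (u t))\<^sup>2 * ?w t)"
    by (rule intI[OF nu(1) fin])
  have iG: "integrable lborel (\<lambda>t. (norm (g t))\<^sup>2 * ?w t)"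
    by (rule intI[OF nu(2) g_fin])
  have q_le': "q (u t) * ?w t \<le> onorm M0 * ((norm (u t))\<^sup>2 * ?w t)" for t
    using mult_right_mono[OF q_le[of "u t"] trunc_weight_nonneg[of \<mu> T t]] by (simp add: mult.assoc)
  have iQ: "integrable lborel (\<lambda>t. q (u t) * ?w t)"
  proof (rule Bochner_Integration.integrable_bound[of _ "\<lambda>t. onorm M0 * ((norm (u t))\<^sup>2 * ?w t)"])
    show "AE t in lborel. norm (q (u t) * ?w t) \<le> norm (onorm M0 * ((norm (u t))\<^sup>2 * ?w t))"
      using q_le' M0_pos trunc_weight_nonneg onorm_pos_le[OF M0_bl] by (intro AE_I2) (simp add: abs_mult)
  qed (use iE in \<open>auto\<close>)
  have Q_le: "Q \<le> onorm M0 * E"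
  proof -
    have "Q \<le> (\<integral>t. onorm M0 * ((norm (u t))\<^sup>2 * ?w t) \<partial>lborel)"
      unfolding Q_def using q_le' iE by (intro integral_mono iQ) auto
    then show ?thesis
      by (simp add: E_def)
  qed
  have Q0: "0 \<le> Q" and E0: "0 \<le> E" and G0: "0 \<le> G"
    unfolding Q_def E_def G_def using M0_pos trunc_weight_nonneg by (auto intro!: integral_nonneg_AE)
  have "(\<lambda>t. (norm (u t))\<^sup>2) \<in> borel_measurable borel"
    by measurable
  from shifted_weight_integral[OF this _ _ iE, of "- h"] h_neg
  have iEh: "integrable lborel (\<lambda>t. (norm (u (t - (- h))))\<^sup>2 * ?w t)" and Eh: "Eh \<le> exp (2 * \<mu> * h) * E"
    unfolding Eh_def E_def by auto
  from shifted_weight_integral[OF qu _ _ iQ, of \<epsilon>] \<epsilon> M0_pos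
  have iQ\<epsilon>: "integrable lborel (\<lambda>t. q (u (t - \<epsilon>)) * ?w t)" and Q\<epsilon>: "Q\<epsilon> \<le> exp (- 2 * \<mu> * \<epsilon>) * Q"
    unfolding Q\<epsilon>_def Q_def by auto
  define \<alpha> where "\<alpha> = exp (- \<mu> * \<epsilon>)"
  define \<beta> where "\<beta> = exp (\<mu> * h)"
  have ab: "\<alpha> > 0" "\<beta> > 0"
    by (auto simp: \<alpha>_def \<beta>_def)
  have ab2: "exp (2 * \<mu> * h) = \<beta> * \<beta>" "exp (- 2 * \<mu> * \<epsilon>) = \<alpha> * \<alpha>"
    by (auto simp: \<alpha>_def \<beta>_def exp_add[symmetric])
  let ?L = "\<lambda>t. c * ((norm (u t))\<^sup>2 * ?w t) + (q (u t) * ?w t) / \<epsilon>"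
  let ?R = "\<lambda>t. ((norm (g t))\<^sup>2 * ?w t) / (2 * \<kappa>) + \<kappa> / 2 * ((norm (u t))\<^sup>2 * ?w t)
      + (\<beta> * ((norm (u t))\<^sup>2 * ?w t) + ((norm (u (t - (- h))))\<^sup>2 * ?w t) / \<beta>) / 2
      + (\<alpha> * (q (u t) * ?w t) + (q (u (t - \<epsilon>)) * ?w t) / \<alpha>) / (2 * \<epsilon>)"
  have "AE t in lborel. ?L t \<le> ?R t"
    using eq
  proof eventually_elim
    case (elim t)
    show ?case
    proof (cases "t \<le> T")
      case True
      have "c * (norm (u t))\<^sup>2 + q (u t) / \<epsilon> \<le> (norm (g t))\<^sup>2 / (2 * \<kappa>) + \<kappa> / 2 * (norm (u t))\<^sup>2
          + (\<beta> * (norm (u t))\<^sup>2 + (norm (u (t + h)))\<^sup>2 / \<beta>) / 2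
          + (\<alpha> * q (u t) + q (u (t - \<epsilon>)) / \<alpha>) / (2 * \<epsilon>)"
        using elim True \<epsilon> \<kappa>(1) ab by (intro pointwise_energy) (auto simp: dq_def)
      from mult_right_mono[OF this trunc_weight_nonneg[of \<mu> T t]] show ?thesis
        by (simp add: algebra_simps add_divide_distrib)
    next
      case False
      then have "?w t = 0"
        by (simp add: trunc_weight_def)
      then show ?thesis
        by simp
    qed
  qed
  moreover have "has_bochner_integral lborel ?L (c * E + Q / \<epsilon>)"
    unfolding E_def Q_def using iE iQ
    by (intro has_bochner_integral_add has_bochner_integral_mult_right has_bochner_integral_divide)
       (auto simp: has_bochner_integral_integrable)
  moreover have "has_bochner_integral lborel ?R
      (G / (2 * \<kappa>) + \<kappa> / 2 * E + (\<beta> * E + Eh / \<beta>) / 2 + (\<alpha> * Q + Q\<epsilon> / \<alpha>) / (2 * \<epsilon>))"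
    unfolding E_def Q_def G_def Eh_def Q\<epsilon>_def using iE iQ iG iEh iQ\<epsilon>
    by (intro has_bochner_integral_add has_bochner_integral_mult_right has_bochner_integral_divide)
       (auto simp: has_bochner_integral_integrable)
  ultimately have main: "c * E + Q / \<epsilon> \<le>
      G / (2 * \<kappa>) + \<kappa> / 2 * E + (\<beta> * E + Eh / \<beta>) / 2 + (\<alpha> * Q + Q\<epsilon> / \<alpha>) / (2 * \<epsilon>)"
    using integral_mono_AE[of lborel ?L ?R] by (simp only: has_bochner_integral_iff)
  have "Eh / \<beta> \<le> \<beta> * E"
    using Eh ab unfolding ab2 by (simp add: divide_le_eq algebra_simps)
  then have e1: "(\<beta> * E + Eh / \<beta>) / 2 \<le> \<beta> * E"
    by (simp add: mult.commute)
  have "Q\<epsilon> / \<alpha> \<le> \<alpha> * Q"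
    using Q\<epsilon> ab unfolding ab2 by (simp add: divide_le_eq algebra_simps)
  then have "(\<alpha> * Q + Q\<epsilon> / \<alpha>) / (2 * \<epsilon>) \<le> (2 * (\<alpha> * Q)) / (2 * \<epsilon>)"
    using \<epsilon> by (intro divide_right_mono) (auto simp: mult.commute)
  then have e2: "(\<alpha> * Q + Q\<epsilon> / \<alpha>) / (2 * \<epsilon>) \<le> \<alpha> * Q / \<epsilon>"
    by simp
  have e3: "(\<alpha> - 1) / \<epsilon> * Q \<le> (c - \<beta> - \<kappa>) * E"
  proof (cases "\<alpha> \<le> 1")
    case True
    then have "(\<alpha> - 1) / \<epsilon> * Q \<le> 0"
      using \<epsilon> Q0 by (intro mult_nonpos_nonneg divide_nonpos_nonneg) auto
    also have "0 \<le> (c - \<beta> - \<kappa>) * E"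
      using \<kappa>(2) E0 by (simp add: \<beta>_def)
    finally show ?thesis .
  next
    case False
    then have "(\<alpha> - 1) / \<epsilon> * Q \<le> (\<alpha> - 1) / \<epsilon> * (onorm M0 * E)"
      using \<epsilon> by (intro mult_left_mono Q_le) auto
    also have "\<dots> = ((\<alpha> - 1) / \<epsilon> * onorm M0) * E"
      by simp
    also have "\<dots> \<le> (c - \<beta> - \<kappa>) * E"
      using \<kappa>(3) E0 by (intro mult_right_mono) (auto simp: \<alpha>_def \<beta>_def)
    finally show ?thesis .
  qed
  have "(\<alpha> - 1) / \<epsilon> * Q = \<alpha> * Q / \<epsilon> - Q / \<epsilon>"
    by (simp add: diff_divide_distrib algebra_simps)
  moreover have "(c - \<beta> - \<kappa>) * E = c * E - \<beta> * E - \<kappa> * E" "\<kappa> / 2 * E = (\<kappa> * E) / 2"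
    by (simp_all add: algebra_simps)
  ultimately have "\<kappa> / 2 * E \<le> G / (2 * \<kappa>)"
    using main e1 e2 e3 by linarith
  then have "E \<le> G / \<kappa>\<^sup>2"
    using \<kappa>(1) by (simp add: field_simps power2_eq_square)
  then show ?thesis
    unfolding intE[OF nu(1) fin, folded E_def] intE[OF nu(2) g_fin, folded G_def]
    using \<kappa>(1) G0 by (simp add: ennreal_mult[symmetric] ennreal_leI)
qed

lemma energy_estimate_global:
  fixes u g :: "real \<Rightarrow> 'a"
  assumes u: "u \<in> borel_measurable borel" and g: "g \<in> borel_measurable borel"
    and \<epsilon>: "\<epsilon> > 0" and \<kappa>: "\<kappa> > 0" "\<kappa> \<le> c - exp (\<mu> * h)"
      "\<kappa> + (exp (- \<mu> * \<epsilon>) - 1) / \<epsilon> * onorm M0 \<le> c - exp (\<mu> * h)"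
    and eq: "AE t in lborel. (u t, g t - dq \<epsilon> (\<lambda>s. M0 (u s)) t - u (t + h) - M1 (u t)) \<in> A"
    and fin: "\<And>T. wn (trunc_weight \<mu> T) u < \<infinity>"
  shows "wnorm_sq \<mu> u \<le> ennreal (1 / \<kappa>\<^sup>2) * wnorm_sq \<mu> g"
proof -
  have [measurable]: "(\<lambda>t. norm (u t)) \<in> borel_measurable borel"
    using borel_measurable_continuous_on[OF _ u, of norm] by (auto intro: continuous_intros)
  let ?F = "\<lambda>n t. ennreal ((norm (u t))\<^sup>2 * trunc_weight \<mu> (real n) t)"
  have "(\<lambda>n. \<integral>\<^sup>+ t. ?F n t \<partial>lborel) \<longlonglongrightarrow> (\<integral>\<^sup>+ t. ennreal ((norm (u t))\<^sup>2 * exp (- 2 * \<mu> * t)) \<partial>lborel)"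
  proof (rule nn_integral_LIMSEQ)
    show "incseq ?F"
      by (auto simp: incseq_def le_fun_def trunc_weight_def indicator_def)
    show "(\<lambda>n. ?F n t) \<longlonglongrightarrow> ennreal ((norm (u t))\<^sup>2 * exp (- 2 * \<mu> * t))" for t
    proof (rule tendsto_eventually)
      obtain N :: nat where "t < real N"
        using reals_Archimedean2 by blast
      then show "eventually (\<lambda>n. ?F n t = ennreal ((norm (u t))\<^sup>2 * exp (- 2 * \<mu> * t))) sequentially"
        by (intro eventually_sequentiallyI[of N]) (auto simp: trunc_weight_def)
    qed
  qed measurable
  then have "(\<lambda>n. wn (trunc_weight \<mu> (real n)) u) \<longlonglongrightarrow> wnorm_sq \<mu> u"
    by (simp add: wn_def wnorm_sq_def)
  moreover have "wn (trunc_weight \<mu> (real n)) u \<le> ennreal (1 / \<kappa>\<^sup>2) * wnorm_sq \<mu> g" for n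
  proof -
    have "wn (trunc_weight \<mu> (real n)) u \<le> ennreal (1 / \<kappa>\<^sup>2) * wn (trunc_weight \<mu> (real n)) g"
      by (rule energy_estimate[OF u g \<epsilon> \<kappa> _ fin]) (use eq in \<open>eventually_elim, simp\<close>)
    also have "wn (trunc_weight \<mu> (real n)) g \<le> wnorm_sq \<mu> g"
      unfolding wn_def wnorm_sq_def
      by (intro nn_integral_mono ennreal_leI) (auto simp: trunc_weight_def indicator_def)
    finally show ?thesis
      by (simp add: mult_left_mono)
  qed
  ultimately show ?thesis
    by (intro LIMSEQ_le_const2) auto
qed

end

section \<open>The time-discretised equation\<close>

context evolution
begin

context
  fixes \<epsilon> a :: real and R :: "'a \<Rightarrow> 'a"
  assumes \<epsilon>: "\<epsilon> > 0" and R_bl: "bounded_linear R"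
    and R_A: "\<And>y. (R y, y - ((1/\<epsilon>) *\<^sub>R M0 (R y) + M1 (R y))) \<in> A"
begin

primrec picard :: "(real \<Rightarrow> 'a) \<Rightarrow> nat \<Rightarrow> real \<Rightarrow> 'a" where
  "picard f 0 t = 0"
| "picard f (Suc n) t = R (f t - picard f n (t + h) + (1/\<epsilon>) *\<^sub>R M0 (picard f n (t - \<epsilon>)))"

definition step :: real where
  "step = min \<epsilon> (- h)"

text \<open>The iterates are causal: the \<open>n\<close>-th one is final on \<open>t < a + n step\<close>.\<close>

definition sol :: "(real \<Rightarrow> 'a) \<Rightarrow> real \<Rightarrow> 'a" where
  "sol f t = picard f (Suc (nat \<lceil>(t - a) / step\<rceil>)) t"

lemma step_pos: "step > 0" and step_le: "step \<le> \<epsilon>" "step \<le> - h"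
  using \<epsilon> h_neg by (auto simp: step_def)

lemma linear_0s: "R 0 = 0" "M0 0 = 0"
  using linear_0[OF bounded_linear.linear[OF R_bl]] linear_0[OF M0_linear] by auto

lemma picard_zero:
  assumes "\<forall>t<a. f t = 0"
  shows "t < a \<Longrightarrow> picard f n t = 0"
  using assms h_neg \<epsilon> by (induction n arbitrary: t) (auto simp: linear_0s)

lemma picard_stable:
  assumes "\<forall>t<a. f t = 0"
  shows "t < a + real n * step \<Longrightarrow> n \<le> m \<Longrightarrow> picard f m t = picard f n t"
proof (induction n arbitrary: t m)
  case 0
  then show ?case
    using picard_zero[OF assms] by simp
next
  case (Suc n)
  then obtain m' where m: "m = Suc m'" "n \<le> m'"
    by (cases m) auto
  have "t + h < a + real n * step" "t - \<epsilon> < a + real n * step"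
    using Suc.prems(1) step_le by (auto simp: algebra_simps)
  from Suc.IH[OF this(1) m(2)] Suc.IH[OF this(2) m(2)] show ?case
    by (simp add: m(1))
qed

lemma before_step: "t < a + real (Suc (nat \<lceil>(t - a) / step\<rceil>)) * step"
proof -
  have "(t - a) / step \<le> real (nat \<lceil>(t - a) / step\<rceil>)"
    by linarith
  then have "t - a \<le> real (nat \<lceil>(t - a) / step\<rceil>) * step"
    using step_pos by (simp add: divide_le_eq)
  then show ?thesis
    using step_pos by (simp add: algebra_simps)
qed

lemma sol_eq_picard:
  assumes "\<forall>t<a. f t = 0" "t < a + real n * step"
  shows "sol f t = picard f n t"
proof -
  let ?k = "Suc (nat \<lceil>(t - a) / step\<rceil>)"
  have "picard f (max n ?k) t = picard f n t"
    by (rule picard_stable[OF assms]) simp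
  moreover have "picard f (max n ?k) t = picard f ?k t"
    by (rule picard_stable[OF assms(1) before_step]) simp
  ultimately show ?thesis
    by (simp add: sol_def)
qed

lemma sol_zero: "\<forall>t<a. f t = 0 \<Longrightarrow> t < a \<Longrightarrow> sol f t = 0"
  by (simp only: sol_def picard_zero)

lemma sol_equation:
  assumes f: "\<forall>t<a. f t = 0"
  shows "(sol f t, f t - dq \<epsilon> (\<lambda>s. M0 (sol f s)) t - sol f (t + h) - M1 (sol f t)) \<in> A"
proof -
  let ?n = "Suc (nat \<lceil>(t - a) / step\<rceil>)"
  have t: "t < a + real ?n * step"
    by (rule before_step)
  have "t + h < a + real ?n * step" "t - \<epsilon> < a + real ?n * step" "t < a + real (Suc ?n) * step"
    using t h_neg \<epsilon> step_pos by (auto simp: algebra_simps)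
  note eqs = sol_eq_picard[OF f this(1)] sol_eq_picard[OF f this(2)] sol_eq_picard[OF f this(3)]
  have "sol f t = R (f t - sol f (t + h) + (1/\<epsilon>) *\<^sub>R M0 (sol f (t - \<epsilon>)))"
    by (simp only: eqs picard.simps(2))
  with R_A[of "f t - sol f (t + h) + (1/\<epsilon>) *\<^sub>R M0 (sol f (t - \<epsilon>))"] show ?thesis
    by (simp add: dq_def algebra_simps)
qed

lemma has_vector_derivative_shift:
  fixes f :: "real \<Rightarrow> 'a"
  assumes "\<forall>t. (f has_vector_derivative f' t) (at t)"
  shows "((\<lambda>t. f (t + s)) has_vector_derivative f' (t + s)) (at t)"
proof -
  have "((\<lambda>t. t + s) has_real_derivative 1) (at t)"
    by (auto intro!: derivative_eq_intros)
  then show ?thesis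
    using vector_diff_chain_at[of "\<lambda>t. t + s" 1 t f "f' (t + s)"] assms
    by (simp add: o_def has_real_derivative_iff_has_vector_derivative)
qed

lemma picard_deriv:
  assumes "\<forall>t. (f has_vector_derivative f' t) (at t)"
  shows "(picard f n has_vector_derivative picard f' n t) (at t)"
proof (induction n arbitrary: t)
  case 0
  then show ?case
    by (simp add: picard.simps(1)[abs_def])
next
  case (Suc n)
  have "((\<lambda>t. picard f n (t + s)) has_vector_derivative picard f' n (t + s)) (at t)" for s t
    using Suc by (intro has_vector_derivative_shift) auto
  from this[of h] this[of "- \<epsilon>"]
  have "((\<lambda>t. R (f t - picard f n (t + h) + (1/\<epsilon>) *\<^sub>R M0 (picard f n (t + - \<epsilon>)))) has_vector_derivative
      R (f' t - picard f' n (t + h) + (1/\<epsilon>) *\<^sub>R M0 (picard f' n (t + - \<epsilon>)))) (at t)" for t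
    using assms
    by (intro bounded_linear.has_vector_derivative[OF R_bl] has_vector_derivative_add has_vector_derivative_diff
        bounded_linear.has_vector_derivative[OF bounded_linear_scaleR_right]
        bounded_linear.has_vector_derivative[OF M0_bl]) auto
  then show ?case
    by (simp add: picard.simps(2)[abs_def])
qed

lemma sol_deriv:
  assumes f: "\<forall>t. (f has_vector_derivative f' t) (at t)" "\<forall>t<a. f t = 0"
  shows "\<forall>t<a. f' t = 0" "\<forall>t. (sol f has_vector_derivative sol f' t) (at t)"
proof -
  show f': "\<forall>t<a. f' t = 0"
    using deriv_zero_open[OF f(1), of "{..<a}"] f(2) by auto
  show "\<forall>t. (sol f has_vector_derivative sol f' t) (at t)"
  proof
    fix t
    let ?n = "Suc (nat \<lceil>(t - a) / step\<rceil>)"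
    have "(picard f ?n has_vector_derivative picard f' ?n t) (at t)"
      by (rule picard_deriv[OF f(1)])
    then have "(sol f has_vector_derivative picard f' ?n t) (at t)"
      by (rule has_vector_derivative_transform_within_open[of _ _ _ "{..<a + real ?n * step}"])
         (simp_all only: open_lessThan lessThan_iff before_step sol_eq_picard[OF f(2)])
    then show "(sol f has_vector_derivative sol f' t) (at t)"
      by (simp only: sol_eq_picard[OF f' before_step])
  qed
qed

lemma sol_smooth:
  assumes "smooth f" "\<forall>t<a. f t = 0"
  shows "smooth (sol f)"
proof (rule smooth_coinduct[of _ "{sol f | f. smooth f \<and> (\<forall>t<a. f t = 0)}"])
  fix g assume "g \<in> {sol f | f. smooth f \<and> (\<forall>t<a. f t = 0)}"
  then obtain f where f: "g = sol f" "smooth f" "\<forall>t<a. f t = 0"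
    by blast
  obtain f' where f': "smooth f'" "\<forall>t. (f has_vector_derivative f' t) (at t)"
    by (rule smooth_derivE[OF f(2)])
  show "\<exists>g'\<in>{sol f | f. smooth f \<and> (\<forall>t<a. f t = 0)}. \<forall>t. (g has_vector_derivative g' t) (at t)"
    unfolding f(1) using sol_deriv[OF f'(2) f(3)] f'(1) by blast
qed (use assms in blast)

lemma sol_estimate:
  assumes f: "smooth f" "\<forall>t<a. f t = 0"
    and \<kappa>: "\<kappa> > 0" "\<kappa> \<le> c - exp (\<mu> * h)"
      "\<kappa> + (exp (- \<mu> * \<epsilon>) - 1) / \<epsilon> * onorm M0 \<le> c - exp (\<mu> * h)"
  shows "wnorm_sq \<mu> (sol f) \<le> ennreal (1 / \<kappa>\<^sup>2) * wnorm_sq \<mu> f"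
proof (rule energy_estimate_global[OF _ _ \<epsilon> \<kappa>])
  have cont: "continuous_on UNIV (sol f)"
    by (rule smooth_continuous[OF sol_smooth[OF f]])
  then show "sol f \<in> borel_measurable borel"
    by (rule borel_measurable_continuous_onI)
  show "f \<in> borel_measurable borel"
    by (rule borel_measurable_continuous_onI[OF smooth_continuous[OF f(1)]])
  show "AE t in lborel. (sol f t, f t - dq \<epsilon> (\<lambda>s. M0 (sol f s)) t - sol f (t + h) - M1 (sol f t)) \<in> A"
    using sol_equation[OF f(2)] by simp
  show "wn (trunc_weight \<mu> T) (sol f) < \<infinity>" for T
  proof -
    define S where "S = max \<bar>a\<bar> \<bar>T\<bar>"
    have "bounded (sol f ` {- S..S})"
      using continuous_on_subset[OF cont]
      by (intro compact_imp_bounded compact_continuous_image) auto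
    then obtain K where K: "K > 0" "\<forall>x\<in>sol f ` {- S..S}. norm x \<le> K"
      unfolding bounded_pos by blast
    let ?g = "\<lambda>t. indicat_real {..T} t *\<^sub>R sol f t"
    have out: "?g t = 0" if "S < \<bar>t\<bar>" for t
    proof -
      have "t < a \<or> T < t"
        using that by (auto simp: S_def)
      then show ?thesis
        using sol_zero[OF f(2), of t] by (auto simp: indicator_def)
    qed
    have "norm (?g t) \<le> K" for t
    proof (cases "S < \<bar>t\<bar>")
      case True
      then show ?thesis
        unfolding out[OF True] using K(1) by simp
    next
      case False
      then have "t \<in> {- S..S}"
        by auto
      then show ?thesis
        using K by (auto simp: indicator_def)
    qed
    then have "wnorm_sq \<mu> ?g < \<infinity>"
      using out by (rule wnorm_sq_finite_bounded_support)
    moreover have "wnorm_sq \<mu> ?g = wn (trunc_weight \<mu> T) (sol f)"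
      unfolding wnorm_sq_def wn_def
      by (intro nn_integral_cong) (auto simp: trunc_weight_def indicator_def)
    ultimately show ?thesis
      by simp
  qed
qed

end

lemma onorm_M0_nonneg: "0 \<le> onorm M0"
  by (rule onorm_pos_le[OF M0_bl])

lemma coercivity_pos:
  assumes "\<rho> > 0"
  shows "0 < c - exp (\<rho> * h)"
proof -
  have "exp (\<rho> * h) < 1"
    using assms h_neg by (simp add: mult_pos_neg)
  then have "exp (\<rho> * h) < c"
    using c_gt by (rule less_trans)
  then show ?thesis
    by simp
qed

lemma discrete_loss_nonpos:
  assumes "\<rho> > 0" "\<epsilon> > 0"
  shows "\<kappa> + (exp (- \<rho> * \<epsilon>) - 1) / \<epsilon> * onorm M0 \<le> \<kappa>"
proof -
  have "(exp (- \<rho> * \<epsilon>) - 1) / \<epsilon> * onorm M0 \<le> 0"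
    using assms onorm_M0_nonneg by (intro mult_nonpos_nonneg divide_nonpos_pos) auto
  then show ?thesis
    by simp
qed

lemma discrete_solution:
  assumes \<epsilon>: "\<epsilon> > 0" and \<rho>: "\<rho> > 0" and f: "smooth f" "\<forall>t. S < \<bar>t\<bar> \<longrightarrow> f t = 0"
    and f': "\<forall>t. (f has_vector_derivative f' t) (at t)" and f'': "\<forall>t. (f' has_vector_derivative f'' t) (at t)"
    and smf: "smooth f'" "smooth f''"
  obtains u e where "(u, (\<lambda>t. f t + e t)) \<in> B_graph \<rho> h M0 M1 A" "e \<in> Hrho \<rho>"
    "wnorm_sq \<rho> e \<le> ennreal (\<epsilon>\<^sup>2 * (onorm M0)\<^sup>2 / (c - exp (\<rho> * h))\<^sup>2) * wnorm_sq \<rho> f''"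
    "\<forall>\<mu> \<kappa>. \<kappa> > 0 \<longrightarrow> \<kappa> \<le> c - exp (\<mu> * h) \<longrightarrow>
      \<kappa> + (exp (- \<mu> * \<epsilon>) - 1) / \<epsilon> * onorm M0 \<le> c - exp (\<mu> * h) \<longrightarrow>
      wnorm_sq \<mu> u \<le> ennreal (1 / \<kappa>\<^sup>2) * wnorm_sq \<mu> f"
proof -
  obtain R where R: "bounded_linear R" "\<forall>y. (R y, y - ((1/\<epsilon>) *\<^sub>R M0 (R y) + M1 (R y))) \<in> A"
  proof (rule resolvent_exists[of "\<lambda>x. (1/\<epsilon>) *\<^sub>R M0 x + M1 x" c])
    show "bounded_linear (\<lambda>x. (1/\<epsilon>) *\<^sub>R M0 x + M1 x)"
      using M0_bl M1_bl by (intro bounded_linear_add bounded_linear_compose[OF bounded_linear_scaleR_right])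
    show "c > 0"
      using c_gt by simp
    show "c * (norm x)\<^sup>2 \<le> r ((1/\<epsilon>) *\<^sub>R M0 x + M1 x) x" for x
      using M1_coercive[of x] M0_pos[of x] \<epsilon> by (simp add: r_simps add_increasing)
  qed auto
  define a where "a = - \<bar>S\<bar> - 1"
  have f0: "\<forall>t<a. f t = 0"
    using f(2) by (auto simp: a_def)
  note ctx = \<epsilon> R(1) R(2)[rule_format]
  let ?u = "sol \<epsilon> a R f" and ?u' = "sol \<epsilon> a R f'" and ?u'' = "sol \<epsilon> a R f''"
  note d1 = sol_deriv[OF ctx f' f0]
  note d2 = sol_deriv[OF ctx f'' d1(1)]
  note sm = sol_smooth[OF ctx f(1) f0] sol_smooth[OF ctx smf(1) d1(1)] sol_smooth[OF ctx smf(2) d2(1)]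
  define \<kappa> where "\<kappa> = c - exp (\<rho> * h)"
  have \<kappa>: "\<kappa> > 0" "\<kappa> \<le> c - exp (\<rho> * h)"
    using coercivity_pos[OF \<rho>] by (auto simp: \<kappa>_def)
  have \<kappa>3: "\<kappa> + (exp (- \<rho> * \<epsilon>) - 1) / \<epsilon> * onorm M0 \<le> c - exp (\<rho> * h)"
    unfolding \<kappa>_def by (rule discrete_loss_nonpos[OF \<rho> \<epsilon>])
  have outside: "\<forall>t. S < \<bar>t\<bar> \<longrightarrow> f' t = 0" "\<forall>t. S < \<bar>t\<bar> \<longrightarrow> f'' t = 0"
    using deriv_zero_outside[OF f' f(2)] deriv_zero_outside[OF f''] by blast+
  note fH = smooth_compact_Hrho[OF f, of \<rho>] smooth_compact_Hrho[OF smf(1) outside(1), of \<rho>]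
    smooth_compact_Hrho[OF smf(2) outside(2), of \<rho>]
  have uH: "sol \<epsilon> a R g \<in> Hrho \<rho>" if g: "smooth g" "\<forall>t<a. g t = 0" "g \<in> Hrho \<rho>" for g
  proof (rule HrhoI)
    show "strongly_measurable (sol \<epsilon> a R g)"
      by (intro strongly_measurable_continuous smooth_continuous sol_smooth[OF ctx g(1,2)])
    have "wnorm_sq \<rho> (sol \<epsilon> a R g) \<le> ennreal (1 / \<kappa>\<^sup>2) * wnorm_sq \<rho> g"
      by (rule sol_estimate[OF ctx g(1,2) \<kappa> \<kappa>3])
    also have "\<dots> < \<infinity>"
      using g(3) by (auto simp: Hrho_def ennreal_mult_less_top)
    finally show "wnorm_sq \<rho> (sol \<epsilon> a R g) < \<infinity>" .
  qed
  note uH = uH[OF f(1) f0 fH(1)] uH[OF smf(1) d1(1) fH(2)] uH[OF smf(2) d2(1) fH(3)]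
  define e where "e = (\<lambda>t. M0 (?u' t) - dq \<epsilon> (\<lambda>s. M0 (?u s)) t)"
  have M0u: "(\<lambda>t. M0 (?u t)) \<in> Hrho \<rho>" "(\<lambda>t. M0 (?u' t)) \<in> Hrho \<rho>"
    by (intro Hrho_bounded_linear[OF M0_bl] uH)+
  have eH: "e \<in> Hrho \<rho>"
    unfolding e_def by (intro Hrho_diff M0u dq_Hrho)
  have M0d: "\<forall>t. ((\<lambda>t. M0 (?u t)) has_vector_derivative M0 (?u' t)) (at t)"
      "\<forall>t. ((\<lambda>t. M0 (?u' t)) has_vector_derivative M0 (?u'' t)) (at t)"
    using d1(2) d2(2) by (auto intro: bounded_linear.has_vector_derivative[OF M0_bl])
  show ?thesis
  proof (rule that)
    show "e \<in> Hrho \<rho>"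
      by (rule eH)
    have "wnorm_sq \<rho> e \<le> ennreal (\<epsilon>\<^sup>2) * wnorm_sq \<rho> (\<lambda>t. M0 (?u'' t))"
      unfolding e_def using \<rho>
      by (intro dq_error_wnorm_sq_le[OF M0d smooth_continuous[OF smooth_bounded_linear[OF M0_bl sm(3)]] \<epsilon>]) simp
    also have "wnorm_sq \<rho> (\<lambda>t. M0 (?u'' t)) \<le> ennreal ((onorm M0)\<^sup>2) * wnorm_sq \<rho> ?u''"
      by (rule wnorm_sq_bounded_linear_le[OF M0_bl Hrho_strongly_measurable[OF uH(3)]])
    also have "wnorm_sq \<rho> ?u'' \<le> ennreal (1 / \<kappa>\<^sup>2) * wnorm_sq \<rho> f''"
      by (rule sol_estimate[OF ctx smf(2) d2(1) \<kappa> \<kappa>3])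
    also have "ennreal (\<epsilon>\<^sup>2) * (ennreal ((onorm M0)\<^sup>2) * (ennreal (1 / \<kappa>\<^sup>2) * wnorm_sq \<rho> f'')) =
        ennreal (\<epsilon>\<^sup>2 * (onorm M0)\<^sup>2 / (c - exp (\<rho> * h))\<^sup>2) * wnorm_sq \<rho> f''"
      by (simp add: mult.assoc[symmetric] ennreal_mult[symmetric] \<kappa>_def)
    finally show "wnorm_sq \<rho> e \<le> ennreal (\<epsilon>\<^sup>2 * (onorm M0)\<^sup>2 / (c - exp (\<rho> * h))\<^sup>2) * wnorm_sq \<rho> f''"
      by (simp add: mult_left_mono)
    show "\<forall>\<mu> \<kappa>. \<kappa> > 0 \<longrightarrow> \<kappa> \<le> c - exp (\<mu> * h) \<longrightarrow>
      \<kappa> + (exp (- \<mu> * \<epsilon>) - 1) / \<epsilon> * onorm M0 \<le> c - exp (\<mu> * h) \<longrightarrow>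
      wnorm_sq \<mu> ?u \<le> ennreal (1 / \<kappa>\<^sup>2) * wnorm_sq \<mu> f"
      by (intro allI impI sol_estimate[OF ctx f(1) f0])
    define w where "w = (\<lambda>t. f t - dq \<epsilon> (\<lambda>s. M0 (?u s)) t - ?u (t + h) - M1 (?u t))"
    have "w \<in> Hrho \<rho>"
      unfolding w_def by (intro Hrho_diff fH dq_Hrho M0u Hrho_shift uH Hrho_bounded_linear[OF M1_bl])
    moreover have "((\<lambda>t. M0 (?u t)), (\<lambda>t. M0 (?u' t))) \<in> d0_graph \<rho>"
      by (rule smooth_d0_graph[OF smooth_bounded_linear[OF M0_bl sm(1)] M0d(1) M0u])
    moreover have "(?u t, w t) \<in> A" for t
      unfolding w_def by (rule sol_equation[OF ctx f0])
    moreover have "f t + e t = M0 (?u' t) + ?u (t + h) + M1 (?u t) + w t" for t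
      by (simp add: e_def w_def)
    ultimately show "(?u, (\<lambda>t. f t + e t)) \<in> B_graph \<rho> h M0 M1 A"
      unfolding B_graph_def using uH(1) Hrho_add[OF fH(1) eH]
      by (intro CollectI case_prodI conjI exI[of _ "\<lambda>t. M0 (?u' t)"] exI[of _ w]) auto
  qed
qed

end

section \<open>Solution theory\<close>

lemma ennreal_tendsto_le:
  fixes a b :: "nat \<Rightarrow> ennreal"
  assumes "a \<longlonglongrightarrow> 0" "b \<longlonglongrightarrow> 0" "C < \<infinity>" "D < \<infinity>" "\<And>n. x \<le> y + (C * a n + D * b n)"
  shows "x \<le> y"
proof -
  have "(\<lambda>n. y + (C * a n + D * b n)) \<longlonglongrightarrow> y + 0"
    by (intro tendsto_add tendsto_const ennreal_tendsto_0_lincomb assms)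
  then show ?thesis
    using assms(5) by (intro LIMSEQ_le_const[of _ "y"]) auto
qed

lemma wnorm_sq_scaleR_le:
  "strongly_measurable f \<Longrightarrow> wnorm_sq \<rho> (\<lambda>t. k *\<^sub>R f t) \<le> ennreal (k\<^sup>2) * wnorm_sq \<rho> f"
  using wnorm_sq_cmult_le[of f "\<lambda>t. k *\<^sub>R f t" "\<bar>k\<bar>" \<rho>] by simp

lemma wnorm_sq_limit_le:
  fixes un :: "nat \<Rightarrow> real \<Rightarrow> 'a::banach"
  assumes sm: "\<And>n. strongly_measurable (un n)" "strongly_measurable u"
    and lim: "(\<lambda>n. wnorm_sq \<rho> (\<lambda>t. un n t - u t)) \<longlonglongrightarrow> 0" and le: "\<And>n. wnorm_sq \<mu> (un n) \<le> K"
  shows "wnorm_sq \<mu> u \<le> K"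
proof -
  obtain s :: "nat \<Rightarrow> nat" where "AE t in lborel. (\<lambda>n. un (s n) t) \<longlonglongrightarrow> u t"
    by (rule wnorm_sq_tendsto_AE_subseq[OF sm lim])
  then show ?thesis
    by (rule wnorm_sq_Fatou[OF sm(1)]) (rule le)
qed

lemma B_graph_add:
  assumes A_add: "\<And>x u y v. (x, u) \<in> A \<Longrightarrow> (y, v) \<in> A \<Longrightarrow> (x + y, u + v) \<in> A"
    and lin: "linear M0" "linear M1"
    and "(u, f) \<in> B_graph \<rho> h M0 M1 A" "(u', f') \<in> B_graph \<rho> h M0 M1 A"
  shows "((\<lambda>t. u t + u' t), (\<lambda>t. f t + f' t)) \<in> B_graph \<rho> h M0 M1 A"
proof -
  obtain v w where *: "u \<in> Hrho \<rho>" "f \<in> Hrho \<rho>" "((\<lambda>t. M0 (u t)), v) \<in> d0_graph \<rho>" "w \<in> Hrho \<rho>"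
      "AE t in lborel. (u t, w t) \<in> A" "AE t in lborel. f t = v t + u (t + h) + M1 (u t) + w t"
    using assms(4) unfolding B_graph_def by blast
  obtain v' w' where **: "u' \<in> Hrho \<rho>" "f' \<in> Hrho \<rho>" "((\<lambda>t. M0 (u' t)), v') \<in> d0_graph \<rho>" "w' \<in> Hrho \<rho>"
      "AE t in lborel. (u' t, w' t) \<in> A" "AE t in lborel. f' t = v' t + u' (t + h) + M1 (u' t) + w' t"
    using assms(5) unfolding B_graph_def by blast
  have "((\<lambda>t. M0 (u t + u' t)), (\<lambda>t. v t + v' t)) \<in> d0_graph \<rho>"
    using d0_graph_add[OF *(3) **(3)] by (simp add: linear_add[OF lin(1)])
  moreover have "AE t in lborel. (u t + u' t, w t + w' t) \<in> A"
    using *(5) **(5) by eventually_elim (rule A_add)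
  moreover have "AE t in lborel. f t + f' t = (v t + v' t) + (u (t + h) + u' (t + h)) + M1 (u t + u' t) + (w t + w' t)"
    using *(6) **(6) by eventually_elim (simp add: linear_add[OF lin(2)])
  ultimately show ?thesis
    unfolding B_graph_def using Hrho_add[OF *(1) **(1)] Hrho_add[OF *(2) **(2)] Hrho_add[OF *(4) **(4)]
    by blast
qed

lemma B_graph_bounded_linear:
  assumes L: "bounded_linear L" and A_L: "\<And>x u. (x, u) \<in> A \<Longrightarrow> (L x, L u) \<in> A"
    and M0_L: "\<And>x. M0 (L x) = L (M0 x)" and M1_L: "\<And>x. M1 (L x) = L (M1 x)"
    and "(u, f) \<in> B_graph \<rho> h M0 M1 A"
  shows "((\<lambda>t. L (u t)), (\<lambda>t. L (f t))) \<in> B_graph \<rho> h M0 M1 A"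
proof -
  obtain v w where *: "u \<in> Hrho \<rho>" "f \<in> Hrho \<rho>" "((\<lambda>t. M0 (u t)), v) \<in> d0_graph \<rho>" "w \<in> Hrho \<rho>"
      "AE t in lborel. (u t, w t) \<in> A" "AE t in lborel. f t = v t + u (t + h) + M1 (u t) + w t"
    using assms(5) unfolding B_graph_def by blast
  have "((\<lambda>t. M0 (L (u t))), (\<lambda>t. L (v t))) \<in> d0_graph \<rho>"
    using d0_graph_bounded_linear[OF L *(3)] by (simp add: M0_L)
  moreover have "AE t in lborel. (L (u t), L (w t)) \<in> A"
    using *(5) by eventually_elim (rule A_L)
  moreover have "AE t in lborel. L (f t) = L (v t) + L (u (t + h)) + M1 (L (u t)) + L (w t)"
    using *(6) by eventually_elim (simp add: linear_add[OF bounded_linear.linear[OF L]] M1_L)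
  ultimately show ?thesis
    unfolding B_graph_def using Hrho_bounded_linear[OF L *(1)] Hrho_bounded_linear[OF L *(2)] Hrho_bounded_linear[OF L *(4)]
    by blast
qed

lemma B_graph_Hrho:
  "(u, f) \<in> B_graph \<rho> h M0 M1 A \<Longrightarrow> u \<in> Hrho \<rho>" "(u, f) \<in> B_graph \<rho> h M0 M1 A \<Longrightarrow> f \<in> Hrho \<rho>"
  by (auto simp: B_graph_def)

context evolution
begin

lemma B_graph_estimate:
  assumes \<rho>: "\<rho> > 0" and uf: "(u, f) \<in> B_graph \<rho> h M0 M1 A"
  shows "wnorm_sq \<rho> u \<le> ennreal (2 / (c - exp (\<rho> * h))\<^sup>2) * wnorm_sq \<rho> f"
proof (rule ennreal_le_epsilon)
  fix d :: real assume d: "d > 0"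
  define \<kappa> where "\<kappa> = c - exp (\<rho> * h)"
  have \<kappa>: "\<kappa> > 0"
    using coercivity_pos[OF \<rho>] by (simp add: \<kappa>_def)
  obtain v w where *: "u \<in> Hrho \<rho>" "f \<in> Hrho \<rho>" "((\<lambda>t. M0 (u t)), v) \<in> d0_graph \<rho>" "w \<in> Hrho \<rho>"
      "AE t in lborel. (u t, w t) \<in> A" "AE t in lborel. f t = v t + u (t + h) + M1 (u t) + w t"
    using uf unfolding B_graph_def by blast
  have \<eta>: "\<kappa>\<^sup>2 * d / 2 > 0"
    using \<kappa> d by simp
  obtain \<epsilon> where \<epsilon>: "\<epsilon> > 0" "wnorm_sq \<rho> (\<lambda>t. v t - dq \<epsilon> (\<lambda>s. M0 (u s)) t) \<le> ennreal (\<kappa>\<^sup>2 * d / 2)"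
    using d0_graph_dq[OF *(3) less_imp_le[OF \<rho>] \<eta>] by blast
  have smu: "strongly_measurable u" and smf: "strongly_measurable f" and smv: "strongly_measurable v"
    using * by (auto simp: Hrho_def d0_graph_def gclosure_def)
  define e where "e = (\<lambda>t. v t - dq \<epsilon> (\<lambda>s. M0 (u s)) t)"
  have sme: "strongly_measurable e"
    unfolding e_def by (intro strongly_measurable_diff smv dq_strongly_measurable strongly_measurable_bounded_linear[OF M0_bl] smu)
  obtain u' D where u': "u' \<in> borel_measurable borel" "AE t in lborel. u t = u' t"
      "countable D" "range u' \<subseteq> closure D"
    by (rule strongly_measurable_imp_borel[OF smu])
  obtain g D where g: "g \<in> borel_measurable borel" "AE t in lborel. f t - e t = g t"
      "countable D" "range g \<subseteq> closure D"
    by (rule strongly_measurable_imp_borel[OF strongly_measurable_diff[OF smf sme]])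
  have eq: "AE t in lborel. (u' t, g t - dq \<epsilon> (\<lambda>s. M0 (u' s)) t - u' (t + h) - M1 (u' t)) \<in> A"
    using *(5,6) u'(2) g(2) AE_lborel_shift[OF u'(2), of h] AE_lborel_shift[OF u'(2), of "- \<epsilon>"]
  proof eventually_elim
    case (elim t)
    have "g t - dq \<epsilon> (\<lambda>s. M0 (u' s)) t - u' (t + h) - M1 (u' t) = w t"
      using elim by (simp add: e_def dq_def algebra_simps)
    then show ?case
      using elim by simp
  qed
  have \<kappa>3: "\<kappa> + (exp (- \<rho> * \<epsilon>) - 1) / \<epsilon> * onorm M0 \<le> c - exp (\<rho> * h)"
    unfolding \<kappa>_def by (rule discrete_loss_nonpos[OF \<rho> \<epsilon>(1)])
  have eqn: "wnorm_sq \<rho> u = wnorm_sq \<rho> u'" "wnorm_sq \<rho> (\<lambda>t. f t - e t) = wnorm_sq \<rho> g"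
    by (rule wnorm_sq_cong_AE[OF u'(2)] wnorm_sq_cong_AE[OF g(2)])+
  have "wnorm_sq \<rho> u' \<le> ennreal (1 / \<kappa>\<^sup>2) * wnorm_sq \<rho> g"
  proof (rule energy_estimate_global[OF u'(1) g(1) \<epsilon>(1) \<kappa> _ \<kappa>3 eq])
    show "\<kappa> \<le> c - exp (\<rho> * h)"
      by (simp add: \<kappa>_def)
    have "wn (trunc_weight \<rho> T) u' \<le> wnorm_sq \<rho> u'" for T
      unfolding wn_def wnorm_sq_def
      by (intro nn_integral_mono ennreal_leI) (auto simp: trunc_weight_def indicator_def)
    also have "wnorm_sq \<rho> u' < \<infinity>"
      using *(1) eqn by (auto simp: Hrho_def)
    finally show "wn (trunc_weight \<rho> T) u' < \<infinity>" for T .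
  qed
  also have "wnorm_sq \<rho> g \<le> 2 * wnorm_sq \<rho> f + 2 * wnorm_sq \<rho> e"
    unfolding eqn(2)[symmetric] by (rule wnorm_sq_diff_le[OF smf sme])
  also have "\<dots> \<le> 2 * wnorm_sq \<rho> f + 2 * ennreal (\<kappa>\<^sup>2 * d / 2)"
    using \<epsilon>(2) unfolding e_def by (intro add_left_mono mult_left_mono) auto
  also have "ennreal (1 / \<kappa>\<^sup>2) * (2 * wnorm_sq \<rho> f + 2 * ennreal (\<kappa>\<^sup>2 * d / 2)) =
      ennreal (2 / \<kappa>\<^sup>2) * wnorm_sq \<rho> f + ennreal d"
  proof -
    have "ennreal (1 / \<kappa>\<^sup>2) * (ennreal 2 * wnorm_sq \<rho> f) = ennreal (2 / \<kappa>\<^sup>2) * wnorm_sq \<rho> f"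
      unfolding mult.assoc[symmetric] by (subst ennreal_mult[symmetric]) auto
    moreover have "ennreal (1 / \<kappa>\<^sup>2) * (ennreal 2 * ennreal (\<kappa>\<^sup>2 * d / 2)) = ennreal d"
      using \<kappa> d by (subst ennreal_mult[symmetric], simp, simp) (subst ennreal_mult[symmetric], auto)
    ultimately show ?thesis
      by (simp add: distrib_left)
  qed
  finally show "wnorm_sq \<rho> u \<le> ennreal (2 / (c - exp (\<rho> * h))\<^sup>2) * wnorm_sq \<rho> f + ennreal d"
    unfolding \<kappa>_def[symmetric] eqn(1) by (simp add: mult_left_mono)
qed

lemma B_graph_dissipative:
  assumes \<rho>: "\<rho> > 0" and k: "k > 0" and uf: "(u, f) \<in> B_graph \<rho> h M0 M1 A"
  shows "wnorm_sq \<rho> u \<le> 2 * wnorm_sq \<rho> (\<lambda>t. u t + k *\<^sub>R f t)"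
proof -
  have "bounded_linear (\<lambda>x. M1 x + (1/k) *\<^sub>R x)"
    by (intro bounded_linear_add M1_bl bounded_linear_scaleR_right)
  moreover have "(c + 1/k) * (norm x)\<^sup>2 \<le> r (M1 x + (1/k) *\<^sub>R x) x" for x
    using M1_coercive[of x] by (simp add: r_simps r_norm distrib_right)
  moreover have "1 < c + 1/k"
    using c_gt divide_pos_pos[OF zero_less_one k] by linarith
  ultimately interpret E: evolution r A M0 "\<lambda>x. M1 x + (1/k) *\<^sub>R x" "c + 1/k" h
    by (intro evolution.intro max_mono_axioms evolution_axioms.intro M0_bl M0_sym M0_pos h_neg)
  obtain v w where *: "u \<in> Hrho \<rho>" "f \<in> Hrho \<rho>" "((\<lambda>t. M0 (u t)), v) \<in> d0_graph \<rho>" "w \<in> Hrho \<rho>"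
      "AE t in lborel. (u t, w t) \<in> A" "AE t in lborel. f t = v t + u (t + h) + M1 (u t) + w t"
    using uf unfolding B_graph_def by blast
  have "AE t in lborel. f t + (1/k) *\<^sub>R u t = v t + u (t + h) + (M1 (u t) + (1/k) *\<^sub>R u t) + w t"
    using *(6) by eventually_elim simp
  then have "(u, (\<lambda>t. f t + (1/k) *\<^sub>R u t)) \<in> B_graph \<rho> h M0 (\<lambda>x. M1 x + (1/k) *\<^sub>R x) A"
    unfolding B_graph_def using *(1,3,4,5) Hrho_add[OF *(2) Hrho_scaleR[OF *(1)]] by blast
  from E.B_graph_estimate[OF \<rho> this]
  have "wnorm_sq \<rho> u \<le> ennreal (2 / (c + 1/k - exp (\<rho> * h))\<^sup>2) * wnorm_sq \<rho> (\<lambda>t. f t + (1/k) *\<^sub>R u t)" .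
  also have "(\<lambda>t. f t + (1/k) *\<^sub>R u t) = (\<lambda>t. (1/k) *\<^sub>R (u t + k *\<^sub>R f t))"
    using k by (auto simp: algebra_simps)
  also have "wnorm_sq \<rho> (\<lambda>t. (1/k) *\<^sub>R (u t + k *\<^sub>R f t)) \<le> ennreal ((1/k)\<^sup>2) * wnorm_sq \<rho> (\<lambda>t. u t + k *\<^sub>R f t)"
    by (intro wnorm_sq_scaleR_le Hrho_strongly_measurable[OF Hrho_add[OF *(1) Hrho_scaleR[OF *(2)]]])
  also have "ennreal (2 / (c + 1/k - exp (\<rho> * h))\<^sup>2) * (ennreal ((1/k)\<^sup>2) * wnorm_sq \<rho> (\<lambda>t. u t + k *\<^sub>R f t)) =
      ennreal (2 / (c + 1/k - exp (\<rho> * h))\<^sup>2 * (1/k)\<^sup>2) * wnorm_sq \<rho> (\<lambda>t. u t + k *\<^sub>R f t)"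
    unfolding mult.assoc[symmetric] by (subst ennreal_mult[symmetric]) auto
  also have "\<dots> \<le> ennreal 2 * wnorm_sq \<rho> (\<lambda>t. u t + k *\<^sub>R f t)"
  proof (intro mult_right_mono ennreal_leI)
    have "1/k \<le> c + 1/k - exp (\<rho> * h)"
      using coercivity_pos[OF \<rho>] by simp
    then have "(1/k)\<^sup>2 \<le> (c + 1/k - exp (\<rho> * h))\<^sup>2"
      using k by (intro power_mono) auto
    then show "2 / (c + 1/k - exp (\<rho> * h))\<^sup>2 * (1/k)\<^sup>2 \<le> 2"
      using coercivity_pos[OF \<rho>] k by (simp add: divide_le_eq)
  qed auto
  finally show ?thesis
    by (simp add: mult_left_mono)
qed

abbreviation G :: "real \<Rightarrow> ((real \<Rightarrow> 'a) \<times> (real \<Rightarrow> 'a)) set" where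
  "G \<rho> \<equiv> gclosure \<rho> (B_graph \<rho> h M0 M1 A)"

lemma G_add: "(u, f) \<in> G \<rho> \<Longrightarrow> (v, g) \<in> G \<rho> \<Longrightarrow> ((\<lambda>t. u t + v t), (\<lambda>t. f t + g t)) \<in> G \<rho>"
  by (rule gclosure_add[OF B_graph_add[OF A_add M0_linear M1_linear]])

lemma B_scaleR:
  "(u, f) \<in> B_graph \<rho> h M0 M1 A \<Longrightarrow> ((\<lambda>t. k *\<^sub>R u t), (\<lambda>t. k *\<^sub>R f t)) \<in> B_graph \<rho> h M0 M1 A"
  by (rule B_graph_bounded_linear[OF bounded_linear_scaleR_right])
     (auto simp: A_scale linear_scale[OF M0_linear] linear_scale[OF M1_linear])

lemma G_diff:
  assumes "(u, f) \<in> G \<rho>" "(v, g) \<in> G \<rho>"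
  shows "((\<lambda>t. u t - v t), (\<lambda>t. f t - g t)) \<in> G \<rho>"
  using G_add[OF assms(1) gclosure_bounded_linear[OF bounded_linear_scaleR_right B_scaleR assms(2), of "-1"]]
  by simp

definition Cest :: "real \<Rightarrow> ennreal" where
  "Cest \<rho> = 4 * ennreal (2 / (c - exp (\<rho> * h))\<^sup>2)"

lemma Cest_finite: "Cest \<rho> < \<infinity>"
  by (simp add: Cest_def ennreal_mult_less_top)

lemma G_estimate:
  assumes \<rho>: "\<rho> > 0" and uf: "(u, f) \<in> G \<rho>"
  shows "wnorm_sq \<rho> u \<le> Cest \<rho> * wnorm_sq \<rho> f"
proof -
  let ?C = "ennreal (2 / (c - exp (\<rho> * h))\<^sup>2)"
  obtain un fn where *: "u \<in> Hrho \<rho>" "f \<in> Hrho \<rho>"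
      "\<forall>n. (un n, fn n) \<in> B_graph \<rho> h M0 M1 A" "\<forall>n. un n \<in> Hrho \<rho>" "\<forall>n. fn n \<in> Hrho \<rho>"
      "(\<lambda>n. wnorm_sq \<rho> (\<lambda>t. un n t - u t)) \<longlonglongrightarrow> 0" "(\<lambda>n. wnorm_sq \<rho> (\<lambda>t. fn n t - f t)) \<longlonglongrightarrow> 0"
    by (rule gclosureE[OF uf])
  have sm: "strongly_measurable u" "strongly_measurable f" "strongly_measurable (un n)" "strongly_measurable (fn n)" for n
    using * by (auto simp: Hrho_def)
  show ?thesis
  proof (rule ennreal_tendsto_le[OF *(6,7), of 2 "4 * ?C"])
    fix n
    have "wnorm_sq \<rho> u \<le> 2 * wnorm_sq \<rho> (un n) + 2 * wnorm_sq \<rho> (\<lambda>t. un n t - u t)"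
      using wnorm_sq_diff_le[OF sm(3)[of n] strongly_measurable_diff[OF sm(3)[of n] sm(1)], of \<rho>] by simp
    also have "wnorm_sq \<rho> (un n) \<le> ?C * wnorm_sq \<rho> (fn n)"
      using *(3) by (intro B_graph_estimate \<rho>) auto
    also have "wnorm_sq \<rho> (fn n) \<le> 2 * wnorm_sq \<rho> f + 2 * wnorm_sq \<rho> (\<lambda>t. fn n t - f t)"
      using wnorm_sq_add_le[OF sm(2) strongly_measurable_diff[OF sm(4)[of n] sm(2)], of \<rho>] by simp
    finally have "wnorm_sq \<rho> u \<le> 2 * (?C * (2 * wnorm_sq \<rho> f + 2 * wnorm_sq \<rho> (\<lambda>t. fn n t - f t)))
        + 2 * wnorm_sq \<rho> (\<lambda>t. un n t - u t)"
      by (simp add: mult_left_mono)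
    also have "\<dots> = Cest \<rho> * wnorm_sq \<rho> f +
        (2 * wnorm_sq \<rho> (\<lambda>t. un n t - u t) + 4 * ?C * wnorm_sq \<rho> (\<lambda>t. fn n t - f t))"
      by (simp add: Cest_def algebra_simps)
    finally show "wnorm_sq \<rho> u \<le> Cest \<rho> * wnorm_sq \<rho> f +
        (2 * wnorm_sq \<rho> (\<lambda>t. un n t - u t) + 4 * ?C * wnorm_sq \<rho> (\<lambda>t. fn n t - f t))" .
  qed (auto simp: ennreal_mult_less_top)
qed

lemma G_unique_solution:
  assumes \<rho>: "\<rho> > 0" and "(u, f) \<in> G \<rho>" "(v, f) \<in> G \<rho>"
  shows "wnorm_sq \<rho> (\<lambda>t. u t - v t) = 0"
  using G_estimate[OF \<rho> G_diff[OF assms(2,3)]] by (simp add: wnorm_sq_zero)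

lemma tensors_in_domain:
  assumes "x \<in> tensors (fst ` A)"
  shows "\<exists>y. (x, y) \<in> B_graph \<rho> h M0 M1 A"
  using assms
proof induction
  case (base \<phi> S x)
  then obtain z where z: "(x, z) \<in> A"
    by auto
  obtain \<phi>' where \<phi>': "smooth \<phi>'" "\<forall>t. (\<phi> has_vector_derivative \<phi>' t) (at t)"
    by (rule smooth_derivE[OF base(1)])
  have out: "\<forall>t. S < \<bar>t\<bar> \<longrightarrow> \<phi>' t = 0"
    using deriv_zero_outside[OF \<phi>'(2) base(2)] by blast
  have H: "(\<lambda>t. \<psi> t *\<^sub>R y) \<in> Hrho \<rho>" if "smooth \<psi>" "\<forall>t. S < \<bar>t\<bar> \<longrightarrow> \<psi> t = 0" for \<psi> and y :: 'a
    using that by (intro smooth_compact_Hrho[of _ S] smooth_scaleR smooth_const) auto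
  let ?u = "\<lambda>t. \<phi> t *\<^sub>R x"
  have "(\<lambda>t. \<phi> t *\<^sub>R M0 x, \<lambda>t. \<phi>' t *\<^sub>R M0 x) \<in> Cc_deriv_graph"
    unfolding Cc_deriv_graph_iff
  proof (intro conjI allI)
    show "smooth (\<lambda>t. \<phi> t *\<^sub>R M0 x)"
      by (intro smooth_scaleR smooth_const base)
    show "((\<lambda>t. \<phi> t *\<^sub>R M0 x) has_vector_derivative \<phi>' t *\<^sub>R M0 x) (at t)" for t
      using \<phi>'(2) by (auto intro: bounded_linear.has_vector_derivative[OF bounded_linear_scaleR_left])
    show "\<exists>R. \<forall>t. R < \<bar>t\<bar> \<longrightarrow> \<phi> t *\<^sub>R M0 x = 0"
      using base(2) by (intro exI[of _ S]) auto
  qed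
  then have "((\<lambda>t. M0 (?u t)), (\<lambda>t. \<phi>' t *\<^sub>R M0 x)) \<in> d0_graph \<rho>"
    unfolding d0_graph_def linear_scale[OF M0_linear]
    by (intro gclosure_subset H base \<phi>' out)
  moreover have "(\<lambda>t. \<phi> t *\<^sub>R z) \<in> Hrho \<rho>" "?u \<in> Hrho \<rho>"
    by (intro H base)+
  moreover have "(\<lambda>t. \<phi>' t *\<^sub>R M0 x + ?u (t + h) + M1 (?u t) + \<phi> t *\<^sub>R z) \<in> Hrho \<rho>"
    by (intro Hrho_add Hrho_shift[OF H[OF base(1,2), of x], of h] H[OF \<phi>'(1) out] H[OF base(1,2)]
        Hrho_bounded_linear[OF M1_bl])
  moreover have "AE t in lborel. (?u t, \<phi> t *\<^sub>R z) \<in> A"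
    using A_scale[OF z] by simp
  ultimately show ?case
    unfolding B_graph_def
    by (intro exI[of _ "\<lambda>t. \<phi>' t *\<^sub>R M0 x + ?u (t + h) + M1 (?u t) + \<phi> t *\<^sub>R z"] CollectI case_prodI conjI
        exI[of _ "\<lambda>t. \<phi>' t *\<^sub>R M0 x"] exI[of _ "\<lambda>t. \<phi> t *\<^sub>R z"]) auto
next
  case (sum f g)
  then show ?case
    using B_graph_add[OF A_add M0_linear M1_linear] by blast
qed

lemma domain_A_minus: "x \<in> fst ` A \<Longrightarrow> - x \<in> fst ` A"
  using A_scale[of x _ "-1"] by force

lemma tensors_dense_two_weights:
  assumes f: "f \<in> Hrho \<rho>" "f \<in> Hrho \<mu>" and e: "e > 0"
  obtains g where "g \<in> tensors (fst ` A)" "wnorm_sq \<rho> (\<lambda>t. f t - g t) \<le> ennreal e"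
    "wnorm_sq \<mu> (\<lambda>t. f t - g t) \<le> ennreal e"
proof -
  let ?w = "\<lambda>t. exp (- 2 * \<rho> * t) + exp (- 2 * \<mu> * t) :: real"
  have sm: "strongly_measurable f"
    using f by (auto simp: Hrho_def)
  obtain f' D where f': "f' \<in> borel_measurable borel" "AE t in lborel. f t = f' t"
      "countable D" "range f' \<subseteq> closure D"
    by (rule strongly_measurable_imp_borel[OF sm])
  have "wn ?w f = wn ?w f'"
    by (rule wn_cong_AE[OF f'(2)])
  also have "\<dots> = wnorm_sq \<rho> f' + wnorm_sq \<mu> f'"
    unfolding wn_def wnorm_sq_def
    using borel_measurable_norm_sq_weight[OF weight_borel weight_nonneg f'(1)]
    by (subst nn_integral_add[symmetric]) (auto simp: distrib_left intro!: nn_integral_cong)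
  also have "\<dots> < \<infinity>"
    using f wnorm_sq_cong_AE[OF f'(2)] by (auto simp: Hrho_def)
  finally have fin: "wn ?w f < \<infinity>" .
  have "0 \<in> fst ` A"
    using A_zero by force
  moreover have "continuous_on UNIV ?w"
    by (intro continuous_intros)
  ultimately obtain g where g: "g \<in> tensors (fst ` A)" "wn ?w (\<lambda>t. f t - g t) \<le> ennreal e"
    using tensors_dense[of ?w "fst ` A" f e, OF _ _ domain_dense domain_A_minus _ sm fin e] by auto
  have "wnorm_sq \<rho> (\<lambda>t. f t - g t) \<le> wn ?w (\<lambda>t. f t - g t)" "wnorm_sq \<mu> (\<lambda>t. f t - g t) \<le> wn ?w (\<lambda>t. f t - g t)"
    unfolding wn_def wnorm_sq_def by (intro nn_integral_mono ennreal_leI mult_left_mono; simp)+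
  with g show ?thesis
    by (intro that[of g]) (auto intro: order_trans)
qed

text \<open>Lumer--Phillips: a densely defined operator with \<open>\<parallel>u\<parallel> \<le> C \<parallel>u + k B u\<parallel>\<close> for all \<open>k > 0\<close> is closable.\<close>

lemma G_closable:
  assumes \<rho>: "\<rho> > 0" and "(u, f) \<in> G \<rho>" "(u, g) \<in> G \<rho>"
  shows "wnorm_sq \<rho> (\<lambda>t. f t - g t) = 0"
proof -
  define d where "d = (\<lambda>t. f t - g t)"
  have dG: "((\<lambda>t. 0), d) \<in> G \<rho>"
    using G_diff[OF assms(2,3)] by (simp add: d_def)
  obtain un fn where *: "(\<lambda>t. 0::'a) \<in> Hrho \<rho>" "d \<in> Hrho \<rho>"
      "\<forall>n. (un n, fn n) \<in> B_graph \<rho> h M0 M1 A" "\<forall>n. un n \<in> Hrho \<rho>" "\<forall>n. fn n \<in> Hrho \<rho>"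
      "(\<lambda>n. wnorm_sq \<rho> (\<lambda>t. un n t - 0)) \<longlonglongrightarrow> 0" "(\<lambda>n. wnorm_sq \<rho> (\<lambda>t. fn n t - d t)) \<longlonglongrightarrow> 0"
    by (rule gclosureE[OF dG])
  have lim: "(\<lambda>n. wnorm_sq \<rho> (un n)) \<longlonglongrightarrow> 0"
    using *(6) by simp
  have step: "wnorm_sq \<rho> x \<le> 8 * wnorm_sq \<rho> (\<lambda>t. x t + d t + k *\<^sub>R y t)"
    if xy: "(x, y) \<in> B_graph \<rho> h M0 M1 A" and k: "k > 0" for x y k
  proof (rule ennreal_tendsto_le[OF lim *(7), of "18 * ennreal ((1/k)\<^sup>2)" 16])
    fix n
    have H: "x \<in> Hrho \<rho>" "y \<in> Hrho \<rho>" "un n \<in> Hrho \<rho>" "fn n \<in> Hrho \<rho>" "d \<in> Hrho \<rho>"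
      using xy * B_graph_Hrho by blast+
    let ?v = "\<lambda>t. (1/k) *\<^sub>R un n t"
    have vH: "?v \<in> Hrho \<rho>"
      by (rule Hrho_scaleR[OF H(3)])
    note sm = H[THEN Hrho_strongly_measurable] vH[THEN Hrho_strongly_measurable]
    have sum: "((\<lambda>t. x t + ?v t), (\<lambda>t. y t + (1/k) *\<^sub>R fn n t)) \<in> B_graph \<rho> h M0 M1 A"
      by (rule B_graph_add[OF A_add M0_linear M1_linear xy B_scaleR]) (use *(3) in auto)
    have v_le: "wnorm_sq \<rho> ?v \<le> ennreal ((1/k)\<^sup>2) * wnorm_sq \<rho> (un n)"
      by (rule wnorm_sq_scaleR_le[OF sm(3)])
    have z: "(\<lambda>t. x t + d t + k *\<^sub>R y t) \<in> Hrho \<rho>"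
      by (intro Hrho_add Hrho_scaleR H)
    have "wnorm_sq \<rho> (\<lambda>t. x t + ?v t) \<le> 2 * wnorm_sq \<rho> (\<lambda>t. (x t + ?v t) + k *\<^sub>R (y t + (1/k) *\<^sub>R fn n t))"
      by (rule B_graph_dissipative[OF \<rho> k sum])
    also have "(\<lambda>t. (x t + ?v t) + k *\<^sub>R (y t + (1/k) *\<^sub>R fn n t)) =
        (\<lambda>t. (x t + d t + k *\<^sub>R y t) + (?v t + (fn n t - d t)))"
      using k by (auto simp: algebra_simps)
    also have "wnorm_sq \<rho> (\<lambda>t. (x t + d t + k *\<^sub>R y t) + (?v t + (fn n t - d t))) \<le>
        2 * wnorm_sq \<rho> (\<lambda>t. x t + d t + k *\<^sub>R y t) + 2 * wnorm_sq \<rho> (\<lambda>t. ?v t + (fn n t - d t))"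
      by (intro wnorm_sq_add_le strongly_measurable_add strongly_measurable_diff sm Hrho_strongly_measurable[OF z])
    also have "wnorm_sq \<rho> (\<lambda>t. ?v t + (fn n t - d t)) \<le> 2 * wnorm_sq \<rho> ?v + 2 * wnorm_sq \<rho> (\<lambda>t. fn n t - d t)"
      by (intro wnorm_sq_add_le strongly_measurable_diff sm)
    finally have le: "wnorm_sq \<rho> (\<lambda>t. x t + ?v t) \<le> 2 * (2 * wnorm_sq \<rho> (\<lambda>t. x t + d t + k *\<^sub>R y t)
        + 2 * (2 * wnorm_sq \<rho> ?v + 2 * wnorm_sq \<rho> (\<lambda>t. fn n t - d t)))"
      by (simp add: mult_left_mono add_left_mono)
    have "wnorm_sq \<rho> x \<le> 2 * wnorm_sq \<rho> (\<lambda>t. x t + ?v t) + 2 * wnorm_sq \<rho> ?v"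
      using wnorm_sq_diff_le[OF strongly_measurable_add[OF sm(1,6)] sm(6), of \<rho>] by simp
    also have "\<dots> \<le> 2 * (2 * (2 * wnorm_sq \<rho> (\<lambda>t. x t + d t + k *\<^sub>R y t)
        + 2 * (2 * wnorm_sq \<rho> ?v + 2 * wnorm_sq \<rho> (\<lambda>t. fn n t - d t)))) + 2 * wnorm_sq \<rho> ?v"
      by (intro add_right_mono mult_left_mono le) auto
    also have "\<dots> = 8 * wnorm_sq \<rho> (\<lambda>t. x t + d t + k *\<^sub>R y t) +
        (18 * wnorm_sq \<rho> ?v + 16 * wnorm_sq \<rho> (\<lambda>t. fn n t - d t))"
    proof -
      have "2 * (2 * (2 * a + 2 * (2 * b + 2 * e))) + 2 * b = 8 * a + (18 * b + 16 * e)" for a b e :: ennreal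
        by (simp add: algebra_simps) (simp add: distrib_left[symmetric])
      then show ?thesis .
    qed
    also have "\<dots> \<le> 8 * wnorm_sq \<rho> (\<lambda>t. x t + d t + k *\<^sub>R y t) +
        (18 * (ennreal ((1/k)\<^sup>2) * wnorm_sq \<rho> (un n)) + 16 * wnorm_sq \<rho> (\<lambda>t. fn n t - d t))"
      by (intro add_left_mono add_right_mono mult_left_mono v_le) auto
    finally show "wnorm_sq \<rho> x \<le> 8 * wnorm_sq \<rho> (\<lambda>t. x t + d t + k *\<^sub>R y t) +
        (18 * ennreal ((1/k)\<^sup>2) * wnorm_sq \<rho> (un n) + 16 * wnorm_sq \<rho> (\<lambda>t. fn n t - d t))"
      by (simp add: mult.assoc)
  qed (auto simp: ennreal_mult_less_top)
  have step2: "wnorm_sq \<rho> x \<le> 16 * wnorm_sq \<rho> (\<lambda>t. x t + d t)"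
    if xy: "(x, y) \<in> B_graph \<rho> h M0 M1 A" for x y
  proof -
    have H: "x \<in> Hrho \<rho>" "y \<in> Hrho \<rho>"
      using xy B_graph_Hrho by blast+
    note sm = H[THEN Hrho_strongly_measurable] *(2)[THEN Hrho_strongly_measurable]
    have lim0: "(\<lambda>n. ennreal ((inverse (real (Suc n)))\<^sup>2)) \<longlonglongrightarrow> 0"
      using tendsto_ennrealI[OF tendsto_power[OF LIMSEQ_inverse_real_of_nat, of 2]] by simp
    show ?thesis
    proof (rule ennreal_tendsto_le[OF lim0 lim0, of "16 * wnorm_sq \<rho> y" 0])
      fix n
      let ?k = "inverse (real (Suc n))"
      have "wnorm_sq \<rho> x \<le> 8 * wnorm_sq \<rho> (\<lambda>t. x t + d t + ?k *\<^sub>R y t)"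
        by (rule step[OF xy]) simp
      also have "wnorm_sq \<rho> (\<lambda>t. x t + d t + ?k *\<^sub>R y t) \<le>
          2 * wnorm_sq \<rho> (\<lambda>t. x t + d t) + 2 * wnorm_sq \<rho> (\<lambda>t. ?k *\<^sub>R y t)"
        by (intro wnorm_sq_add_le strongly_measurable_add sm Hrho_strongly_measurable[OF Hrho_scaleR[OF H(2)]])
      also have "wnorm_sq \<rho> (\<lambda>t. ?k *\<^sub>R y t) \<le> ennreal (?k\<^sup>2) * wnorm_sq \<rho> y"
        by (rule wnorm_sq_scaleR_le[OF sm(2)])
      finally have "wnorm_sq \<rho> x \<le> 8 * (2 * wnorm_sq \<rho> (\<lambda>t. x t + d t) + 2 * (ennreal (?k\<^sup>2) * wnorm_sq \<rho> y))"
        by (simp add: mult_left_mono add_left_mono)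
      also have "\<dots> = 16 * wnorm_sq \<rho> (\<lambda>t. x t + d t) + (16 * wnorm_sq \<rho> y * ennreal (?k\<^sup>2) + 0 * ennreal (?k\<^sup>2))"
        by (simp add: algebra_simps)
      finally show "wnorm_sq \<rho> x \<le> 16 * wnorm_sq \<rho> (\<lambda>t. x t + d t) + (16 * wnorm_sq \<rho> y * ennreal (?k\<^sup>2) + 0 * ennreal (?k\<^sup>2))" .
    qed (use H(2) in \<open>auto simp: Hrho_def ennreal_mult_less_top\<close>)
  qed
  have "wnorm_sq \<rho> d \<le> 0"
  proof (rule ennreal_le_epsilon)
    fix e :: real assume e: "e > 0"
    have dm: "(\<lambda>t. - d t) \<in> Hrho \<rho>"
      using Hrho_scaleR[OF *(2), of "-1"] by simp
    obtain x where x: "x \<in> tensors (fst ` A)" "wnorm_sq \<rho> (\<lambda>t. - d t - x t) \<le> ennreal (e/34)"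
      using tensors_dense_two_weights[OF dm dm, of "e/34"] e by auto
    obtain y where xy: "(x, y) \<in> B_graph \<rho> h M0 M1 A"
      using tensors_in_domain[OF x(1)] by blast
    have xH: "x \<in> Hrho \<rho>"
      using xy B_graph_Hrho by blast
    have "wnorm_sq \<rho> (\<lambda>t. x t + d t) = wnorm_sq \<rho> (\<lambda>t. x t - - d t)"
      by simp
    then have x2: "wnorm_sq \<rho> (\<lambda>t. x t + d t) \<le> ennreal (e/34)"
      using x(2) by (simp only: wnorm_sq_diff_commute[of _ x])
    have "wnorm_sq \<rho> d \<le> 2 * wnorm_sq \<rho> (\<lambda>t. x t + d t) + 2 * wnorm_sq \<rho> x"
      using wnorm_sq_diff_le[OF Hrho_strongly_measurable[OF Hrho_add[OF xH *(2)]] Hrho_strongly_measurable[OF xH], of \<rho>]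
      by simp
    also have "\<dots> \<le> 2 * ennreal (e/34) + 2 * (16 * ennreal (e/34))"
      by (intro add_mono mult_left_mono x2 order_trans[OF step2[OF xy]]) auto
    also have "\<dots> = 34 * ennreal (e/34)"
      by (simp add: mult.assoc[symmetric] distrib_right[symmetric])
    also have "\<dots> = ennreal (34 * (e/34))"
      using e by (subst ennreal_mult) auto
    finally show "wnorm_sq \<rho> d \<le> 0 + ennreal e"
      by simp
  qed
  then show ?thesis
    by (simp add: d_def)
qed

lemma G_limit:
  assumes \<rho>: "\<rho> > 0" and G: "\<And>n. (un n, fn n) \<in> G \<rho>" and f: "f \<in> Hrho \<rho>"
    and lim: "(\<lambda>n. wnorm_sq \<rho> (\<lambda>t. fn n t - f t)) \<longlonglongrightarrow> 0"
  obtains u where "(u, f) \<in> G \<rho>" "(\<lambda>n. wnorm_sq \<rho> (\<lambda>t. un n t - u t)) \<longlonglongrightarrow> 0"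
proof -
  have H: "un n \<in> Hrho \<rho>" "fn n \<in> Hrho \<rho>" for n
    using gclosure_Hrho[OF G[of n]] by auto
  have sm: "strongly_measurable (un n)" "strongly_measurable (fn n)" "strongly_measurable f" for n
    using H f by (auto simp: Hrho_def)
  have cauchy: "\<exists>N. \<forall>m\<ge>N. \<forall>n\<ge>N. wnorm_sq \<rho> (\<lambda>t. un m t - un n t) \<le> ennreal e" if e: "e > 0" for e
  proof -
    have "(\<lambda>n. Cest \<rho> * wnorm_sq \<rho> (\<lambda>t. fn n t - f t) + 0 * wnorm_sq \<rho> (\<lambda>t. fn n t - f t)) \<longlonglongrightarrow> 0"
      by (intro ennreal_tendsto_0_lincomb lim Cest_finite) auto
    then have "eventually (\<lambda>n. Cest \<rho> * wnorm_sq \<rho> (\<lambda>t. fn n t - f t) < ennreal (e/4)) sequentially"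
      using e by (intro order_tendstoD(2)) auto
    then obtain N where N: "\<And>n. n \<ge> N \<Longrightarrow> Cest \<rho> * wnorm_sq \<rho> (\<lambda>t. fn n t - f t) < ennreal (e/4)"
      by (auto simp: eventually_sequentially)
    have "wnorm_sq \<rho> (\<lambda>t. un m t - un n t) \<le> ennreal e" if mn: "m \<ge> N" "n \<ge> N" for m n
    proof -
      have "wnorm_sq \<rho> (\<lambda>t. un m t - un n t) \<le> Cest \<rho> * wnorm_sq \<rho> (\<lambda>t. fn m t - fn n t)"
        by (rule G_estimate[OF \<rho> G_diff[OF G G]])
      also have "wnorm_sq \<rho> (\<lambda>t. fn m t - fn n t) \<le>
          2 * wnorm_sq \<rho> (\<lambda>t. fn m t - f t) + 2 * wnorm_sq \<rho> (\<lambda>t. f t - fn n t)"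
        by (intro wnorm_sq_dist_triangle sm)
      also have "wnorm_sq \<rho> (\<lambda>t. f t - fn n t) = wnorm_sq \<rho> (\<lambda>t. fn n t - f t)"
        by (rule wnorm_sq_diff_commute)
      finally have "wnorm_sq \<rho> (\<lambda>t. un m t - un n t) \<le>
          Cest \<rho> * (2 * wnorm_sq \<rho> (\<lambda>t. fn m t - f t) + 2 * wnorm_sq \<rho> (\<lambda>t. fn n t - f t))"
        by (simp add: mult_left_mono)
      also have "\<dots> = 2 * (Cest \<rho> * wnorm_sq \<rho> (\<lambda>t. fn m t - f t)) + 2 * (Cest \<rho> * wnorm_sq \<rho> (\<lambda>t. fn n t - f t))"
        by (simp add: distrib_left ac_simps)
      also have "\<dots> \<le> 2 * ennreal (e/4) + 2 * ennreal (e/4)"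
        using N mn by (intro add_mono mult_left_mono less_imp_le) auto
      also have "\<dots> = ennreal e"
        using e by (simp add: ennreal_mult[of 2, simplified, symmetric] ennreal_plus[symmetric] del: ennreal_plus)
      finally show ?thesis .
    qed
    then show ?thesis
      by blast
  qed
  obtain u where u: "strongly_measurable u" "wnorm_sq \<rho> u < \<infinity>" "(\<lambda>n. wnorm_sq \<rho> (\<lambda>t. un n t - u t)) \<longlonglongrightarrow> 0"
    by (rule wnorm_sq_complete[OF sm(1) Hrho_finite[OF H(1)] cauchy])
  have "(u, f) \<in> G \<rho>"
    by (rule gclosure_closed[OF HrhoI[OF u(1,2)] f G u(3) lim])
  then show ?thesis
    using that u(3) by blast
qed

lemma smooth_solution:
  assumes \<rho>: "\<rho> > 0" and f: "smooth f" "\<forall>t. S < \<bar>t\<bar> \<longrightarrow> f t = 0"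
    and \<kappa>: "\<kappa> > 0" "\<kappa> \<le> c - exp (\<mu> * h)" and \<epsilon>0: "\<epsilon>0 > 0"
      "\<And>\<epsilon>. 0 < \<epsilon> \<Longrightarrow> \<epsilon> < \<epsilon>0 \<Longrightarrow> \<kappa> + (exp (- \<mu> * \<epsilon>) - 1) / \<epsilon> * onorm M0 \<le> c - exp (\<mu> * h)"
  shows "\<exists>u. (u, f) \<in> G \<rho> \<and> wnorm_sq \<mu> u \<le> ennreal (1 / \<kappa>\<^sup>2) * wnorm_sq \<mu> f"
proof -
  obtain f' where f': "smooth f'" "\<forall>t. (f has_vector_derivative f' t) (at t)"
    by (rule smooth_derivE[OF f(1)])
  obtain f'' where f'': "smooth f''" "\<forall>t. (f' has_vector_derivative f'' t) (at t)"
    by (rule smooth_derivE[OF f'(1)])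
  have "\<forall>t. S < \<bar>t\<bar> \<longrightarrow> f'' t = 0"
    using deriv_zero_outside[OF f''(2)] deriv_zero_outside[OF f'(2) f(2)] by blast
  then have f''H: "f'' \<in> Hrho \<rho>"
    by (rule smooth_compact_Hrho[OF f''(1)])
  have fH: "f \<in> Hrho \<rho>"
    by (rule smooth_compact_Hrho[OF f])
  define \<epsilon> where "\<epsilon> = (\<lambda>n. \<epsilon>0 / 2 * inverse (real (Suc n)))"
  have \<epsilon>: "\<epsilon> n > 0" "\<epsilon> n < \<epsilon>0" for n
  proof -
    show "\<epsilon> n > 0"
      using \<epsilon>0 by (simp add: \<epsilon>_def)
    have "\<epsilon>0 / 2 * inverse (real (Suc n)) \<le> \<epsilon>0 / 2 * 1"
      using \<epsilon>0(1) by (intro mult_left_mono) (auto simp: inverse_le_1_iff)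
    then show "\<epsilon> n < \<epsilon>0"
      using \<epsilon>0(1) by (simp add: \<epsilon>_def)
  qed
  define K where "K = ennreal ((onorm M0)\<^sup>2 / (c - exp (\<rho> * h))\<^sup>2) * wnorm_sq \<rho> f''"
  have K: "K < \<infinity>"
    using f''H by (auto simp: K_def Hrho_def ennreal_mult_less_top)
  have "\<forall>n. \<exists>p. (fst p, (\<lambda>t. f t + snd p t)) \<in> B_graph \<rho> h M0 M1 A \<and> snd p \<in> Hrho \<rho> \<and>
      wnorm_sq \<rho> (snd p) \<le> K * ennreal ((\<epsilon> n)\<^sup>2) \<and> wnorm_sq \<mu> (fst p) \<le> ennreal (1 / \<kappa>\<^sup>2) * wnorm_sq \<mu> f"
  proof
    fix n
    obtain u e where *: "(u, (\<lambda>t. f t + e t)) \<in> B_graph \<rho> h M0 M1 A" "e \<in> Hrho \<rho>"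
        "wnorm_sq \<rho> e \<le> ennreal ((\<epsilon> n)\<^sup>2 * (onorm M0)\<^sup>2 / (c - exp (\<rho> * h))\<^sup>2) * wnorm_sq \<rho> f''"
        "\<forall>\<mu> \<kappa>. \<kappa> > 0 \<longrightarrow> \<kappa> \<le> c - exp (\<mu> * h) \<longrightarrow>
          \<kappa> + (exp (- \<mu> * \<epsilon> n) - 1) / \<epsilon> n * onorm M0 \<le> c - exp (\<mu> * h) \<longrightarrow>
          wnorm_sq \<mu> u \<le> ennreal (1 / \<kappa>\<^sup>2) * wnorm_sq \<mu> f"
      by (rule discrete_solution[OF \<epsilon>(1)[of n] \<rho> f f'(2) f''(2) f'(1) f''(1)])
    have "ennreal ((\<epsilon> n)\<^sup>2 * (onorm M0)\<^sup>2 / (c - exp (\<rho> * h))\<^sup>2) * wnorm_sq \<rho> f'' = K * ennreal ((\<epsilon> n)\<^sup>2)"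
      by (simp add: K_def ennreal_mult[symmetric] times_divide_eq_right[symmetric] ac_simps
          del: times_divide_eq_right) (simp add: ennreal_mult ac_simps)
    moreover have "wnorm_sq \<mu> u \<le> ennreal (1 / \<kappa>\<^sup>2) * wnorm_sq \<mu> f"
      using *(4) \<kappa> \<epsilon>0(2)[OF \<epsilon>] by blast
    ultimately show "\<exists>p. (fst p, (\<lambda>t. f t + snd p t)) \<in> B_graph \<rho> h M0 M1 A \<and> snd p \<in> Hrho \<rho> \<and>
      wnorm_sq \<rho> (snd p) \<le> K * ennreal ((\<epsilon> n)\<^sup>2) \<and> wnorm_sq \<mu> (fst p) \<le> ennreal (1 / \<kappa>\<^sup>2) * wnorm_sq \<mu> f"
      using *(1-3) by (intro exI[of _ "(u, e)"]) auto
  qed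
  from choice[OF this] obtain p where p: "\<And>n. (fst (p n), (\<lambda>t. f t + snd (p n) t)) \<in> B_graph \<rho> h M0 M1 A"
      "\<And>n. snd (p n) \<in> Hrho \<rho>" "\<And>n. wnorm_sq \<rho> (snd (p n)) \<le> K * ennreal ((\<epsilon> n)\<^sup>2)"
      "\<And>n. wnorm_sq \<mu> (fst (p n)) \<le> ennreal (1 / \<kappa>\<^sup>2) * wnorm_sq \<mu> f"
    by auto
  have G: "(fst (p n), (\<lambda>t. f t + snd (p n) t)) \<in> G \<rho>" for n
    using p(1)[of n] B_graph_Hrho[OF p(1)[of n]] by (rule gclosure_subset)
  have "(\<lambda>n. (\<epsilon> n)\<^sup>2) \<longlonglongrightarrow> (\<epsilon>0 / 2 * 0)\<^sup>2"
    unfolding \<epsilon>_def by (intro tendsto_intros LIMSEQ_inverse_real_of_nat)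
  then have e0: "(\<lambda>n. ennreal ((\<epsilon> n)\<^sup>2)) \<longlonglongrightarrow> 0"
    using tendsto_ennrealI by fastforce
  have "(\<lambda>n. wnorm_sq \<rho> (\<lambda>t. (f t + snd (p n) t) - f t)) \<longlonglongrightarrow> 0"
    by (rule ennreal_squeeze_0[OF ennreal_tendsto_0_lincomb[OF e0 e0 K, of 0]]) (use p(3) in auto)
  from G_limit[OF \<rho> G fH this] obtain u where
      u: "(u, f) \<in> G \<rho>" "(\<lambda>n. wnorm_sq \<rho> (\<lambda>t. fst (p n) t - u t)) \<longlonglongrightarrow> 0"
    by blast
  have "wnorm_sq \<mu> u \<le> ennreal (1 / \<kappa>\<^sup>2) * wnorm_sq \<mu> f"
    by (rule wnorm_sq_limit_le[OF Hrho_strongly_measurable[OF gclosure_Hrho(1)[OF G]]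
          Hrho_strongly_measurable[OF gclosure_Hrho(1)[OF u(1)]] u(2) p(4)])
  with u(1) show ?thesis
    by blast
qed

lemma solution_exists:
  assumes \<rho>: "\<rho> > 0" and f: "f \<in> Hrho \<rho>" "f \<in> Hrho \<mu>"
    and \<kappa>: "\<kappa> > 0" "\<kappa> \<le> c - exp (\<mu> * h)" and \<epsilon>0: "\<epsilon>0 > 0"
      "\<And>\<epsilon>. 0 < \<epsilon> \<Longrightarrow> \<epsilon> < \<epsilon>0 \<Longrightarrow> \<kappa> + (exp (- \<mu> * \<epsilon>) - 1) / \<epsilon> * onorm M0 \<le> c - exp (\<mu> * h)"
  shows "\<exists>u. (u, f) \<in> G \<rho> \<and> u \<in> Hrho \<mu>"
proof -
  have "\<forall>n. \<exists>p. (fst p, snd p) \<in> G \<rho> \<and> wnorm_sq \<rho> (\<lambda>t. snd p t - f t) \<le> ennreal (inverse (real (Suc n))) \<and>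
      wnorm_sq \<mu> (fst p) \<le> ennreal (1 / \<kappa>\<^sup>2) * (2 * wnorm_sq \<mu> f + 2 * ennreal 1)"
  proof
    fix n
    have pos: "inverse (real (Suc n)) > 0"
      by simp
    obtain g where g: "g \<in> tensors (fst ` A)" "wnorm_sq \<rho> (\<lambda>t. f t - g t) \<le> ennreal (inverse (real (Suc n)))"
        "wnorm_sq \<mu> (\<lambda>t. f t - g t) \<le> ennreal (inverse (real (Suc n)))"
      by (rule tensors_dense_two_weights[OF f pos])
    obtain S where S: "\<forall>t. S < \<bar>t\<bar> \<longrightarrow> g t = 0"
      using tensors_support[OF g(1)] by blast
    have smg: "smooth g"
      by (rule tensors_smooth[OF g(1)])
    obtain u where u: "(u, g) \<in> G \<rho>" "wnorm_sq \<mu> u \<le> ennreal (1 / \<kappa>\<^sup>2) * wnorm_sq \<mu> g"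
      using smooth_solution[OF \<rho> smg S \<kappa> \<epsilon>0] by blast
    have "strongly_measurable f" "strongly_measurable g"
      using f strongly_measurable_continuous[OF smooth_continuous[OF smg]] by (auto simp: Hrho_def)
    from wnorm_sq_diff_le[OF this(1) strongly_measurable_diff[OF this], of \<mu>]
    have "wnorm_sq \<mu> g \<le> 2 * wnorm_sq \<mu> f + 2 * wnorm_sq \<mu> (\<lambda>t. f t - g t)"
      by simp
    also have "\<dots> \<le> 2 * wnorm_sq \<mu> f + 2 * ennreal 1"
    proof (intro add_left_mono mult_left_mono order_trans[OF g(3)] ennreal_leI)
      show "inverse (real (Suc n)) \<le> 1"
        by (simp add: inverse_le_1_iff)
    qed simp
    finally have "ennreal (1 / \<kappa>\<^sup>2) * wnorm_sq \<mu> g \<le> ennreal (1 / \<kappa>\<^sup>2) * (2 * wnorm_sq \<mu> f + 2 * ennreal 1)"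
      by (rule mult_left_mono) simp
    then have "wnorm_sq \<mu> u \<le> ennreal (1 / \<kappa>\<^sup>2) * (2 * wnorm_sq \<mu> f + 2 * ennreal 1)"
      by (rule order_trans[OF u(2)])
    moreover have "wnorm_sq \<rho> (\<lambda>t. g t - f t) \<le> ennreal (inverse (real (Suc n)))"
      using g(2) by (simp only: wnorm_sq_diff_commute[of _ g])
    ultimately show "\<exists>p. (fst p, snd p) \<in> G \<rho> \<and> wnorm_sq \<rho> (\<lambda>t. snd p t - f t) \<le> ennreal (inverse (real (Suc n))) \<and>
      wnorm_sq \<mu> (fst p) \<le> ennreal (1 / \<kappa>\<^sup>2) * (2 * wnorm_sq \<mu> f + 2 * ennreal 1)"
      using u(1) by (intro exI[of _ "(u, g)"]) simp
  qed
  from choice[OF this] obtain p where p: "\<And>n. (fst (p n), snd (p n)) \<in> G \<rho>"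
      "\<And>n. wnorm_sq \<rho> (\<lambda>t. snd (p n) t - f t) \<le> ennreal (inverse (real (Suc n)))"
      "\<And>n. wnorm_sq \<mu> (fst (p n)) \<le> ennreal (1 / \<kappa>\<^sup>2) * (2 * wnorm_sq \<mu> f + 2 * ennreal 1)"
    by blast
  have "(\<lambda>n. ennreal (inverse (real (Suc n)))) \<longlonglongrightarrow> 0"
    using tendsto_ennrealI[OF LIMSEQ_inverse_real_of_nat] by simp
  then have "(\<lambda>n. wnorm_sq \<rho> (\<lambda>t. snd (p n) t - f t)) \<longlonglongrightarrow> 0"
    by (rule ennreal_squeeze_0) (rule p(2))
  from G_limit[OF \<rho> p(1) f(1) this] obtain u where
      u: "(u, f) \<in> G \<rho>" "(\<lambda>n. wnorm_sq \<rho> (\<lambda>t. fst (p n) t - u t)) \<longlonglongrightarrow> 0"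
    by blast
  have smu: "strongly_measurable u"
    by (rule Hrho_strongly_measurable[OF gclosure_Hrho(1)[OF u(1)]])
  have "wnorm_sq \<mu> u \<le> ennreal (1 / \<kappa>\<^sup>2) * (2 * wnorm_sq \<mu> f + 2 * ennreal 1)"
    by (rule wnorm_sq_limit_le[OF Hrho_strongly_measurable[OF gclosure_Hrho(1)[OF p(1)]] smu u(2) p(3)])
  also have "\<dots> < \<infinity>"
    using f(2) by (auto simp: Hrho_def ennreal_mult_less_top)
  finally show ?thesis
    using u(1) HrhoI[OF smu] by blast
qed

lemma solution_exists_rho:
  assumes \<rho>: "\<rho> > 0" and f: "f \<in> Hrho \<rho>"
  shows "\<exists>u. (u, f) \<in> G \<rho>"
proof -
  have "\<exists>u. (u, f) \<in> G \<rho> \<and> u \<in> Hrho \<rho>"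
    by (rule solution_exists[OF \<rho> f f coercivity_pos[OF \<rho>] order_refl zero_less_one])
       (rule discrete_loss_nonpos[OF \<rho>])
  then show ?thesis
    by blast
qed

lemma solution_exists_stable:
  assumes \<rho>: "\<rho> > 0" and f: "f \<in> Hrho \<rho>" "f \<in> Hrho (- \<nu>)"
    and \<nu>: "0 \<le> \<nu>" "\<nu> < \<nu>0" and \<nu>0: "\<nu>0 * onorm M0 + exp (- \<nu>0 * h) = c"
  shows "\<exists>u. (u, f) \<in> G \<rho> \<and> u \<in> Hrho (- \<nu>)"
proof -
  define \<kappa> where "\<kappa> = (c - exp (- \<nu> * h) - \<nu> * onorm M0) / 2"
  have "exp (- \<nu> * h) < exp (- \<nu>0 * h)"
    using \<nu>(2) h_neg by simp
  moreover have "\<nu> * onorm M0 \<le> \<nu>0 * onorm M0"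
    using \<nu>(2) onorm_M0_nonneg by (intro mult_right_mono) auto
  ultimately have "exp (- \<nu> * h) + \<nu> * onorm M0 < exp (- \<nu>0 * h) + \<nu>0 * onorm M0"
    by (rule add_less_le_mono)
  also have "\<dots> = c"
    using \<nu>0 by (simp only: add.commute)
  finally have \<kappa>: "\<kappa> > 0"
    by (simp add: \<kappa>_def)
  have "((\<lambda>\<epsilon>. exp (\<nu> * \<epsilon>)) has_real_derivative \<nu>) (at 0)"
    by (auto intro!: derivative_eq_intros)
  then have "((\<lambda>\<epsilon>. (exp (\<nu> * \<epsilon>) - 1) / \<epsilon>) \<longlongrightarrow> \<nu>) (at 0)"
    by (simp add: has_field_derivative_iff)
  then have "((\<lambda>\<epsilon>. (exp (\<nu> * \<epsilon>) - 1) / \<epsilon> * onorm M0) \<longlongrightarrow> \<nu> * onorm M0) (at 0)"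
    by (intro tendsto_intros)
  then have "eventually (\<lambda>\<epsilon>. (exp (\<nu> * \<epsilon>) - 1) / \<epsilon> * onorm M0 < \<nu> * onorm M0 + \<kappa>) (at 0)"
    using \<kappa> by (intro order_tendstoD(2)) auto
  then obtain \<epsilon>0 where \<epsilon>0: "\<epsilon>0 > 0"
      "\<And>\<epsilon>. \<epsilon> \<noteq> 0 \<Longrightarrow> \<bar>\<epsilon>\<bar> < \<epsilon>0 \<Longrightarrow> (exp (\<nu> * \<epsilon>) - 1) / \<epsilon> * onorm M0 < \<nu> * onorm M0 + \<kappa>"
    by (auto simp: eventually_at)
  show ?thesis
  proof (rule solution_exists[OF \<rho> f \<kappa> _ \<epsilon>0(1)])
    have "0 \<le> \<nu> * onorm M0"
      using \<nu>(1) onorm_M0_nonneg by simp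
    then show "\<kappa> \<le> c - exp (- \<nu> * h)"
      using \<kappa> by (simp add: \<kappa>_def)
    fix \<epsilon> :: real assume "0 < \<epsilon>" "\<epsilon> < \<epsilon>0"
    then have "(exp (\<nu> * \<epsilon>) - 1) / \<epsilon> * onorm M0 < \<nu> * onorm M0 + \<kappa>"
      by (intro \<epsilon>0(2)) auto
    then show "\<kappa> + (exp (- (- \<nu>) * \<epsilon>) - 1) / \<epsilon> * onorm M0 \<le> c - exp (- \<nu> * h)"
      by (simp add: \<kappa>_def field_simps)
  qed
qed

end

lemma chilbertD:
  assumes "chilbert sc ip"
  shows "vector_space sc" "sc (complex_of_real k) x = k *\<^sub>R x" "ip (x + y) z = ip x z + ip y z"
    "ip (sc a x) y = a * ip x y" "ip y x = cnj (ip x y)" "ip x x = complex_of_real ((norm x)\<^sup>2)"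
  using assms unfolding chilbert_def by blast+

lemma chilbert_bounded_linear:
  assumes hilb: "chilbert sc ip"
  shows "bounded_linear (sc a)"
proof -
  interpret vector_space sc
    by (rule chilbertD(1)[OF hilb])
  have n: "norm (sc a x) = norm x * cmod a" for x
  proof -
    have "ip (sc a x) (sc a x) = a * cnj (a * ip x x)"
      by (simp only: chilbertD(4)[OF hilb, of a x "sc a x"] chilbertD(5)[OF hilb, of x "sc a x"]
          chilbertD(4)[OF hilb, of a x x])
    then have "complex_of_real ((norm (sc a x))\<^sup>2) = (a * cnj a) * complex_of_real ((norm x)\<^sup>2)"
      unfolding chilbertD(6)[OF hilb] by (simp add: mult.assoc)
    also have "\<dots> = complex_of_real ((cmod a)\<^sup>2 * (norm x)\<^sup>2)"
      by (simp add: complex_norm_square[symmetric])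
    finally have "(norm (sc a x))\<^sup>2 = (norm x * cmod a)\<^sup>2"
      by (simp only: of_real_eq_iff power_mult_distrib mult.commute)
    then show ?thesis
      by (simp add: power2_eq_iff_nonneg)
  qed
  show ?thesis
  proof (rule bounded_linear_intro[of _ "cmod a"])
    show "sc a (x + y) = sc a x + sc a y" for x y
      by (rule scale_right_distrib)
    show "sc a (k *\<^sub>R x) = k *\<^sub>R sc a x" for k x
      unfolding chilbertD(2)[OF hilb, symmetric] by (rule scale_left_commute)
  qed (simp add: n)
qed

theorem theorem4p4:
  fixes sc :: "complex \<Rightarrow> 'a::banach \<Rightarrow> 'a"
    and ip :: "'a \<Rightarrow> 'a \<Rightarrow> complex"
    and A :: "('a \<times> 'a) set"
    and M0 M1 :: "'a \<Rightarrow> 'a"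
    and c h \<nu>0 :: real
  assumes hilb: "chilbert sc ip"
    and A_lin: "linear_operator sc A"
    and A_mm: "maximal_monotone ip A"
    and M0_bdd: "bounded_clinear_op sc M0"
    and M0_sa: "\<forall>x y. ip (M0 x) y = ip x (M0 y)"
    and M0_nonneg: "\<forall>x. Re (ip (M0 x) x) \<ge> 0"
    and M1_bdd: "bounded_clinear_op sc M1"
    and M1_pos: "\<forall>x. Re (ip (M1 x) x) \<ge> c * (norm x)\<^sup>2"
    and c_gt: "c > 1"
    and h_neg: "h < 0"
    and nu0_pos: "\<nu>0 > 0"
    and nu0_eq: "\<nu>0 * onorm M0 + exp (- \<nu>0 * h) = c"
  shows "\<forall>\<rho>>0. \<exists>S. bdd_inverse \<rho> sc (gclosure \<rho> (B_graph \<rho> h M0 M1 A)) S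
                   \<and> exp_stable \<rho> \<nu>0 S"
proof (intro allI impI)
  fix \<rho> :: real assume \<rho>: "\<rho> > 0"
  define r where "r = (\<lambda>x y. Re (ip x y))"
  note scR = chilbertD(2)[OF hilb]
  interpret real_ip r
  proof
    show "r (x + y) z = r x z + r y z" for x y z
      by (simp add: chilbertD(3)[OF hilb] r_def)
    show "r (k *\<^sub>R x) y = k * r x y" for k x y
      using chilbertD(4)[OF hilb, of "complex_of_real k" x y] by (simp add: r_def scR)
    show "r x y = r y x" for x y
      unfolding r_def chilbertD(5)[OF hilb, of y x] by simp
    show "r x x = (norm x)\<^sup>2" for x
      by (simp add: chilbertD(6)[OF hilb] r_def)
  qed
  have A0: "(0, 0) \<in> A"
    and A_add: "\<And>x u y v. (x, u) \<in> A \<Longrightarrow> (y, v) \<in> A \<Longrightarrow> (x + y, u + v) \<in> A"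
    and A_sc: "\<And>a x u. (x, u) \<in> A \<Longrightarrow> (sc a x, sc a u) \<in> A"
    and A_fun: "\<And>x u v. (x, u) \<in> A \<Longrightarrow> (x, v) \<in> A \<Longrightarrow> u = v"
    using A_lin unfolding linear_operator_def by blast+
  have mono: "0 \<le> r (u - v) (x - y)" if "(x, u) \<in> A" "(y, v) \<in> A" for x u y v
    using A_mm that unfolding maximal_monotone_def monotone_rel_def r_def by blast
  interpret max_mono r A
  proof
    show "(k *\<^sub>R x, k *\<^sub>R u) \<in> A" if "(x, u) \<in> A" for k x u
      using A_sc[OF that, of "complex_of_real k"] by (simp add: scR)
    show "0 \<le> r u x" if "(x, u) \<in> A" for x u
      using mono[OF that A0] by simp
    show "(y, v) \<in> A" if rel: "\<And>x u. (x, u) \<in> A \<Longrightarrow> 0 \<le> r (u - v) (x - y)" for y v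
    proof -
      have "monotone_rel ip (insert (y, v) A)"
        unfolding monotone_rel_def r_def[symmetric]
      proof (intro allI impI)
        fix x1 u1 x2 u2 assume "(x1, u1) \<in> insert (y, v) A" "(x2, u2) \<in> insert (y, v) A"
        moreover have "r (v - u) (y - x) = r (u - v) (x - y)" for x u
          by (simp add: r_simps)
        ultimately have "0 \<le> r (u1 - u2) (x1 - x2)"
          using mono[of x1 u1 x2 u2] rel[of x1 u1] rel[of x2 u2] by (auto simp: r_zero)
        then show "0 \<le> Re (ip (u1 - u2) (x1 - x2))"
          by (simp add: r_def)
      qed
      then have "insert (y, v) A = A"
        using A_mm unfolding maximal_monotone_def by blast
      then show ?thesis
        by blast
    qed
  qed (fact A0 A_add A_fun)+
  have "bounded_linear M0" "bounded_linear M1"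
    using M0_bdd M1_bdd by (auto simp: bounded_clinear_op_def)
  moreover have "r (M0 x) y = r x (M0 y)" "0 \<le> r (M0 x) x" "c * (norm x)\<^sup>2 \<le> r (M1 x) x" for x y
    using M0_sa M0_nonneg M1_pos by (simp_all add: r_def)
  ultimately interpret evolution r A M0 M1 c h
    by (intro evolution.intro max_mono_axioms evolution_axioms.intro c_gt h_neg)
  have M_sc: "M0 (sc a x) = sc a (M0 x)" "M1 (sc a x) = sc a (M1 x)" for a x
    using M0_bdd M1_bdd unfolding bounded_clinear_op_def
    by (simp_all add: Vector_Spaces.linear_iff)
  have G_sc: "((\<lambda>t. sc a (u t)), (\<lambda>t. sc a (f t))) \<in> G \<rho>" if "(u, f) \<in> G \<rho>" for a u f
  proof (rule gclosure_bounded_linear[OF chilbert_bounded_linear[OF hilb] _ that])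
    show "((\<lambda>t. sc a (u t)), (\<lambda>t. sc a (f t))) \<in> B_graph \<rho> h M0 M1 A"
      if "(u, f) \<in> B_graph \<rho> h M0 M1 A" for u f
      by (rule B_graph_bounded_linear[OF chilbert_bounded_linear[OF hilb] _ _ _ that]) (fact A_sc M_sc)+
  qed
  define S where "S = (\<lambda>f. SOME u. (u, f) \<in> G \<rho>)"
  have S: "(S f, f) \<in> G \<rho>" if "f \<in> Hrho \<rho>" for f :: "real \<Rightarrow> 'a"
    unfolding S_def by (rule someI_ex[OF solution_exists_rho[OF \<rho> that]])
  have SH: "S f \<in> Hrho \<rho>" if "f \<in> Hrho \<rho>" for f :: "real \<Rightarrow> 'a"
    by (rule gclosure_Hrho(1)[OF S[OF that]])
  have uniq: "nrm \<rho> (\<lambda>t. u t - v t) = 0" if "(u, f) \<in> G \<rho>" "(v, f) \<in> G \<rho>" for u v f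
    using G_unique_solution[OF \<rho> that] by (simp add: nrm_def)
  have "bdd_inverse \<rho> sc (G \<rho>) S"
    unfolding bdd_inverse_def
  proof (intro conjI ballI allI impI)
    show "S f \<in> Hrho \<rho>" if "f \<in> Hrho \<rho>" for f :: "real \<Rightarrow> 'a"
      by (rule SH[OF that])
    show "nrm \<rho> (\<lambda>t. S (\<lambda>s. sc a (f s) + g s) t - (sc a (S f t) + S g t)) = 0"
      if "f \<in> Hrho \<rho>" "g \<in> Hrho \<rho>" for f g :: "real \<Rightarrow> 'a" and a
    proof (rule uniq)
      show "(S (\<lambda>s. sc a (f s) + g s), (\<lambda>s. sc a (f s) + g s)) \<in> G \<rho>"
        by (intro S Hrho_add Hrho_bounded_linear[OF chilbert_bounded_linear[OF hilb]] that)
      show "((\<lambda>t. sc a (S f t) + S g t), (\<lambda>s. sc a (f s) + g s)) \<in> G \<rho>"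
        by (intro G_add G_sc S that)
    qed
    show "\<exists>C. \<forall>f\<in>Hrho \<rho>. nrm \<rho> (S f) \<le> C * nrm \<rho> f"
    proof (intro exI ballI)
      fix f :: "real \<Rightarrow> 'a" assume f: "f \<in> Hrho \<rho>"
      have "enn2real (wnorm_sq \<rho> (S f)) \<le> enn2real (Cest \<rho> * wnorm_sq \<rho> f)"
        using G_estimate[OF \<rho> S[OF f]] Cest_finite[of \<rho>] Hrho_finite[OF f]
        by (intro enn2real_mono) (auto simp: ennreal_mult_less_top)
      then have "sqrt (enn2real (wnorm_sq \<rho> (S f))) \<le> sqrt (enn2real (Cest \<rho>) * enn2real (wnorm_sq \<rho> f))"
        by (simp add: enn2real_mult)
      then show "nrm \<rho> (S f) \<le> sqrt (enn2real (Cest \<rho>)) * nrm \<rho> f"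
        by (simp add: nrm_def real_sqrt_mult)
    qed
    show "((u, f) \<in> G \<rho>) = (u \<in> Hrho \<rho> \<and> f \<in> Hrho \<rho> \<and> nrm \<rho> (\<lambda>t. u t - S f t) = 0)" for u f
    proof
      assume uf: "(u, f) \<in> G \<rho>"
      then show "u \<in> Hrho \<rho> \<and> f \<in> Hrho \<rho> \<and> nrm \<rho> (\<lambda>t. u t - S f t) = 0"
        using gclosure_Hrho[OF uf] uniq[OF uf S] by blast
    next
      assume *: "u \<in> Hrho \<rho> \<and> f \<in> Hrho \<rho> \<and> nrm \<rho> (\<lambda>t. u t - S f t) = 0"
      then have d: "(\<lambda>t. u t - S f t) \<in> Hrho \<rho>"
        by (intro Hrho_diff SH) auto
      have "AE t in lborel. u t - S f t = 0"
        using * nrm_eq_0_iff[OF d] by (intro wnorm_sq_eq_0_imp_AE[OF Hrho_strongly_measurable[OF d]]) auto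
      then have "AE t in lborel. S f t = u t"
        by eventually_elim simp
      then show "(u, f) \<in> G \<rho>"
        using gclosure_cong_AE[OF S] * by blast
    qed
    show "nrm \<rho> (\<lambda>t. f t - g t) = 0" if "(u, f) \<in> G \<rho>" "(u, g) \<in> G \<rho>" for u f g
      using G_closable[OF \<rho> that] by (simp add: nrm_def)
  qed
  moreover have "exp_stable \<rho> \<nu>0 S"
    unfolding exp_stable_def
  proof (intro conjI allI impI nu0_pos)
    fix \<nu> \<mu> :: real and f :: "real \<Rightarrow> 'a"
    assume \<nu>: "0 \<le> \<nu> \<and> \<nu> < \<nu>0" and f: "f \<in> Hrho (- \<nu>) \<and> f \<in> Hrho \<rho>" and \<mu>: "- \<nu> < \<mu> \<and> \<mu> \<le> \<rho>"
    obtain u where u: "(u, f) \<in> G \<rho>" "u \<in> Hrho (- \<nu>)"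
      using solution_exists_stable[OF \<rho> _ _ _ _ nu0_eq] \<nu> f by blast
    have Sf: "(S f, f) \<in> G \<rho>"
      using f by (intro S) auto
    have "strongly_measurable (\<lambda>t. u t - S f t)"
      using Hrho_diff[OF gclosure_Hrho(1)[OF u(1)] gclosure_Hrho(1)[OF Sf]] by (rule Hrho_strongly_measurable)
    from wnorm_sq_eq_0_imp_AE[OF this G_unique_solution[OF \<rho> u(1) Sf]]
    have "AE t in lborel. u t = S f t"
      by eventually_elim simp
    then have "S f \<in> Hrho (- \<nu>)"
      using u(2) by (rule Hrho_cong_AE)
    then show "S f \<in> Hrho \<mu>"
      using SH[of f] f \<mu> by (intro Hrho_interpolate[of "S f" "- \<nu>" \<rho> \<mu>]) auto
  qed
  ultimately show "\<exists>S. bdd_inverse \<rho> sc (G \<rho>) S \<and> exp_stable \<rho> \<nu>0 S"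
    by blast
qed

end
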